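(* Let $\mathcal{H}_1$ and $\mathcal{H}_2$ be infinite dimensional separable complex Hilbert spaces, let $\mathcal{H}=\mathcal{H}_1\otimes\mathcal{H}_2$, and let $\rho_i\in \mathrm{S}_{+,1}(\mathcal{H}_i)$ for $i=1,2$. Define $f:\mathrm{T}(\mathcal{H})\to[0,\infty)$ by $$f(X)=\|\mathrm{Tr}_2 X-\rho_1\|_1+\|\mathrm{Tr}_1 X-\rho_2\|_1 ,$$ which is a convex function that is Lipschitz with respect to $\|\cdot\|_1$. Let $\mathcal{X}\subset\mathcal{H}$ be an infinite dimensional closed subspace with an orthonormal basis $\mathbf{x}_i$, $i\in\mathbb{N}$, and let $\mathcal{X}_n$ be the subspace spanned by $\mathbf{x}_1,\ldots,\mathbf{x}_n$ for $n\in\mathbb{N}$. For $n\in\mathbb{N}$ let $$\mu_n(\rho_1,\rho_2)=\inf\{f(X):\ X\in \mathrm{S}_+(\mathcal{X}_n)\}.$$ Then this infimum is attained at some $X_n\in \mathrm{S}_+(\mathcal{X}_n)$ which satisfies $\|X_n\|\le 2$. Moreover, there exists $\rho\in \mathrm{S}_{+,1}(\mathcal{H})$ with $\operatorname{supp}\rho\subseteq\mathcal{X}$ such that $\mathrm{Tr}_2\rho=\rho_1$ and $\mathrm{Tr}_1\rho=\rho_2$ if and only if $$\lim_{n\to\infty}\mu_n(\rho_1,\rho_2)=0.$$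
   Context: For a separable complex Hilbert space $\mathcal{H}$: $\|\cdot\|$ is the operator norm; $\mathrm{T}(\mathcal{H})$ is the Banach space of trace class operators with trace norm $\|\cdot\|_1$ (sum of singular values); $\mathrm{S}_+(\mathcal{H})$ is the cone of bounded selfadjoint positive semidefinite operators; $\mathrm{S}_{+,1}(\mathcal{H})$ is the set of positive semidefinite trace class operators of trace $1$ (density operators). The support $\operatorname{supp}\rho$ is the closure of the range of $\rho$. For a closed subspace $\mathcal{Y}\subseteq\mathcal{H}$, operators on $\mathcal{Y}$ are identified with the operators $L$ on $\mathcal{H}$ satisfying $L(\mathcal{Y})\subseteq\mathcal{Y}$ and $L(\mathcal{Y}^\perp)=0$; in particular $\mathrm{S}_+(\mathcal{X}_n)$ is the set of positive semidefinite operators on $\mathcal{H}$ with support contained in $\mathcal{X}_n$. Inner products are linear in the first argument, and $\mathbf{x}\mathbf{y}^\vee$ denotes the operator $\mathbf{z}\mapsto\langle\mathbf{z},\mathbf{y}\rangle\mathbf{x}$. The partial traces $\mathrm{Tr}_1:\mathrm{T}(\mathcal{H}_1\otimes\mathcal{H}_2)\to\mathrm{T}(\mathcal{H}_2)$ and $\mathrm{Tr}_2:\mathrm{T}(\mathcal{H}_1\otimes\mathcal{H}_2)\to\mathrm{T}(\mathcal{H}_1)$ are the unique bounded linear maps with $\mathrm{Tr}_1((\mathbf{x}\otimes\mathbf{y})(\mathbf{u}\otimes\mathbf{v})^\vee)=\langle\mathbf{x},\mathbf{u}\rangle\,\mathbf{y}\mathbf{v}^\vee$ and $\mathrm{Tr}_2((\mathbf{x}\otimes\mathbf{y})(\mathbf{u}\otimes\mathbf{v})^\vee)=\langle\mathbf{y},\mathbf{v}\rangle\,\mathbf{x}\mathbf{u}^\vee$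 (so $\mathrm{Tr}_i$ traces out the $i$-th factor). *)

theory Defs
  imports "HOL-Analysis.Analysis"
begin

section \<open>Complex Hilbert spaces\<close>

text \<open>The inner product \<^term>\<open>cinner\<close> is linear in its first argument.  The underlying real
  Hilbert space structure (hence norm and topology) is the one induced by \<^term>\<open>cinner\<close>.\<close>

class chilbert_space = real_inner + banach +
  fixes scaleC :: "complex \<Rightarrow> 'a \<Rightarrow> 'a"  (infixr \<open>*\<^sub>C\<close> 75)
    and cinner :: "'a \<Rightarrow> 'a \<Rightarrow> complex"
  assumes scaleC_add_right: "c *\<^sub>C (x + y) = c *\<^sub>C x + c *\<^sub>C y"
    and scaleC_add_left: "(c + d) *\<^sub>C x = c *\<^sub>C x + d *\<^sub>C x"
    and scaleC_scaleC: "c *\<^sub>C (d *\<^sub>C x) = (c * d) *\<^sub>C x"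
    and scaleR_scaleC: "r *\<^sub>R x = complex_of_real r *\<^sub>C x"
    and cinner_commute: "cinner x y = cnj (cinner y x)"
    and cinner_add_left: "cinner (x + y) z = cinner x z + cinner y z"
    and cinner_scaleC_left: "cinner (c *\<^sub>C x) y = c * cinner x y"
    and Re_cinner: "Re (cinner x y) = x \<bullet> y"

lemma scaleC_one: "1 *\<^sub>C (x :: 'a :: chilbert_space) = x"
  using scaleR_scaleC[of 1 x] by simp

global_interpretation complex_vector:
  vector_space "scaleC :: complex \<Rightarrow> 'a \<Rightarrow> 'a :: chilbert_space"
  by unfold_locales (simp_all add: scaleC_add_right scaleC_add_left scaleC_scaleC scaleC_one)

lemma cinner_self: "cinner x x = complex_of_real ((norm x)\<^sup>2)"
proof (rule complex_eqI)
  show "Im (cinner x x) = Im (complex_of_real ((norm x)\<^sup>2))"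
    using arg_cong[OF cinner_commute[of x x], of Im] by simp
qed (simp add: Re_cinner power2_norm_eq_inner)

lemma norm_scaleC: "norm (c *\<^sub>C (x :: 'a :: chilbert_space)) = norm c * norm x"
proof -
  have "cinner (c *\<^sub>C x) (c *\<^sub>C x) = c * cnj c * cinner x x"
    using cinner_commute[of x "c *\<^sub>C x"] by (simp add: cinner_scaleC_left flip: cinner_commute)
  also have "\<dots> = complex_of_real ((norm c * norm x)\<^sup>2)"
    by (simp add: cinner_self power_mult_distrib complex_norm_square[symmetric] flip: of_real_power)
  finally have "(norm (c *\<^sub>C x))\<^sup>2 = (norm c * norm x)\<^sup>2"
    unfolding cinner_self of_real_eq_iff .
  then show ?thesis
    by (simp add: power2_eq_iff_nonneg)
qed

lemma norm_cinner_le: "norm (cinner x y) \<le> norm x * norm y"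
proof (cases "cinner x y = 0")
  case False
  define c where "c = cnj (sgn (cinner x y))"
  have n: "norm c = 1" using False by (simp add: c_def norm_sgn)
  have "c * cinner x y = complex_of_real (norm (cinner x y))"
    using False complex_norm_square[of "cinner x y"]
    by (simp add: c_def sgn_eq power2_eq_square field_simps)
  then have "norm (cinner x y) = (c *\<^sub>C x) \<bullet> y"
    by (metis Re_cinner cinner_scaleC_left Re_complex_of_real)
  also have "\<dots> \<le> norm (c *\<^sub>C x) * norm y" by (rule norm_cauchy_schwarz)
  finally show ?thesis by (simp add: norm_scaleC n)
qed simp

text \<open>Complex dimension, for linear subspaces.\<close>

definition infinite_dimensional :: "'a :: chilbert_space set \<Rightarrow> bool" where
  "infinite_dimensional V \<longleftrightarrow> \<not> (\<exists>B. finite B \<and> complex_vector.span B = V)"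

definition orthonormal_set :: "'a :: chilbert_space set \<Rightarrow> bool" where
  "orthonormal_set B \<longleftrightarrow> (\<forall>x\<in>B. \<forall>y\<in>B. cinner x y = (if x = y then 1 else 0))"

definition is_onb :: "'a :: chilbert_space set \<Rightarrow> bool" where
  "is_onb B \<longleftrightarrow> orthonormal_set B \<and> closure (complex_vector.span B) = UNIV"

definition onb_sequence_of :: "(nat \<Rightarrow> 'a :: chilbert_space) \<Rightarrow> 'a set \<Rightarrow> bool" where
  "onb_sequence_of x V \<longleftrightarrow>
     (\<forall>i j. cinner (x i) (x j) = (if i = j then 1 else 0)) \<and>
     closure (complex_vector.span (range x)) = V"


section \<open>Operators\<close>

text \<open>Bounded operators are elements of \<^typ>\<open>'a \<Rightarrow>\<^sub>L 'a\<close>, whose norm is the operator norm, that are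
  complex linear.\<close>

definition clinear_op :: "('a :: chilbert_space \<Rightarrow>\<^sub>L 'b :: chilbert_space) \<Rightarrow> bool" where
  "clinear_op T \<longleftrightarrow> Vector_Spaces.linear scaleC scaleC (blinfun_apply T)"

lift_definition scaleC_op ::
  "complex \<Rightarrow> ('a :: chilbert_space \<Rightarrow>\<^sub>L 'b :: chilbert_space) \<Rightarrow> ('a \<Rightarrow>\<^sub>L 'b)"
  is "\<lambda>c T z. c *\<^sub>C T z"
proof -
  fix c :: complex and T :: "'a \<Rightarrow> 'b"
  assume T: "bounded_linear T"
  have "bounded_linear (\<lambda>z :: 'b. c *\<^sub>C z)"
    by (rule bounded_linear_intro[where K = "norm c"])
       (simp_all add: scaleC_add_right scaleR_scaleC scaleC_scaleC norm_scaleC mult.commute)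
  from bounded_linear_compose[OF this T] show "bounded_linear (\<lambda>z. c *\<^sub>C T z)" .
qed

text \<open>\<open>rank_one x y\<close> is the operator mapping \<open>z\<close> to \<open>\<langle>z, y\<rangle> x\<close>.\<close>

lift_definition rank_one :: "'a :: chilbert_space \<Rightarrow> 'b :: chilbert_space \<Rightarrow> ('b \<Rightarrow>\<^sub>L 'a)"
  is "\<lambda>x y z. cinner z y *\<^sub>C x"
proof (rule bounded_linear_intro)
  fix x :: 'a and y z :: 'b
  show "norm (cinner z y *\<^sub>C x) \<le> norm z * (norm y * norm x)"
    using mult_right_mono[OF norm_cinner_le[of z y], of "norm x"]
    by (simp add: norm_scaleC mult.assoc)
qed (simp_all add: cinner_add_left scaleC_add_left scaleR_scaleC cinner_scaleC_left scaleC_scaleC)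

definition cadjoint :: "('a :: chilbert_space \<Rightarrow>\<^sub>L 'b :: chilbert_space) \<Rightarrow> ('b \<Rightarrow>\<^sub>L 'a)" where
  "cadjoint T = (THE S :: 'b \<Rightarrow>\<^sub>L 'a. \<forall>x y. cinner (T x) y = cinner x (S y))"

definition compact_op :: "('a :: chilbert_space \<Rightarrow>\<^sub>L 'b :: chilbert_space) \<Rightarrow> bool" where
  "compact_op T \<longleftrightarrow> compact (closure (blinfun_apply T ` cball 0 1))"

text \<open>The singular values of a compact operator \<open>T\<close> are the \<open>\<sigma> > 0\<close> such that \<open>\<sigma>\<^sup>2\<close> is an
  eigenvalue of \<open>T\<^sup>* T\<close>, counted with multiplicity (which is finite by compactness).\<close>

definition singular_multiplicity ::
    "('a :: chilbert_space \<Rightarrow>\<^sub>L 'b :: chilbert_space) \<Rightarrow> real \<Rightarrow> nat" where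
  "singular_multiplicity T \<sigma> =
     complex_vector.dim {z. (cadjoint T o\<^sub>L T) z = complex_of_real (\<sigma>\<^sup>2) *\<^sub>C z}"

definition trace_class :: "('a :: chilbert_space \<Rightarrow>\<^sub>L 'a) set" where
  "trace_class = {T. clinear_op T \<and> compact_op T \<and>
     (\<lambda>\<sigma>. \<sigma> * real (singular_multiplicity T \<sigma>)) summable_on {0<..}}"

definition trace_norm :: "('a :: chilbert_space \<Rightarrow>\<^sub>L 'a) \<Rightarrow> real" where
  "trace_norm T = (\<Sum>\<^sub>\<infinity>\<sigma>\<in>{0<..}. \<sigma> * real (singular_multiplicity T \<sigma>))"

text \<open>For trace class operators the value does not depend on the chosen orthonormal basis.\<close>

definition trace_op :: "('a :: chilbert_space \<Rightarrow>\<^sub>L 'a) \<Rightarrow> complex" where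
  "trace_op T = (\<Sum>\<^sub>\<infinity>e\<in>(SOME B. is_onb B). cinner (T e) e)"

definition psd_op :: "('a :: chilbert_space \<Rightarrow>\<^sub>L 'a) \<Rightarrow> bool" where
  "psd_op T \<longleftrightarrow> clinear_op T \<and> (\<forall>x y. cinner (T x) y = cinner x (T y)) \<and>
     (\<forall>x. 0 \<le> Re (cinner (T x) x))"

definition supp_op :: "('a :: chilbert_space \<Rightarrow>\<^sub>L 'a) \<Rightarrow> 'a set" where
  "supp_op T = closure (range (blinfun_apply T))"

definition psd_cone :: "'a :: chilbert_space set \<Rightarrow> ('a \<Rightarrow>\<^sub>L 'a) set" where
  "psd_cone V = {T. psd_op T \<and> supp_op T \<subseteq> V}"

definition density_ops :: "('a :: chilbert_space \<Rightarrow>\<^sub>L 'a) set" where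
  "density_ops = {T. psd_op T \<and> T \<in> trace_class \<and> trace_op T = 1}"


section \<open>Tensor products and partial traces\<close>

text \<open>\<open>hilbert_tensor t\<close> says that \<^typ>\<open>'c\<close>, together with \<open>t x y = x \<otimes> y\<close>, is a Hilbert
  space tensor product of \<^typ>\<open>'a\<close> and \<^typ>\<open>'b\<close>; this determines it up to a unique unitary
  commuting with the tensor maps.\<close>

definition hilbert_tensor ::
    "('a :: chilbert_space \<Rightarrow> 'b :: chilbert_space \<Rightarrow> 'c :: chilbert_space) \<Rightarrow> bool" where
  "hilbert_tensor t \<longleftrightarrow>
     (\<forall>y. Vector_Spaces.linear scaleC scaleC (\<lambda>x. t x y)) \<and>
     (\<forall>x. Vector_Spaces.linear scaleC scaleC (\<lambda>y. t x y)) \<and>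
     (\<forall>x y u v. cinner (t x y) (t u v) = cinner x u * cinner y v) \<and>
     closure (complex_vector.span {t x y | x y. True}) = UNIV"

text \<open>Bounded complex linear maps between the Banach spaces of trace class operators.  They are
  represented by functions vanishing outside \<^term>\<open>trace_class\<close>, so that equality of maps on
  \<^term>\<open>trace_class\<close> is equality of functions.\<close>

definition trace_bounded_linear ::
    "(('a :: chilbert_space \<Rightarrow>\<^sub>L 'a) \<Rightarrow> ('b :: chilbert_space \<Rightarrow>\<^sub>L 'b)) \<Rightarrow> bool" where
  "trace_bounded_linear \<Phi> \<longleftrightarrow>
     (\<forall>X\<in>trace_class. \<Phi> X \<in> trace_class) \<and>
     (\<forall>X\<in>trace_class. \<forall>Y\<in>trace_class. \<Phi> (X + Y) = \<Phi> X + \<Phi> Y) \<and>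
     (\<forall>c. \<forall>X\<in>trace_class. \<Phi> (scaleC_op c X) = scaleC_op c (\<Phi> X)) \<and>
     (\<exists>K. \<forall>X\<in>trace_class. trace_norm (\<Phi> X) \<le> K * trace_norm X) \<and>
     (\<forall>X. X \<notin> trace_class \<longrightarrow> \<Phi> X = 0)"

text \<open>\<open>partial_trace1\<close> traces out the first factor, \<open>partial_trace2\<close> the second one.\<close>

definition partial_trace1 ::
    "('a :: chilbert_space \<Rightarrow> 'b :: chilbert_space \<Rightarrow> 'c :: chilbert_space)
       \<Rightarrow> ('c \<Rightarrow>\<^sub>L 'c) \<Rightarrow> ('b \<Rightarrow>\<^sub>L 'b)" where
  "partial_trace1 t = (THE \<Phi>. trace_bounded_linear \<Phi> \<and>
     (\<forall>x y u v. \<Phi> (rank_one (t x y) (t u v)) = scaleC_op (cinner x u) (rank_one y v)))"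

definition partial_trace2 ::
    "('a :: chilbert_space \<Rightarrow> 'b :: chilbert_space \<Rightarrow> 'c :: chilbert_space)
       \<Rightarrow> ('c \<Rightarrow>\<^sub>L 'c) \<Rightarrow> ('a \<Rightarrow>\<^sub>L 'a)" where
  "partial_trace2 t = (THE \<Phi>. trace_bounded_linear \<Phi> \<and>
     (\<forall>x y u v. \<Phi> (rank_one (t x y) (t u v)) = scaleC_op (cinner y v) (rank_one x u)))"

definition marginal_defect ::
    "('a :: chilbert_space \<Rightarrow> 'b :: chilbert_space \<Rightarrow> 'c :: chilbert_space)
       \<Rightarrow> ('a \<Rightarrow>\<^sub>L 'a) \<Rightarrow> ('b \<Rightarrow>\<^sub>L 'b) \<Rightarrow> ('c \<Rightarrow>\<^sub>L 'c) \<Rightarrow> real" where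
  "marginal_defect t \<rho>1 \<rho>2 X =
     trace_norm (partial_trace2 t X - \<rho>1) + trace_norm (partial_trace1 t X - \<rho>2)"

definition min_marginal_defect ::
    "('a :: chilbert_space \<Rightarrow> 'b :: chilbert_space \<Rightarrow> 'c :: chilbert_space)
       \<Rightarrow> ('a \<Rightarrow>\<^sub>L 'a) \<Rightarrow> ('b \<Rightarrow>\<^sub>L 'b) \<Rightarrow> 'c set \<Rightarrow> real" where
  "min_marginal_defect t \<rho>1 \<rho>2 V = (INF X\<in>psd_cone V. marginal_defect t \<rho>1 \<rho>2 X)"

end

theory Submission
  imports Defs
begin

text \<open>The trace norm of \<open>T\<close> is the supremum of \<open>\<Sum>\<^sub>i \<bar>\<langle>T e\<^sub>i, f\<^sub>i\<rangle>\<bar>\<close> over finite orthonormal families \<open>e\<close> and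
  \<open>f\<close>, by the singular value decomposition.  Hence trace class operators are trace norm limits of
  finite rank ones and the partial traces are trace norm contractions, given by partial diagonal
  sums.  A positive \<open>X\<close> has the same trace as its marginals, so a defect of at most \<open>2\<close>, the value at
  \<open>X = 0\<close>, forces trace at most \<open>2\<close>; compactness then yields minimisers.  If a coupling \<open>\<rho>\<close> supported
  in \<open>\<X>\<close> exists, its compressions to \<open>\<X>\<^sub>n\<close> converge to it in trace norm.  Conversely, minimisers
  whose defects tend to \<open>0\<close> have a weakly convergent subsequence, and since both marginals converge in
  trace norm no mass escapes, so the weak limit has the prescribed marginals.\<close>

section \<open>Riesz representation and adjoints\<close>

text \<open>The trace norm is defined through eigenspaces of the adjoint of T composed with T, a
  description badly suited to sums and limits: not even the triangle inequality can be read off from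
  it. The singular value decomposition is therefore used only for two opposite estimates,
  \<open>trace_norm_bessel\<close> and \<open>trace_classI\<close>; the algebra of the trace norm,
  finite rank approximation and lower semicontinuity under weak limits all come from this pair.

  Weak convergence alone yields one inequality between the marginal of the limit and the limit of
  the marginals, since mass may drift to infinity in the factor that is traced out. For a unit
  vector a, the part of the form at a carried by basis vectors outside a finite set is dominated by
  the same part of the other marginal, so the convergence of both marginals enters the
  identification of each.

  Weak limits are extracted from a countable array of numbers: every operator involved lives on
  \<X>, so its matrix entries in the basis x determine it.\<close>

lemma bounded_bilinear_cinner: "bounded_bilinear (cinner :: 'a::chilbert_space \<Rightarrow> 'a \<Rightarrow> complex)"
proof
  fix a a' b b' :: 'a and r :: real
  show "cinner (a + a') b = cinner a b + cinner a' b" by (rule cinner_add_left)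
  show "cinner a (b + b') = cinner a b + cinner a b'"
    by (metis cinner_commute cinner_add_left complex_cnj_add)
  show "cinner (r *\<^sub>R a) b = r *\<^sub>R cinner a b"
    by (simp add: scaleR_scaleC cinner_scaleC_left scaleR_conv_of_real)
  show "cinner a (r *\<^sub>R b) = r *\<^sub>R cinner a b"
    by (metis cinner_commute cinner_scaleC_left complex_cnj_cnj complex_cnj_complex_of_real
        complex_cnj_mult scaleR_conv_of_real scaleR_scaleC)
  show "\<exists>K. \<forall>a b :: 'a. norm (cinner a b) \<le> norm a * norm b * K"
    by (rule exI[of _ 1]) (simp add: norm_cinner_le)
qed

interpretation cinner: bounded_bilinear "cinner :: 'a::chilbert_space \<Rightarrow> 'a \<Rightarrow> complex"
  by (rule bounded_bilinear_cinner)

lemma bounded_bilinear_scaleC: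
  "bounded_bilinear (scaleC :: complex \<Rightarrow> 'a::chilbert_space \<Rightarrow> 'a)"
proof
  fix c c' :: complex and x x' :: 'a and r :: real
  show "(r *\<^sub>R c) *\<^sub>C x = r *\<^sub>R c *\<^sub>C x"
    by (simp add: scaleR_scaleC scaleC_scaleC scaleR_conv_of_real)
  show "c *\<^sub>C r *\<^sub>R x = r *\<^sub>R c *\<^sub>C x"
    by (simp add: scaleR_scaleC scaleC_scaleC mult.commute)
  show "\<exists>K. \<forall>c (x :: 'a). norm (c *\<^sub>C x) \<le> norm c * norm x * K"
    by (rule exI[of _ 1]) (simp add: norm_scaleC)
qed (simp_all add: scaleC_add_left scaleC_add_right)

interpretation scaleC: bounded_bilinear "scaleC :: complex \<Rightarrow> 'a::chilbert_space \<Rightarrow> 'a"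
  by (rule bounded_bilinear_scaleC)

declare scaleC_one [simp] cinner_scaleC_left [simp]

lemma cinner_scaleC_right [simp]:
  "cinner x (c *\<^sub>C y) = cnj c * cinner x y" for x :: "'a::chilbert_space"
  by (metis cinner_commute cinner_scaleC_left complex_cnj_mult)

lemma cinner_self_eq_0 [simp]: "cinner x x = 0 \<longleftrightarrow> x = 0" for x :: "'a::chilbert_space"
  by (simp add: cinner_self)

lemma cinner_ext:
  assumes "\<And>z. cinner x z = cinner y z"
  shows "x = (y :: 'a::chilbert_space)"
  using assms[of "x - y"] cinner_self_eq_0[of "x - y"] by (simp add: cinner.diff_left)

lemma norm_sq_add: "(norm (x + y))\<^sup>2 = (norm x)\<^sup>2 + 2 * Re (cinner x y) + (norm y)\<^sup>2"
  for x :: "'a::chilbert_space"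
  by (simp add: Re_cinner power2_norm_eq_inner inner_add_left inner_add_right inner_commute)

lemma clinear_opI:
  fixes T :: "'a::chilbert_space \<Rightarrow>\<^sub>L 'b::chilbert_space"
  assumes "\<And>c x. T (c *\<^sub>C x) = c *\<^sub>C T x"
  shows "clinear_op T"
  using assms unfolding clinear_op_def Vector_Spaces.linear_iff
  by (auto simp: blinfun.add_right complex_vector.vector_space_axioms)

lemma clinear_op_scaleC:
  fixes T :: "'a::chilbert_space \<Rightarrow>\<^sub>L 'b::chilbert_space"
  shows "clinear_op T \<Longrightarrow> T (c *\<^sub>C x) = c *\<^sub>C T x"
  unfolding clinear_op_def Vector_Spaces.linear_iff by blast

lemma clinear_op_add: "clinear_op S \<Longrightarrow> clinear_op T \<Longrightarrow> clinear_op (S + T)"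
  by (rule clinear_opI) (simp add: clinear_op_scaleC blinfun.add_left scaleC_add_right)

lemma clinear_op_diff: "clinear_op S \<Longrightarrow> clinear_op T \<Longrightarrow> clinear_op (S - T)"
  by (rule clinear_opI) (simp add: clinear_op_scaleC blinfun.diff_left scaleC.diff_right)

lemma clinear_op_zero: "clinear_op 0"
  by (rule clinear_opI) (simp add: scaleC.zero_right)

lemma clinear_op_sum: "(\<And>i. i \<in> I \<Longrightarrow> clinear_op (S i)) \<Longrightarrow> clinear_op (\<Sum>i\<in>I. S i)"
  by (induction I rule: infinite_finite_induct) (auto simp: clinear_op_zero clinear_op_add)

lemma clinear_op_compose: "clinear_op S \<Longrightarrow> clinear_op T \<Longrightarrow> clinear_op (S o\<^sub>L T)"
  by (rule clinear_opI) (simp add: clinear_op_scaleC)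

lemma rank_one_apply [simp]: "rank_one x y z = cinner z y *\<^sub>C x"
  by (simp add: rank_one.rep_eq)

lemma scaleC_op_apply [simp]: "scaleC_op c T z = c *\<^sub>C T z"
  by (simp add: scaleC_op.rep_eq)

lemma clinear_op_rank_one: "clinear_op (rank_one x y)"
  by (rule clinear_opI) (simp add: scaleC_scaleC)

lemma clinear_op_scaleC_op: "clinear_op T \<Longrightarrow> clinear_op (scaleC_op c T)"
  by (rule clinear_opI) (simp add: clinear_op_scaleC scaleC_scaleC mult.commute)

lemma csubspace_imp_subspace:
  "complex_vector.subspace S \<Longrightarrow> subspace S" for S :: "'a::chilbert_space set"
  by (auto simp: complex_vector.subspace_def subspace_def scaleR_scaleC)

lemma csubspace_closure:
  fixes S :: "'a::chilbert_space set"
  assumes S: "complex_vector.subspace S"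
  shows "complex_vector.subspace (closure S)"
proof (rule complex_vector.subspaceI)
  show "0 \<in> closure S"
    using complex_vector.subspace_0[OF S] closure_subset by blast
next
  fix x y assume "x \<in> closure S" "y \<in> closure S"
  then obtain f g where f: "\<forall>n. f n \<in> S" "f \<longlonglongrightarrow> x" and g: "\<forall>n. g n \<in> S" "g \<longlonglongrightarrow> y"
    unfolding closure_sequential by blast
  have "\<forall>n. f n + g n \<in> S" using f g complex_vector.subspace_add[OF S] by blast
  moreover have "(\<lambda>n. f n + g n) \<longlonglongrightarrow> x + y" using f g by (intro tendsto_add) auto
  ultimately show "x + y \<in> closure S"
    unfolding closure_sequential by (intro exI[of _ "\<lambda>n. f n + g n"] conjI)
next
  fix c x assume "x \<in> closure S"
  then obtain f where f: "\<forall>n. f n \<in> S" "f \<longlonglongrightarrow> x"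
    unfolding closure_sequential by blast
  have "\<forall>n. c *\<^sub>C f n \<in> S" using f complex_vector.subspace_scale[OF S] by blast
  moreover have "(\<lambda>n. c *\<^sub>C f n) \<longlonglongrightarrow> c *\<^sub>C x"
    using f by (intro scaleC.tendsto) auto
  ultimately show "c *\<^sub>C x \<in> closure S"
    unfolding closure_sequential by (intro exI[of _ "\<lambda>n. c *\<^sub>C f n"] conjI)
qed

text \<open>The representing vector minimises \<open>\<parallel>x\<parallel>\<^sup>2 - 2 f x\<close> over \<open>S\<close>; the parallelogram law makes
  minimising sequences Cauchy.  Taking \<open>f = inner z\<close> yields orthogonal projections.\<close>

lemma riesz_closed_subspace:
  fixes S :: "'a::{real_inner,banach} set" and f :: "'a \<Rightarrow> real"
  assumes S: "subspace S" "closed S" and f: "bounded_linear f"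
  shows "\<exists>y\<in>S. \<forall>s\<in>S. f s = s \<bullet> y"
proof -
  interpret f: bounded_linear f by fact
  define \<phi> where "\<phi> x = x \<bullet> x - 2 * f x" for x
  define m where "m = (INF x\<in>S. \<phi> x)"
  obtain K where K: "\<And>x. norm (f x) \<le> norm x * K" using f.bounded by blast
  \<comment> \<open>Completing the square: the square of norm x minus 2 K norm x is at least minus
    the square of K.\<close>
  have low: "- (K\<^sup>2) \<le> \<phi> x" for x
  proof -
    have "f x \<le> norm x * K" using K[of x] by simp
    moreover have "0 \<le> (norm x - K)\<^sup>2" by simp
    ultimately show ?thesis by (simp add: \<phi>_def power2_diff flip: power2_norm_eq_inner) 
  qed
  have bdd: "bdd_below (\<phi> ` S)" using low by (auto intro!: bdd_belowI2)
  have ne: "S \<noteq> {}" using subspace_0[OF S(1)] by blast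
  have m_le: "m \<le> \<phi> x" if "x \<in> S" for x
    unfolding m_def using bdd that by (rule cINF_lower)
  have "\<exists>x\<in>S. \<phi> x < m + 1 / real (Suc n)" for n
    using cINF_less_iff[OF ne bdd, of "m + 1 / real (Suc n)"] by (simp add: m_def[symmetric])
  then obtain x where x: "\<And>n. x n \<in> S" "\<And>n. \<phi> (x n) < m + 1 / real (Suc n)" by metis
  \<comment> \<open>The linear part cancels between u, v and their midpoint, so the parallelogram
    law for the norm becomes one for \<phi>, where the midpoint is bounded below by m.\<close>
  have par: "(norm (u - v))\<^sup>2 = 2 * (\<phi> u + \<phi> v - 2 * \<phi> ((1/2) *\<^sub>R (u + v)))" for u v
    by (simp add: \<phi>_def f.add f.scaleR power2_norm_eq_inner inner_add_left inner_add_right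
        inner_diff_left inner_diff_right inner_commute algebra_simps)
  have dist_x: "(norm (x i - x j))\<^sup>2 \<le> 2 * (1 / real (Suc i) + 1 / real (Suc j))" for i j
  proof -
    have "(1/2) *\<^sub>R (x i + x j) \<in> S"
      using S(1) x(1) by (intro subspace_scale subspace_add)
    from m_le[OF this] x(2)[of i] x(2)[of j] show ?thesis unfolding par by simp
  qed
  have "Cauchy x"
  proof (rule CauchyI)
    fix e :: real assume "e > 0"
    then obtain M where M: "1 / real (Suc M) < e\<^sup>2 / 4"
      using nat_approx_posE[of "e\<^sup>2 / 4"] by auto
    show "\<exists>M. \<forall>i\<ge>M. \<forall>j\<ge>M. norm (x i - x j) < e"
    proof (intro exI allI impI)
      fix i j assume "M \<le> i" "M \<le> j"
      then have "1 / real (Suc i) \<le> 1 / real (Suc M)" "1 / real (Suc j) \<le> 1 / real (Suc M)"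
        by (auto intro!: frac_le)
      then have "2 * (1 / real (Suc i) + 1 / real (Suc j)) \<le> 2 * (1 / real (Suc M) + 1 / real (Suc M))"
        by (intro mult_left_mono add_mono) auto
      also have "\<dots> < 2 * (e\<^sup>2 / 4 + e\<^sup>2 / 4)"
        using M by (intro mult_strict_left_mono add_strict_mono) auto
      finally have "(norm (x i - x j))\<^sup>2 < e\<^sup>2" using dist_x[of i j] by simp
      then show "norm (x i - x j) < e" using \<open>e > 0\<close> by (simp add: power2_less_imp_less)
    qed
  qed
  then obtain y where y: "x \<longlonglongrightarrow> y" using Cauchy_convergent_iff convergent_def by blast
  have yS: "y \<in> S" using closed_sequentially[OF S(2)] x(1) y by blast
  have "(\<lambda>n. \<phi> (x n)) \<longlonglongrightarrow> \<phi> y"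
    unfolding \<phi>_def by (intro tendsto_intros y f.tendsto)
  moreover have "(\<lambda>n. m + 1 / real (Suc n)) \<longlonglongrightarrow> m + 0"
    by (intro tendsto_intros LIMSEQ_inverse_real_of_nat[unfolded inverse_eq_divide])
  ultimately have "\<phi> y \<le> m + 0"
    using x(2) by (intro LIMSEQ_le[of "\<lambda>n. \<phi> (x n)"]) (auto intro: less_imp_le)
  have "f s = s \<bullet> y" if s: "s \<in> S" for s
  proof -
    have ineq: "0 \<le> 2 * r * (s \<bullet> y - f s) + r\<^sup>2 * (s \<bullet> s)" for r
    proof -
      have "y + r *\<^sub>R s \<in> S" using S(1) yS s by (intro subspace_scale subspace_add)
      from m_le[OF this] \<open>\<phi> y \<le> m + 0\<close> show ?thesis
        by (simp add: \<phi>_def f.add f.scaleR inner_add_left inner_add_right inner_commute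
            power2_eq_square algebra_simps)
    qed
    show ?thesis
    proof (rule ccontr)
      assume "f s \<noteq> s \<bullet> y"
      define d where "d = s \<bullet> y - f s"
      have d: "d \<noteq> 0" using \<open>f s \<noteq> s \<bullet> y\<close> by (simp add: d_def)
      \<comment> \<open>The quadratic in r has its minimum at - d / (s \<bullet> s); the added 1
        keeps the quotient defined for s = 0 and still makes the value negative.\<close>
      define q where "q = s \<bullet> s + 1"
      have q: "q > 0" "s \<bullet> s < q" by (simp_all add: q_def add_nonneg_pos)
      have "2 * (- d / q) * d + (- d / q)\<^sup>2 * (s \<bullet> s) < 2 * (- d / q) * d + (- d / q)\<^sup>2 * q"
        using q d by (intro add_strict_left_mono mult_strict_left_mono) auto
      also have "\<dots> = - (d\<^sup>2 / q)" using q by (simp add: power2_eq_square field_simps)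
      also have "\<dots> \<le> 0" using q by simp
      finally show False using ineq[of "- d / q"] by (simp add: d_def)
    qed
  qed
  then show ?thesis using yS by blast
qed

text \<open>The real version represents the real part of g; its value at
  \<open>\<i> *\<^sub>C s\<close> recovers the imaginary part, since g is complex linear.\<close>

lemma criesz_closed_subspace:
  fixes S :: "'a::chilbert_space set" and g :: "'a \<Rightarrow> complex"
  assumes S: "complex_vector.subspace S" "closed S" and g: "bounded_linear g"
    and gc: "\<And>c x. g (c *\<^sub>C x) = c * g x"
  shows "\<exists>y\<in>S. \<forall>s\<in>S. g s = cinner s y"
proof -
  have "bounded_linear (\<lambda>x. Re (g x))"
    by (rule bounded_linear_compose[OF bounded_linear_Re g])
  from riesz_closed_subspace[OF csubspace_imp_subspace[OF S(1)] S(2) this]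
  obtain y where y: "y \<in> S" "\<And>s. s \<in> S \<Longrightarrow> Re (g s) = Re (cinner s y)"
    by (auto simp: Re_cinner)
  have "g s = cinner s y" if "s \<in> S" for s
  proof (rule complex_eqI)
    have "\<i> *\<^sub>C s \<in> S" using complex_vector.subspace_scale[OF S(1) that] .
    from y(2)[OF this] show "Im (g s) = Im (cinner s y)" by (simp add: gc)
  qed (use y that in auto)
  then show ?thesis using y(1) by blast
qed

text \<open>The functional \<open>\<lambda>s. cinner s z\<close> restricted to S is also represented
  by a vector of S; this vector is the orthogonal projection of z.\<close>

lemma exists_projection:
  fixes S :: "'a::chilbert_space set"
  assumes S: "complex_vector.subspace S" "closed S"
  shows "\<exists>p\<in>S. \<forall>s\<in>S. cinner s (z - p) = 0"
proof -
  have "\<exists>y\<in>S. \<forall>s\<in>S. cinner s z = cinner s y"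
    by (rule criesz_closed_subspace[OF S cinner.bounded_linear_left]) simp
  then show ?thesis by (auto simp: cinner.diff_right)
qed

text \<open>Adjoints, partial traces and weak limits are first known only as bounded sesquilinear
  forms; this turns each of them into an operator.\<close>

lemma csesquilinear_representation:
  fixes B :: "'a::chilbert_space \<Rightarrow> 'b::chilbert_space \<Rightarrow> complex"
  assumes addl: "\<And>x x' y. B (x + x') y = B x y + B x' y"
    and addr: "\<And>x y y'. B x (y + y') = B x y + B x y'"
    and scl: "\<And>c x y. B (c *\<^sub>C x) y = c * B x y"
    and scr: "\<And>c x y. B x (c *\<^sub>C y) = cnj c * B x y"
    and K: "0 \<le> K" and bd: "\<And>x y. norm (B x y) \<le> K * norm x * norm y"
  shows "\<exists>T :: 'a \<Rightarrow>\<^sub>L 'b. clinear_op T \<and> (\<forall>x y. cinner (T x) y = B x y)"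
proof -
  have "\<exists>w. \<forall>y. B x y = cinner w y" for x
  proof -
    have "bounded_linear (\<lambda>y. cnj (B x y))"
      using bd[of x]
      by (intro bounded_linear_intro[where K = "K * norm x"])
         (simp_all add: addr scr scaleR_scaleC scaleR_conv_of_real mult.commute[of _ "K * norm x"])
    from criesz_closed_subspace[OF complex_vector.subspace_UNIV closed_UNIV this]
    obtain w where "\<And>y. cnj (B x y) = cinner y w" by (auto simp: scr)
    then show ?thesis by (metis cinner_commute complex_cnj_cnj)
  qed
  then obtain T where T: "\<And>x y. B x y = cinner (T x) y" by metis
  have lin: "T (x + x') = T x + T x'" "T (c *\<^sub>C x) = c *\<^sub>C T x" for c x x'
    by (rule cinner_ext; simp add: cinner.add_left flip: T add: addl scl)+
  have "norm (T x) \<le> norm x * K" for x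
  proof (cases "T x = 0")
    case False
    have "norm (T x) * norm (T x) = norm (B x (T x))"
      by (simp add: T cinner_self power2_eq_square norm_mult)
    also have "\<dots> \<le> K * norm x * norm (T x)" by (rule bd)
    finally show ?thesis using False by (simp add: mult.commute)
  next
    case True
    then show ?thesis using K by simp
  qed
  then have "bounded_linear T"
    by (intro bounded_linear_intro) (auto simp: lin scaleR_scaleC)
  then have ap: "blinfun_apply (Blinfun T) = T" by (rule bounded_linear_Blinfun_apply)
  show ?thesis
    by (rule exI[of _ "Blinfun T"]) (auto intro!: clinear_opI simp: ap lin T)
qed

section \<open>Adjoints of complex linear operators\<close>

lemma cadjoint_exists:
  fixes T :: "'a::chilbert_space \<Rightarrow>\<^sub>L 'b::chilbert_space"
  assumes "clinear_op T"
  shows "\<exists>S :: 'b \<Rightarrow>\<^sub>L 'a. clinear_op S \<and> (\<forall>x y. cinner (T x) y = cinner x (S y))"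
proof -
  have "\<exists>S :: 'b \<Rightarrow>\<^sub>L 'a. clinear_op S \<and> (\<forall>y x. cinner (S y) x = cinner y (T x))"
  proof (rule csesquilinear_representation)
    fix x y
    show "norm (cinner y (T x)) \<le> norm T * norm y * norm x"
      using norm_cinner_le[of y "T x"] norm_blinfun[of T x]
      by (smt (verit) mult.assoc mult.commute mult_left_mono norm_ge_zero)
  qed (auto simp: cinner.add_left cinner.add_right blinfun.add_right clinear_op_scaleC[OF assms])
  then show ?thesis by (metis cinner_commute)
qed

text \<open>Evaluates the definite description behind \<open>cadjoint\<close>.\<close>

lemma cadjoint_unique:
  fixes T :: "'a::chilbert_space \<Rightarrow>\<^sub>L 'b::chilbert_space"
    and S :: "'b \<Rightarrow>\<^sub>L 'a"
  assumes "\<And>x y. cinner (T x) y = cinner x (S y)"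
  shows "cadjoint T = S"
  unfolding cadjoint_def
proof (rule the_equality)
  fix R :: "'b \<Rightarrow>\<^sub>L 'a" assume "\<forall>x y. cinner (T x) y = cinner x (R y)"
  then have "cinner (R y) x = cinner (S y) x" for x y
    using assms by (metis cinner_commute)
  then show "R = S" by (intro blinfun_eqI cinner_ext)
qed (use assms in simp)

lemma
  fixes T :: "'a::chilbert_space \<Rightarrow>\<^sub>L 'b::chilbert_space"
  assumes "clinear_op T"
  shows cinner_cadjoint: "cinner (T x) y = cinner x (cadjoint T y)"
    and cinner_cadjoint': "cinner y (T x) = cinner (cadjoint T y) x"
    and clinear_op_cadjoint: "clinear_op (cadjoint T)"
proof -
  obtain S :: "'b \<Rightarrow>\<^sub>L 'a" where S: "clinear_op S" "\<And>x y. cinner (T x) y = cinner x (S y)"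
    using cadjoint_exists[OF assms] by blast
  then have "cadjoint T = S" by (intro cadjoint_unique) auto
  with S show *: "cinner (T x) y = cinner x (cadjoint T y)" "clinear_op (cadjoint T)" by auto
  from *(1) show "cinner y (T x) = cinner (cadjoint T y) x" by (metis cinner_commute)
qed

section \<open>Orthonormal families\<close>

definition onfam :: "('i \<Rightarrow> 'a::chilbert_space) \<Rightarrow> 'i set \<Rightarrow> bool" where
  "onfam e I \<longleftrightarrow> (\<forall>i\<in>I. \<forall>j\<in>I. cinner (e i) (e j) = (if i = j then 1 else 0))"

text \<open>Equivalently, the map from z to its coefficients \<open>cinner z (e i)\<close> is a
  contraction into l2. Neither independence nor unit length of the vectors is implied.\<close>

definition bessel_fam :: "('i \<Rightarrow> 'a::chilbert_space) \<Rightarrow> 'i set \<Rightarrow> bool" where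
  "bessel_fam e I \<longleftrightarrow> finite I \<and> (\<forall>z. (\<Sum>i\<in>I. (cmod (cinner z (e i)))\<^sup>2) \<le> (norm z)\<^sup>2)"

text \<open>For a finite orthonormal family this is the orthogonal projection onto its span;
  symmetry holds for any family.\<close>

definition onproj :: "('i \<Rightarrow> 'a::chilbert_space) \<Rightarrow> 'i set \<Rightarrow> ('a \<Rightarrow>\<^sub>L 'a)" where
  "onproj e I = (\<Sum>i\<in>I. rank_one (e i) (e i))"

lemma orthonormal_set_iff_onfam: "orthonormal_set B \<longleftrightarrow> onfam (\<lambda>x. x) B"
  by (simp add: orthonormal_set_def onfam_def)

lemma onfamD: "onfam e I \<Longrightarrow> i \<in> I \<Longrightarrow> j \<in> I \<Longrightarrow> cinner (e i) (e j) = (if i = j then 1 else 0)"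
  by (simp add: onfam_def)

lemma onfam_norm:
  assumes "onfam e I" "i \<in> I"
  shows "norm (e i) = 1"
proof -
  have "complex_of_real ((norm (e i))\<^sup>2) = complex_of_real 1"
    using onfamD[OF assms assms(2)] by (simp add: cinner_self)
  then have "(norm (e i))\<^sup>2 = 1" using of_real_eq_iff by blast
  then show ?thesis using norm_ge_zero[of "e i"] by (auto simp: power2_eq_1_iff)
qed

lemma onfam_subset: "onfam e I \<Longrightarrow> J \<subseteq> I \<Longrightarrow> onfam e J"
  unfolding onfam_def by blast

lemma onfam_inj_on: "onfam e I \<Longrightarrow> inj_on e I"
  by (rule inj_onI) (metis (full_types) onfam_def zero_neq_one)

lemma onfam_image: "onfam e I \<Longrightarrow> orthonormal_set (e ` I)"
  using onfam_inj_on[of e I] by (auto simp: onfam_def orthonormal_set_def inj_on_eq_iff)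

lemma onproj_apply: "onproj e I z = (\<Sum>i\<in>I. cinner z (e i) *\<^sub>C e i)"
  by (simp add: onproj_def blinfun.sum_left)

lemma clinear_op_onproj: "clinear_op (onproj e I)"
  unfolding onproj_def by (intro clinear_op_sum clinear_op_rank_one)

lemma onproj_in_span: "onproj e I z \<in> complex_vector.span (e ` I)"
  unfolding onproj_apply
  by (intro complex_vector.span_sum complex_vector.span_scale complex_vector.span_base) auto

lemma cinner_onproj_left: "cinner (onproj e I z) w = (\<Sum>i\<in>I. cinner z (e i) * cinner (e i) w)"
  by (simp add: onproj_apply cinner.sum_left)

lemma cinner_onproj_commute: "cinner (onproj e I z) w = cinner z (onproj e I w)"
proof -
  have "cinner z (onproj e I w) = cnj (cinner (onproj e I w) z)" by (rule cinner_commute)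
  also have "\<dots> = (\<Sum>i\<in>I. cnj (cinner w (e i)) * cnj (cinner (e i) z))"
    by (simp add: cinner_onproj_left)
  also have "\<dots> = (\<Sum>i\<in>I. cinner z (e i) * cinner (e i) w)"
    by (intro sum.cong refl) (metis cinner_commute mult.commute)
  finally show ?thesis by (simp add: cinner_onproj_left)
qed

context
  fixes e :: "'i \<Rightarrow> 'a::chilbert_space" and I :: "'i set"
  assumes fin: "finite I" and on: "onfam e I"
begin

lemma onproj_base: "i \<in> I \<Longrightarrow> onproj e I (e i) = e i"
proof -
  assume i: "i \<in> I"
  have "onproj e I (e i) = (\<Sum>j\<in>I. if j = i then e i else 0)"
    unfolding onproj_apply
    by (intro sum.cong refl) (use onfamD[OF on i] in \<open>auto simp: scaleC.zero_left\<close>)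
  then show ?thesis using fin i by simp
qed

lemma onproj_span: "w \<in> complex_vector.span (e ` I) \<Longrightarrow> onproj e I w = w"
proof (induction rule: complex_vector.span_induct)
  case base
  show ?case
    by (rule complex_vector.subspaceI)
       (auto simp: blinfun.zero_right blinfun.add_right clinear_op_scaleC[OF clinear_op_onproj])
qed (auto simp: onproj_base)

text \<open>As the fixed point set of a continuous map the span is visibly closed.\<close>

lemma span_onfam_eq: "complex_vector.span (e ` I) = {w. onproj e I w = w}"
proof (intro equalityI subsetI)
  fix w assume "w \<in> {w. onproj e I w = w}"
  then show "w \<in> complex_vector.span (e ` I)" using onproj_in_span[of e I w] by simp
qed (simp add: onproj_span)

lemma closed_span_onfam: "closed (complex_vector.span (e ` I))"
  unfolding span_onfam_eq by (intro closed_Collect_eq continuous_intros)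

lemma onproj_orthogonal: "w \<in> complex_vector.span (e ` I) \<Longrightarrow> cinner (z - onproj e I z) w = 0"
  by (simp add: cinner.diff_left cinner_onproj_commute onproj_span)

lemma norm_onproj: "(norm (onproj e I z))\<^sup>2 = (\<Sum>i\<in>I. (cmod (cinner z (e i)))\<^sup>2)"
proof -
  have "complex_of_real ((norm (onproj e I z))\<^sup>2) = cinner (onproj e I z) (onproj e I z)"
    by (simp add: cinner_self)
  also have "\<dots> = cinner (onproj e I z) z"
    using onproj_orthogonal[OF onproj_in_span, of z z]
    by (metis cinner.diff_left cinner_onproj_commute onproj_in_span onproj_span)
  also have "\<dots> = (\<Sum>i\<in>I. complex_of_real ((cmod (cinner z (e i)))\<^sup>2))"
    unfolding cinner_onproj_left complex_norm_square
    by (intro sum.cong refl) (metis cinner_commute)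
  finally show ?thesis by (metis of_real_eq_iff of_real_sum)
qed

lemma onproj_pythagoras: "(norm z)\<^sup>2 = (norm (onproj e I z))\<^sup>2 + (norm (z - onproj e I z))\<^sup>2"
  using norm_sq_add[of "z - onproj e I z" "onproj e I z"] onproj_orthogonal[OF onproj_in_span, of z z]
  by simp

lemma bessel_onfam: "bessel_fam e I"
  unfolding bessel_fam_def using fin onproj_pythagoras norm_onproj by (metis le_add_same_cancel1 zero_le_power2)

lemma onproj_best: "w \<in> complex_vector.span (e ` I) \<Longrightarrow> norm (z - onproj e I z) \<le> norm (z - w)"
proof -
  assume w: "w \<in> complex_vector.span (e ` I)"
  then have "onproj e I z - w \<in> complex_vector.span (e ` I)"
    by (intro complex_vector.span_diff onproj_in_span)
  from onproj_orthogonal[OF this] norm_sq_add[of "z - onproj e I z" "onproj e I z - w"]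
  have "(norm (z - w))\<^sup>2 = (norm (z - onproj e I z))\<^sup>2 + (norm (onproj e I z - w))\<^sup>2" by simp
  then show ?thesis by (metis le_add_same_cancel1 norm_ge_zero power2_le_imp_le zero_le_power2)
qed

end

section \<open>Fourier expansions and orthonormal bases\<close>

lemma span_image_finite_support:
  fixes e :: "'i \<Rightarrow> 'a::chilbert_space"
  assumes "w \<in> complex_vector.span (e ` I)"
  shows "\<exists>F. finite F \<and> F \<subseteq> I \<and> w \<in> complex_vector.span (e ` F)"
proof -
  obtain t r where t: "finite t" "t \<subseteq> e ` I" "w = (\<Sum>a\<in>t. r a *\<^sub>C a)"
    using assms unfolding complex_vector.span_explicit mem_Collect_eq by (elim exE conjE)
  obtain F where "F \<subseteq> I" "finite F" "t = e ` F" using finite_subset_image[OF t(1,2)] by blast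
  moreover have "w \<in> complex_vector.span t"
    unfolding t(3) by (intro complex_vector.span_sum complex_vector.span_scale complex_vector.span_base)
  ultimately show ?thesis by (intro exI[of _ F]) simp
qed

text \<open>A vector w of the span close to z uses only finitely many indices F. For every finite G
  above F the partial Fourier sum is the best approximation of z from a space containing w, so it is
  at least as close. This gives unordered convergence over arbitrary index sets.\<close>

lemma fourier_has_sum:
  fixes e :: "'i \<Rightarrow> 'a::chilbert_space"
  assumes on: "onfam e I" and z: "z \<in> closure (complex_vector.span (e ` I))"
  shows "((\<lambda>i. cinner z (e i) *\<^sub>C e i) has_sum z) I"
  unfolding has_sum_def
proof (rule tendstoI)
  fix \<epsilon> :: real assume "\<epsilon> > 0"
  then obtain w where w: "w \<in> complex_vector.span (e ` I)" "dist w z < \<epsilon>"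
    using z by (meson closure_approachable)
  obtain F where F: "finite F" "F \<subseteq> I" "w \<in> complex_vector.span (e ` F)"
    using span_image_finite_support[OF w(1)] by blast
  show "\<forall>\<^sub>F G in finite_subsets_at_top I. dist (\<Sum>i\<in>G. cinner z (e i) *\<^sub>C e i) z < \<epsilon>"
    unfolding eventually_finite_subsets_at_top
  proof (intro exI[of _ F] conjI allI impI)
    fix G assume G: "finite G \<and> F \<subseteq> G \<and> G \<subseteq> I"
    then have "w \<in> complex_vector.span (e ` G)"
      using F(3) complex_vector.span_mono[of "e ` F" "e ` G"] by blast
    from onproj_best[OF _ onfam_subset[OF on] this] G
    have "norm (z - onproj e G z) \<le> norm (z - w)" by simp
    then show "dist (\<Sum>i\<in>G. cinner z (e i) *\<^sub>C e i) z < \<epsilon>"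
      using w(2) by (simp add: dist_norm norm_minus_commute onproj_apply)
  qed (use F in auto)
qed

text \<open>Zorn's lemma inside a prescribed set M, which need not be a subspace: the singular
  system takes a union of eigenspaces for M, bases take the whole space. A unit vector of M
  orthogonal to the maximal set could be added to it.\<close>

lemma orthonormal_extension:
  fixes E M :: "'a::chilbert_space set"
  assumes E: "orthonormal_set E" "E \<subseteq> M"
  obtains U where "orthonormal_set U" "E \<subseteq> U" "U \<subseteq> M"
    "\<And>z. z \<in> M \<Longrightarrow> norm z = 1 \<Longrightarrow> \<exists>u\<in>U. cinner z u \<noteq> 0"
proof -
  define \<A> where "\<A> = {U. orthonormal_set U \<and> E \<subseteq> U \<and> U \<subseteq> M}"
  have "\<exists>U\<in>\<A>. \<forall>V\<in>\<A>. U \<subseteq> V \<longrightarrow> V = U"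
  proof (rule subset_Zorn_nonempty)
    show "\<A> \<noteq> {}" using E by (auto simp: \<A>_def)
    fix C assume C: "C \<noteq> {}" "subset.chain \<A> C"
    have CA: "C \<subseteq> \<A>" using C(2) by (auto simp: subset.chain_def)
    have "cinner x y = (if x = y then 1 else 0)" if "x \<in> \<Union>C" "y \<in> \<Union>C" for x y
    proof -
      from that obtain V W where VW: "V \<in> C" "x \<in> V" "W \<in> C" "y \<in> W" by blast
      then have "V \<subseteq> W \<or> W \<subseteq> V" using C(2) unfolding subset_chain_def by blast
      then obtain V' where V': "V' \<in> C" "x \<in> V'" "y \<in> V'" using VW by blast
      then have "orthonormal_set V'" using CA by (auto simp: \<A>_def)
      then show ?thesis using V' unfolding orthonormal_set_def by blast
    qed
    then have "orthonormal_set (\<Union>C)" unfolding orthonormal_set_def by blast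
    moreover have "E \<subseteq> \<Union>C" "\<Union>C \<subseteq> M" using CA C(1) unfolding \<A>_def by blast+
    ultimately show "\<Union>C \<in> \<A>" unfolding \<A>_def by blast
  qed
  then obtain U where U: "U \<in> \<A>" "\<And>V. V \<in> \<A> \<Longrightarrow> U \<subseteq> V \<Longrightarrow> V = U" by blast
  show ?thesis
  proof (rule that)
    fix z assume z: "z \<in> M" "norm z = 1"
    show "\<exists>u\<in>U. cinner z u \<noteq> 0"
    proof (rule ccontr)
      assume "\<not> ?thesis"
      then have o: "\<And>u. u \<in> U \<Longrightarrow> cinner z u = 0" by blast
      then have o': "\<And>u. u \<in> U \<Longrightarrow> cinner u z = 0" by (metis cinner_commute complex_cnj_zero)
      have zz: "cinner z z = 1" using z by (simp add: cinner_self)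
      have "insert z U \<in> \<A>" using U(1) z(1) o o' zz unfolding \<A>_def orthonormal_set_def by auto
      then have "z \<in> U" using U(2) by blast
      then show False using o zz by force
    qed
  qed (use U(1) in \<open>auto simp: \<A>_def\<close>)
qed

text \<open>The residual of z after projection onto the closed span of B is orthogonal to B, hence
  zero.\<close>

lemma is_onbI:
  fixes B :: "'a::chilbert_space set"
  assumes B: "orthonormal_set B" and z: "\<And>z. (\<And>b. b \<in> B \<Longrightarrow> cinner z b = 0) \<Longrightarrow> z = 0"
  shows "is_onb B"
  unfolding is_onb_def
proof (intro conjI B equalityI subset_UNIV subsetI)
  fix z
  let ?S = "closure (complex_vector.span B)"
  have "complex_vector.subspace ?S" "closed ?S"
    by (auto intro: csubspace_closure complex_vector.subspace_span)
  from exists_projection[OF this, of z]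
  obtain p where p: "p \<in> ?S" "\<forall>s\<in>?S. cinner s (z - p) = 0" by blast
  have "cinner (z - p) b = 0" if "b \<in> B" for b
    using p(2) complex_vector.span_base[OF that] closure_subset cinner_commute
    by (metis complex_cnj_zero subsetD)
  then have "z - p = 0" by (rule z)
  then show "z \<in> ?S" using p(1) by simp
qed

lemma orthonormal_extends_to_onb:
  fixes E :: "'a::chilbert_space set"
  assumes "orthonormal_set E"
  obtains B where "is_onb B" "E \<subseteq> B"
proof -
  obtain U where U: "orthonormal_set U" "E \<subseteq> U"
    "\<And>z. norm z = 1 \<Longrightarrow> \<exists>u\<in>U. cinner z u \<noteq> 0"
    using orthonormal_extension[OF assms subset_UNIV] by auto
  have "is_onb U"
  proof (rule is_onbI[OF U(1)], rule ccontr)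
    fix z assume z: "\<And>b. b \<in> U \<Longrightarrow> cinner z b = 0" "z \<noteq> 0"
    then have "norm (complex_of_real (1 / norm z) *\<^sub>C z) = 1" by (simp add: norm_scaleC norm_divide)
    from U(3)[OF this] z(1) show False by auto
  qed
  with U(2) show thesis by (rule that[rotated])
qed

lemma onb_exists: "\<exists>B :: 'a::chilbert_space set. is_onb B"
proof -
  have "orthonormal_set ({} :: 'a set)" by (simp add: orthonormal_set_def)
  then show ?thesis using orthonormal_extends_to_onb by blast
qed

lemma onb_fourier: "is_onb B \<Longrightarrow> ((\<lambda>b. cinner z b *\<^sub>C b) has_sum z) B"
  using fourier_has_sum[of "\<lambda>x. x" B z] by (simp add: is_onb_def orthonormal_set_iff_onfam)

lemma onb_parseval: "is_onb B \<Longrightarrow> ((\<lambda>b. cinner z b * cinner b w) has_sum cinner z w) B"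
  using has_sum_bounded_linear[OF cinner.bounded_linear_left onb_fourier, of B z w] by (simp add: o_def)

lemma onfam_independent:
  fixes U :: "'a::chilbert_space set"
  assumes "orthonormal_set U"
  shows "complex_vector.independent U"
  unfolding complex_vector.dependent_def
proof
  assume "\<exists>a\<in>U. a \<in> complex_vector.span (U - {a})"
  then obtain a where a: "a \<in> U" "a \<in> complex_vector.span (U - {a})" by blast
  have "complex_vector.subspace {z. cinner z a = 0}"
    by (rule complex_vector.subspaceI) (auto simp: cinner.zero_left cinner.add_left)
  moreover have "U - {a} \<subseteq> {z. cinner z a = 0}" using assms a(1) by (auto simp: orthonormal_set_def)
  ultimately have "cinner a a = 0" using a(2) complex_vector.span_minimal by blast
  moreover have "cinner a a = 1" using assms a(1) by (simp add: orthonormal_set_def)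
  ultimately show False by simp
qed

section \<open>Singular value decomposition\<close>

text \<open>Compactness makes the images of a sequence maximising \<open>norm (T w)\<close> on the
  unit ball of W converge along a subsequence. Near the maximum s, w is almost an eigenvector of A
  for \<open>s\<^sup>2\<close>, and as \<open>s\<^sup>2\<close> is positive the vectors w themselves
  converge, to an eigenvector.\<close>

lemma exists_singular_vector:
  fixes T :: "'a::chilbert_space \<Rightarrow>\<^sub>L 'b::chilbert_space"
  assumes lin: "clinear_op T" and cpt: "compact_op T"
    and W: "closed W" "\<And>c w. w \<in> W \<Longrightarrow> c *\<^sub>C w \<in> W"
    and inv: "\<And>w. w \<in> W \<Longrightarrow> cadjoint T (T w) \<in> W"
    and z: "z \<in> W" "T z \<noteq> 0"
  obtains v s where "v \<in> W" "norm v = 1" "s > 0"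
    "cadjoint T (T v) = complex_of_real (s\<^sup>2) *\<^sub>C v"
proof -
  define A where "A w = cadjoint T (T w)" for w
  define s where "s = (SUP w\<in>W \<inter> cball 0 1. norm (T w))"
  have bdd: "bdd_above ((\<lambda>w. norm (T w)) ` (W \<inter> cball 0 1))"
  proof (rule bdd_aboveI2)
    fix w assume "w \<in> W \<inter> cball 0 1"
    then show "norm (T w) \<le> norm T"
      using norm_blinfun[of T w] mult_left_le[of "norm w" "norm T"] by auto
  qed
  have s_ball: "norm (T w) \<le> s" if "w \<in> W" "norm w \<le> 1" for w
    unfolding s_def using bdd that by (intro cSUP_upper) auto
  have nz: "z \<noteq> 0" using z(2) by (auto simp: blinfun.zero_right)
  have normalize: "norm (complex_of_real (1 / norm w) *\<^sub>C w) = 1" if "w \<noteq> 0" for w :: 'a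
    using that by (simp add: norm_scaleC norm_divide)
  have s_norm: "norm (T w) \<le> s * norm w" if "w \<in> W" for w
  proof (cases "w = 0")
    case False
    from s_ball[OF W(2)[OF that], of "complex_of_real (1 / norm w)"] normalize[OF False] False
    show ?thesis by (simp add: clinear_op_scaleC[OF lin] norm_scaleC norm_divide field_simps)
  qed (simp add: blinfun.zero_right)
  have s: "s > 0"
    using s_norm[OF z(1)] z(2) by (smt (verit) mult_nonpos_nonneg norm_ge_zero zero_less_norm_iff)
  have ne: "W \<inter> cball 0 1 \<noteq> {}" using W(2)[OF z(1), of 0] by (auto simp: scaleC.zero_left)
  have "\<exists>w\<in>W \<inter> cball 0 1. s - 1 / real (Suc n) < norm (T w)" for n
    using less_cSUP_iff[OF ne bdd, of "s - 1 / real (Suc n)"] by (simp add: s_def[symmetric])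
  then obtain w where w: "\<And>n. w n \<in> W" "\<And>n. norm (w n) \<le> 1"
    "\<And>n. s - 1 / real (Suc n) < norm (T (w n))"
    by (metis IntE mem_cball_0)
  have normT: "(\<lambda>n. norm (T (w n))) \<longlonglongrightarrow> s"
  proof (rule tendsto_sandwich[where h = "\<lambda>_. s"])
    show "(\<lambda>n. s - 1 / real (Suc n)) \<longlonglongrightarrow> s"
      using tendsto_diff[OF tendsto_const LIMSEQ_inverse_real_of_nat, of s]
      by (simp add: inverse_eq_divide)
    show "\<forall>\<^sub>F n in sequentially. s - 1 / real (Suc n) \<le> norm (T (w n))"
      using w(3) by (intro always_eventually allI less_imp_le)
  qed (use w s_ball in \<open>auto intro!: always_eventually\<close>)
  have Tw: "\<forall>n. T (w n) \<in> closure (blinfun_apply T ` cball 0 1)"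
    using w(2) by (auto intro!: subsetD[OF closure_subset])
  then obtain y r where r: "strict_mono (r :: nat \<Rightarrow> nat)" and y: "(\<lambda>n. T (w (r n))) \<longlonglongrightarrow> y"
    using seq_compactE[OF compact_imp_seq_compact[OF cpt[unfolded compact_op_def]] Tw]
    unfolding o_def by metis
  have normTr: "(\<lambda>n. norm (T (w (r n)))) \<longlonglongrightarrow> s"
    using LIMSEQ_subseq_LIMSEQ[OF normT r] by (simp add: o_def)
  \<comment> \<open>Expanding the square leaves the mixed term
    \<open>2 * s\<^sup>2 * (norm (T u))\<^sup>2\<close>, while both pure squares are at most
    \<open>(s\<^sup>2)\<^sup>2\<close>. The bound vanishes as \<open>norm (T u)\<close> approaches
    s.\<close>
  have est: "(norm (A u - complex_of_real (s\<^sup>2) *\<^sub>C u))\<^sup>2 \<le> 2 * s\<^sup>2 * (s\<^sup>2 - (norm (T u))\<^sup>2)"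
    if u: "u \<in> W" "norm u \<le> 1" for u
  proof -
    have Au: "norm (A u) \<le> s\<^sup>2"
    proof (cases "A u = 0")
      case False
      have "(norm (A u))\<^sup>2 = Re (cinner (T u) (T (A u)))"
        using cinner_cadjoint'[OF lin, of "T u" "A u"] by (simp add: A_def cinner_self)
      also have "\<dots> \<le> norm (T u) * norm (T (A u))"
        using norm_cinner_le complex_Re_le_cmod order_trans by blast
      also have "\<dots> \<le> s * (s * norm (A u))"
        using s u by (intro mult_mono s_ball s_norm) (auto simp: A_def inv)
      finally show ?thesis using False by (simp add: power2_eq_square)
    qed simp
    have "Re (cinner (A u) u) = (norm (T u))\<^sup>2"
      unfolding A_def cinner_cadjoint'[OF lin, symmetric] cinner_self by simp
    then have "(norm (A u - complex_of_real (s\<^sup>2) *\<^sub>C u))\<^sup>2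
        = (norm (A u))\<^sup>2 - 2 * s\<^sup>2 * (norm (T u))\<^sup>2 + (s\<^sup>2 * norm u)\<^sup>2"
      using norm_sq_add[of "A u" "- (complex_of_real (s\<^sup>2) *\<^sub>C u)"]
      by (simp add: cinner.minus_right norm_scaleC norm_power)
    also have "(norm (A u))\<^sup>2 \<le> (s\<^sup>2)\<^sup>2" using Au by (intro power_mono) auto
    also have "(s\<^sup>2 * norm u)\<^sup>2 \<le> (s\<^sup>2)\<^sup>2" using u(2) by (intro power_mono) (auto intro: mult_left_le)
    finally show ?thesis by (simp add: power2_eq_square algebra_simps)
  qed
  have "(\<lambda>n. (norm (A (w (r n)) - complex_of_real (s\<^sup>2) *\<^sub>C w (r n)))\<^sup>2) \<longlonglongrightarrow> 0"
  proof (rule tendsto_sandwich[where f = "\<lambda>_. 0"])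
    have "(\<lambda>n. 2 * s\<^sup>2 * (s\<^sup>2 - (norm (T (w (r n))))\<^sup>2)) \<longlonglongrightarrow> 2 * s\<^sup>2 * (s\<^sup>2 - s\<^sup>2)"
      by (intro tendsto_intros normTr)
    then show "(\<lambda>n. 2 * s\<^sup>2 * (s\<^sup>2 - (norm (T (w (r n))))\<^sup>2)) \<longlonglongrightarrow> 0" by simp
  qed (use est w in \<open>auto intro!: always_eventually\<close>)
  then have "(\<lambda>n. sqrt ((norm (A (w (r n)) - complex_of_real (s\<^sup>2) *\<^sub>C w (r n)))\<^sup>2)) \<longlonglongrightarrow> sqrt 0"
    by (intro tendsto_intros)
  then have diff0: "(\<lambda>n. A (w (r n)) - complex_of_real (s\<^sup>2) *\<^sub>C w (r n)) \<longlonglongrightarrow> 0"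
    by (simp add: tendsto_norm_zero_iff)
  have Alim: "(\<lambda>n. A (w (r n))) \<longlonglongrightarrow> cadjoint T y"
    unfolding A_def by (intro tendsto_intros y)
  \<comment> \<open>Dividing by \<open>s\<^sup>2\<close> recovers w from A w up to the vanishing
    error, so v is the only possible limit.\<close>
  define v where "v = complex_of_real (1 / s\<^sup>2) *\<^sub>C cadjoint T y"
  have v: "(\<lambda>n. w (r n)) \<longlonglongrightarrow> v"
  proof -
    have "(\<lambda>n. complex_of_real (1 / s\<^sup>2) *\<^sub>C
        (A (w (r n)) - (A (w (r n)) - complex_of_real (s\<^sup>2) *\<^sub>C w (r n)))) \<longlonglongrightarrow>
        complex_of_real (1 / s\<^sup>2) *\<^sub>C (cadjoint T y - 0)"
      by (intro scaleC.tendsto tendsto_const tendsto_diff Alim diff0)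
    then show ?thesis using s
      by (simp add: v_def scaleC_scaleC flip: of_real_mult of_real_power del: of_real_divide)
  qed
  have vW: "v \<in> W" using closed_sequentially[OF W(1) _ v] w(1) by blast
  have "(\<lambda>n. norm (T (w (r n)))) \<longlonglongrightarrow> norm (T v)" by (intro tendsto_intros v)
  then have "norm (T v) = s" using normTr LIMSEQ_unique by blast
  then have v0: "v \<noteq> 0" using s by (auto simp: blinfun.zero_right)
  have "(\<lambda>n. A (w (r n)) - complex_of_real (s\<^sup>2) *\<^sub>C w (r n)) \<longlonglongrightarrow> A v - complex_of_real (s\<^sup>2) *\<^sub>C v"
    unfolding A_def by (intro tendsto_diff scaleC.tendsto tendsto_const blinfun.tendsto v)
  then have Av: "A v = complex_of_real (s\<^sup>2) *\<^sub>C v"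
    using LIMSEQ_unique[OF diff0] by (metis eq_iff_diff_eq_0)
  show thesis
  proof (rule that[of "complex_of_real (1 / norm v) *\<^sub>C v" s])
    show "cadjoint T (T (complex_of_real (1 / norm v) *\<^sub>C v)) =
        complex_of_real (s\<^sup>2) *\<^sub>C complex_of_real (1 / norm v) *\<^sub>C v"
      using Av by (simp add: A_def clinear_op_scaleC[OF lin] clinear_op_scaleC[OF clinear_op_cadjoint[OF lin]]
          scaleC_scaleC mult.commute)
  qed (use s W(2)[OF vW] normalize[OF v0] in auto)
qed

text \<open>U is a maximal orthonormal set of eigenvectors of A for positive eigenvalues. If T z
  were nonzero for some z orthogonal to U, the complement of U would contain a further eigenvector
  by \<open>exists_singular_vector\<close>, against maximality. Maximality also lets U exhaust each
  eigenspace, so that counting vectors counts multiplicities.\<close>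

lemma singular_system:
  fixes T :: "'a::chilbert_space \<Rightarrow>\<^sub>L 'b::chilbert_space"
  assumes lin: "clinear_op T" and cpt: "compact_op T"
  obtains U where "orthonormal_set U" "\<And>u. u \<in> U \<Longrightarrow> T u \<noteq> 0"
    "\<And>u v. u \<in> U \<Longrightarrow> v \<in> U \<Longrightarrow> u \<noteq> v \<Longrightarrow> cinner (T u) (T v) = 0"
    "\<And>z. (\<And>u. u \<in> U \<Longrightarrow> cinner z u = 0) \<Longrightarrow> T z = 0"
    "\<And>\<sigma>. \<sigma> > 0 \<Longrightarrow> finite {u \<in> U. norm (T u) = \<sigma>}"
    "\<And>\<sigma>. \<sigma> > 0 \<Longrightarrow> card {u \<in> U. norm (T u) = \<sigma>} = singular_multiplicity T \<sigma>"
proof -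
  define A where "A = cadjoint T o\<^sub>L T"
  have Alin: "clinear_op A"
    unfolding A_def by (intro clinear_op_compose clinear_op_cadjoint lin)
  have A: "cinner (A w) u = cinner (T w) (T u)" "cinner w (A u) = cinner (T w) (T u)" for w u
    by (simp_all add: A_def flip: cinner_cadjoint[OF lin] cinner_cadjoint'[OF lin])
  define E where "E \<sigma> = {z. A z = complex_of_real (\<sigma>\<^sup>2) *\<^sub>C z}" for \<sigma>
  define M where "M = (\<Union>\<sigma>\<in>{0<..}. E \<sigma>)"
  have "orthonormal_set ({} :: 'a set)" by (simp add: orthonormal_set_def)
  from orthonormal_extension[OF this, of M]
  obtain U where U: "orthonormal_set U" "U \<subseteq> M"
    "\<And>z. z \<in> M \<Longrightarrow> norm z = 1 \<Longrightarrow> \<exists>u\<in>U. cinner z u \<noteq> 0" by auto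
  have cU: "cinner u v = (if u = v then 1 else 0)" if "u \<in> U" "v \<in> U" for u v
    using U(1) that by (auto simp: orthonormal_set_def)
  have normU: "norm u = 1" if "u \<in> U" for u
    using onfam_norm[OF U(1)[unfolded orthonormal_set_iff_onfam] that] .
  have Esub: "complex_vector.subspace (E \<sigma>)" for \<sigma>
    by (rule complex_vector.subspaceI)
       (auto simp: E_def blinfun.zero_right scaleC.zero_right blinfun.add_right scaleC_add_right
         clinear_op_scaleC[OF Alin] scaleC_scaleC mult.commute)
  have EM: "\<sigma> > 0 \<Longrightarrow> z \<in> E \<sigma> \<Longrightarrow> z \<in> M" for \<sigma> z by (auto simp: M_def)
  have normT: "norm (T u) = \<sigma>" if "u \<in> U" "u \<in> E \<sigma>" "\<sigma> > 0" for u \<sigma>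
  proof -
    have "complex_of_real ((norm (T u))\<^sup>2) = complex_of_real (\<sigma>\<^sup>2)"
      using that cU[of u u] A(1)[of u u] by (simp add: E_def cinner_self)
    then have "(norm (T u))\<^sup>2 = \<sigma>\<^sup>2" using of_real_eq_iff by blast
    then show ?thesis using that by (simp add: power2_eq_iff_nonneg)
  qed
  have UE: "u \<in> E (norm (T u)) \<and> norm (T u) > 0" if uU: "u \<in> U" for u
  proof -
    obtain \<sigma> where "\<sigma> > 0" "u \<in> E \<sigma>" using U(2) uU unfolding M_def by auto
    with normT[OF uU] show ?thesis by simp
  qed
  have U\<sigma>: "{u \<in> U. norm (T u) = \<sigma>} = U \<inter> E \<sigma>" if "\<sigma> > 0" for \<sigma>
    using normT UE that by auto
  have Torth: "cinner (T u) (T v) = 0" if "u \<in> U" "v \<in> U" "u \<noteq> v" for u v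
    using UE[OF that(1)] cU[OF that(1,2)] that(3) A(1)[of u v] by (simp add: E_def)
  \<comment> \<open>Images of distinct elements of U are orthogonal, so those of norm \<sigma> keep
    distance at least \<sigma>; infinitely many of them cannot lie in a compact set.\<close>
  have fin: "finite {u \<in> U. norm (T u) = \<sigma>}" if "\<sigma> > 0" for \<sigma>
  proof (rule ccontr)
    let ?V = "{u \<in> U. norm (T u) = \<sigma>}"
    assume inf: "infinite ?V"
    have dist: "dist (T u) (T v) \<ge> \<sigma>" if "u \<in> ?V" "v \<in> ?V" "u \<noteq> v" for u v
    proof -
      have "(norm (T u - T v))\<^sup>2 = \<sigma>\<^sup>2 + \<sigma>\<^sup>2"
        using norm_sq_add[of "T u" "- T v"] Torth[of u v] that by (simp add: cinner.minus_right)
      then have "\<sigma>\<^sup>2 \<le> (norm (T u - T v))\<^sup>2" using zero_le_power2[of \<sigma>] by linarith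
      then show ?thesis unfolding dist_norm by (rule power2_le_imp_le) simp
    qed
    have "inj_on T ?V"
    proof (intro inj_onI, rule ccontr)
      fix u v assume "u \<in> ?V" "v \<in> ?V" "T u = T v" "u \<noteq> v"
      with dist[of u v] \<open>\<sigma> > 0\<close> show False by simp
    qed
    then have "infinite (T ` ?V)" using inf finite_imageD by blast
    moreover have "T ` ?V \<subseteq> closure (T ` cball 0 1)"
      using normU by (auto intro!: subsetD[OF closure_subset])
    ultimately obtain y where y: "y islimpt (T ` ?V)"
      using cpt Heine_Borel_imp_Bolzano_Weierstrass unfolding compact_op_def by blast
    define S where "S = T ` ?V \<inter> ball y (\<sigma> / 2)"
    have S: "infinite S"
      using y[unfolded islimpt_eq_infinite_ball, rule_format, of "\<sigma> / 2"] \<open>\<sigma> > 0\<close>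
      unfolding S_def by linarith
    obtain a where a: "a \<in> S" using infinite_imp_nonempty[OF S] by blast
    obtain b where b: "b \<in> S" "a \<noteq> b"
      using infinite_imp_nonempty[OF infinite_remove[OF S], of a] by blast
    have ab: "dist y a < \<sigma> / 2" "dist y b < \<sigma> / 2" using a b(1) unfolding S_def Int_iff mem_ball by simp_all
    obtain u v where "u \<in> ?V" "a = T u" "v \<in> ?V" "b = T v" using a b(1) unfolding S_def by blast
    moreover from this b(2) have "u \<noteq> v" by blast
    ultimately have "\<sigma> \<le> dist a b" using dist[of u v] by blast
    then show False using dist_triangle3[of a b y] ab by linarith
  qed
  have compl: "z = 0" if z: "z \<in> M" "\<And>u. u \<in> U \<Longrightarrow> cinner z u = 0" for z
  proof (rule ccontr)
    assume "z \<noteq> 0"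
    then have "norm (complex_of_real (1 / norm z) *\<^sub>C z) = 1" by (simp add: norm_scaleC norm_divide)
    moreover have "complex_of_real (1 / norm z) *\<^sub>C z \<in> M"
      using z(1) complex_vector.subspace_scale[OF Esub] unfolding M_def by blast
    ultimately show False using U(3) z(2) by fastforce
  qed
  have card: "card {u \<in> U. norm (T u) = \<sigma>} = singular_multiplicity T \<sigma>" if \<sigma>: "\<sigma> > 0" for \<sigma>
  proof -
    let ?V = "{u \<in> U. norm (T u) = \<sigma>}"
    have onV: "orthonormal_set ?V" using U(1) by (auto simp: orthonormal_set_def)
    have "z \<in> complex_vector.span ?V" if z: "z \<in> E \<sigma>" for z
    proof -
      \<comment> \<open>The part of z outside the span of \<open>?V\<close> is again in
        \<open>E \<sigma>\<close> and orthogonal to all of U: to \<open>?V\<close> by projection, to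
        the rest because eigenvectors for distinct eigenvalues are orthogonal. By
        \<open>compl\<close> it is zero.\<close>
      define w where "w = z - onproj (\<lambda>x. x) ?V z"
      have "onproj (\<lambda>x. x) ?V z \<in> complex_vector.span ?V"
        using onproj_in_span[of "\<lambda>x. x" ?V z] by simp
      moreover have "complex_vector.span ?V \<subseteq> E \<sigma>"
        using U\<sigma>[OF \<sigma>] by (intro complex_vector.span_minimal Esub) auto
      ultimately have wE: "w \<in> E \<sigma>"
        unfolding w_def using z by (intro complex_vector.subspace_diff[OF Esub]) auto
      have "cinner w u = 0" if u: "u \<in> U" for u
      proof (cases "norm (T u) = \<sigma>")
        case True
        then show ?thesis
          using onproj_orthogonal[of ?V "\<lambda>x. x" u z] fin[OF \<sigma>] onV u
          by (simp add: w_def orthonormal_set_iff_onfam complex_vector.span_base)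
      next
        case False
        have "complex_of_real (\<sigma>\<^sup>2) * cinner w u = complex_of_real ((norm (T u))\<^sup>2) * cinner w u"
          using A[of w u] UE[OF u] wE by (simp add: E_def)
        moreover have "\<sigma>\<^sup>2 \<noteq> (norm (T u))\<^sup>2" using False \<sigma> by (simp add: power2_eq_iff_nonneg)
        then have "complex_of_real (\<sigma>\<^sup>2) \<noteq> complex_of_real ((norm (T u))\<^sup>2)" using of_real_eq_iff by blast
        ultimately show ?thesis by simp
      qed
      then have "w = 0" using compl EM[OF \<sigma> wE] by blast
      then show ?thesis using \<open>onproj (\<lambda>x. x) ?V z \<in> complex_vector.span ?V\<close> by (simp add: w_def)
    qed
    then have "complex_vector.dim (E \<sigma>) = card ?V"
      using U\<sigma>[OF \<sigma>] onfam_independent[OF onV] by (intro complex_vector.dim_unique[where B = ?V]) auto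
    then show ?thesis by (simp add: singular_multiplicity_def E_def A_def)
  qed
  have ker: "T z = 0" if z: "\<And>u. u \<in> U \<Longrightarrow> cinner z u = 0" for z
  proof (rule ccontr)
    assume "T z \<noteq> 0"
    \<comment> \<open>The orthogonal complement of U is closed, and invariant under A because U
      consists of eigenvectors.\<close>
    define W where "W = {w. \<forall>u\<in>U. cinner w u = 0}"
    have "W = (\<Inter>u\<in>U. {w. cinner w u = 0})" by (auto simp: W_def)
    then have "closed W"
      by (auto intro!: closed_INT closed_Collect_eq cinner.continuous_on continuous_intros)
    moreover have "cadjoint T (T w) \<in> W" if "w \<in> W" for w
    proof -
      have "cinner (A w) u = 0" if "u \<in> U" for u
        using A[of w u] UE[OF that] \<open>w \<in> W\<close> that by (simp add: E_def W_def)
      then show ?thesis by (simp add: W_def A_def)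
    qed
    moreover have "c *\<^sub>C w \<in> W" if "w \<in> W" for c w using that by (simp add: W_def)
    moreover have "z \<in> W" using z by (simp add: W_def)
    ultimately obtain v s where v: "v \<in> W" "norm v = 1" "s > 0"
      "cadjoint T (T v) = complex_of_real (s\<^sup>2) *\<^sub>C v"
      using exists_singular_vector[OF lin cpt, of W z] \<open>T z \<noteq> 0\<close> by metis
    then have "v \<in> M" by (intro EM[of s]) (auto simp: E_def A_def)
    with v(1,2) U(3) show False by (auto simp: W_def)
  qed
  show thesis
    by (rule that[OF U(1) _ Torth ker fin card]) (use UE in auto)
qed

section \<open>Trace class operators\<close>

lemma bessel_cauchy_schwarz:
  assumes e: "bessel_fam e I" and f: "bessel_fam f I"
  shows "(\<Sum>i\<in>I. cmod (cinner z (e i)) * cmod (cinner w (f i))) \<le> norm z * norm w"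
proof -
  have "(\<Sum>i\<in>I. cmod (cinner z (e i)) * cmod (cinner w (f i)))
      \<le> L2_set (\<lambda>i. cmod (cinner z (e i))) I * L2_set (\<lambda>i. cmod (cinner w (f i))) I"
    using L2_set_mult_ineq[of "\<lambda>i. cmod (cinner z (e i))" "\<lambda>i. cmod (cinner w (f i))" I] by simp
  also have "\<dots> \<le> norm z * norm w"
    using e f by (intro mult_mono) (auto simp: L2_set_def bessel_fam_def intro!: real_le_lsqrt sum_nonneg)
  finally show ?thesis .
qed

lemma cmod_cinner_commute: "cmod (cinner x y) = cmod (cinner y x)" for x :: "'a::chilbert_space"
  by (metis cinner_commute complex_mod_cnj)

text \<open>Grouping F by the value of \<open>norm (T u)\<close> turns a sum over vectors into one
  over singular values; each group is no larger than the multiplicity, which leaves a partial sum of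
  the series for \<open>trace_norm\<close>.\<close>

lemma singular_sum_le_trace_norm:
  fixes T :: "'a::chilbert_space \<Rightarrow>\<^sub>L 'a"
  assumes T: "T \<in> trace_class" and F: "finite F" "\<And>u. u \<in> F \<Longrightarrow> T u \<noteq> 0"
    and fin: "\<And>\<sigma>. \<sigma> > 0 \<Longrightarrow> finite {u \<in> U. norm (T u) = \<sigma>}" and FU: "F \<subseteq> U"
    and card: "\<And>\<sigma>. \<sigma> > 0 \<Longrightarrow> card {u \<in> U. norm (T u) = \<sigma>} = singular_multiplicity T \<sigma>"
  shows "(\<Sum>u\<in>F. norm (T u)) \<le> trace_norm T"
proof -
  let ?g = "\<lambda>\<sigma>. \<sigma> * real (singular_multiplicity T \<sigma>)"
  let ?B = "(\<lambda>u. norm (T u)) ` F"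
  have pos: "\<sigma> > 0" if "\<sigma> \<in> ?B" for \<sigma> using F(2) that by auto
  have "(\<Sum>u\<in>F. norm (T u)) = (\<Sum>\<sigma>\<in>?B. \<Sum>u\<in>{u\<in>F. norm (T u) = \<sigma>}. norm (T u))"
    by (rule sum.image_gen[OF F(1)])
  also have "\<dots> = (\<Sum>\<sigma>\<in>?B. \<sigma> * real (card {u\<in>F. norm (T u) = \<sigma>}))"
    by (intro sum.cong refl) (simp add: mult.commute)
  also have "\<dots> \<le> (\<Sum>\<sigma>\<in>?B. ?g \<sigma>)"
  proof (intro sum_mono mult_left_mono)
    fix \<sigma> assume "\<sigma> \<in> ?B"
    from pos[OF this] show "real (card {u \<in> F. norm (T u) = \<sigma>}) \<le> real (singular_multiplicity T \<sigma>)" "0 \<le> \<sigma>"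
      using card_mono[OF fin, of \<sigma> "{u \<in> F. norm (T u) = \<sigma>}"] FU card[of \<sigma>] by auto
  qed
  also have "\<dots> \<le> trace_norm T"
    unfolding trace_norm_def using T F(1) pos
    by (intro finite_sum_le_infsum) (auto simp: trace_class_def)
  finally show ?thesis .
qed

text \<open>Bessel rather than orthonormal families are used because they are stable under
  contractions and can be split along a projection.\<close>

lemma trace_norm_bessel:
  fixes T :: "'a::chilbert_space \<Rightarrow>\<^sub>L 'a"
  assumes T: "T \<in> trace_class" and e: "bessel_fam e I" and f: "bessel_fam f I"
  shows "(\<Sum>i\<in>I. cmod (cinner (T (e i)) (f i))) \<le> trace_norm T"
proof -
  have lin: "clinear_op T" and cpt: "compact_op T" using T by (auto simp: trace_class_def)
  obtain U where U: "orthonormal_set U" "\<And>u. u \<in> U \<Longrightarrow> T u \<noteq> 0"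
    and orth: "\<And>u v. u \<in> U \<Longrightarrow> v \<in> U \<Longrightarrow> u \<noteq> v \<Longrightarrow> cinner (T u) (T v) = 0"
    and ker: "\<And>z. (\<And>u. u \<in> U \<Longrightarrow> cinner z u = 0) \<Longrightarrow> T z = 0"
    and fin: "\<And>\<sigma>. \<sigma> > 0 \<Longrightarrow> finite {u \<in> U. norm (T u) = \<sigma>}"
    and card: "\<And>\<sigma>. \<sigma> > 0 \<Longrightarrow> card {u \<in> U. norm (T u) = \<sigma>} = singular_multiplicity T \<sigma>"
  proof (rule singular_system[OF lin cpt], goal_cases)
    case (1 U)
    show ?case by (rule 1(1)[OF 1(2-7)])
  qed
  have normU: "u \<in> U \<Longrightarrow> norm u = 1" for u
    using onfam_norm[OF U(1)[unfolded orthonormal_set_iff_onfam]] .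
  \<comment> \<open>The singular value expansion of T. Only the projection of z to the closed span
    of U matters, since T vanishes on the complement, and there the Fourier series applies.\<close>
  have expand: "((\<lambda>u. cinner z u * cinner (T u) w) has_sum cinner (T z) w) U" for z w
  proof -
    let ?S = "closure (complex_vector.span U)"
    have "complex_vector.subspace ?S" "closed ?S"
      by (auto intro: csubspace_closure complex_vector.subspace_span)
    from exists_projection[OF this, of z]
    obtain p where p: "p \<in> ?S" "\<And>s. s \<in> ?S \<Longrightarrow> cinner s (z - p) = 0" by blast
    have orth: "cinner (z - p) u = 0" if "u \<in> U" for u
      using p(2)[of u] complex_vector.span_base[OF that] closure_subset
      by (metis cinner_commute complex_cnj_zero subsetD)
    then have "T (z - p) = 0" by (rule ker)
    then have Tz: "T z = T p" by (simp add: blinfun.diff_right)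
    have zu: "cinner z u = cinner p u" if "u \<in> U" for u
      using orth[OF that] by (simp add: cinner.diff_left)
    have "((\<lambda>u. cinner p u *\<^sub>C u) has_sum p) U"
      using fourier_has_sum[of "\<lambda>x. x" U p] U(1) p(1) by (simp add: orthonormal_set_iff_onfam)
    from has_sum_bounded_linear[OF bounded_linear_compose[OF cinner.bounded_linear_left[of w]
          blinfun.bounded_linear_right[of T]] this]
    have "((\<lambda>u. cinner (T (cinner p u *\<^sub>C u)) w) has_sum cinner (T p) w) U" by (simp add: o_def)
    then have "((\<lambda>u. cinner p u * cinner (T u) w) has_sum cinner (T p) w) U"
      by (simp add: clinear_op_scaleC[OF lin])
    then show ?thesis unfolding Tz by (rule has_sum_cong[THEN iffD1, rotated]) (simp add: zu)
  qed
  \<comment> \<open>Exchanging the sums leaves one Cauchy-Schwarz estimate for each u, worth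
    \<open>norm (T u)\<close>. Truncation to a finite F allows the exchange; the limit in F follows
    below.\<close>
  have fin_bound: "(\<Sum>i\<in>I. cmod (\<Sum>u\<in>F. cinner (e i) u * cinner (T u) (f i))) \<le> trace_norm T"
    if F: "finite F" "F \<subseteq> U" for F
  proof -
    have "(\<Sum>i\<in>I. cmod (\<Sum>u\<in>F. cinner (e i) u * cinner (T u) (f i)))
        \<le> (\<Sum>i\<in>I. \<Sum>u\<in>F. cmod (cinner u (e i)) * cmod (cinner (T u) (f i)))"
      by (intro sum_mono order_trans[OF norm_sum]) (simp add: norm_mult cmod_cinner_commute)
    also have "\<dots> = (\<Sum>u\<in>F. \<Sum>i\<in>I. cmod (cinner u (e i)) * cmod (cinner (T u) (f i)))"
      by (rule sum.swap)
    also have "\<dots> \<le> (\<Sum>u\<in>F. norm (T u))"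
    proof (rule sum_mono)
      fix u assume "u \<in> F"
      then show "(\<Sum>i\<in>I. cmod (cinner u (e i)) * cmod (cinner (T u) (f i))) \<le> norm (T u)"
        using bessel_cauchy_schwarz[OF e f, of u "T u"] normU[of u] F(2) by auto
    qed
    also have "\<dots> \<le> trace_norm T"
      using F U(2) by (intro singular_sum_le_trace_norm[OF T _ _ fin _ card]) auto
    finally show ?thesis .
  qed
  have "((\<lambda>F. \<Sum>i\<in>I. cmod (\<Sum>u\<in>F. cinner (e i) u * cinner (T u) (f i)))
      \<longlongrightarrow> (\<Sum>i\<in>I. cmod (cinner (T (e i)) (f i)))) (finite_subsets_at_top U)"
    using expand unfolding has_sum_def by (intro tendsto_sum tendsto_norm) auto
  then show ?thesis
    by (rule tendsto_upperbound) (auto intro!: eventually_finite_subsets_at_top_weakI fin_bound)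
qed

lemma trace_norm_onfam:
  fixes T :: "'a::chilbert_space \<Rightarrow>\<^sub>L 'a"
  assumes "T \<in> trace_class" "finite I" "onfam e I" "onfam f I"
  shows "(\<Sum>i\<in>I. cmod (cinner (T (e i)) (f i))) \<le> trace_norm T"
  using assms by (intro trace_norm_bessel bessel_onfam)

section \<open>Finite rank operators and a criterion for compactness\<close>

definition finite_rank :: "nat \<Rightarrow> (nat \<Rightarrow> 'b::chilbert_space) \<Rightarrow> (nat \<Rightarrow> 'a::chilbert_space) \<Rightarrow> ('a \<Rightarrow>\<^sub>L 'b)" where
  "finite_rank n a b = (\<Sum>i<n. rank_one (a i) (b i))"

text \<open>Each rank one summand sends the unit ball into the multiples of \<open>a n\<close> by
  scalars from a closed disc, a compact set, and sums of compact sets are compact.\<close>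

lemma finite_rank_compact_image:
  "\<exists>K. compact K \<and> (\<forall>z\<in>cball 0 1. finite_rank n a b z \<in> K)"
proof (induction n)
  case 0
  show ?case by (intro exI[of _ "{0}"]) (simp add: finite_rank_def)
next
  case (Suc n)
  then obtain K where K: "compact K" "\<And>z. z \<in> cball 0 1 \<Longrightarrow> finite_rank n a b z \<in> K" by blast
  define Z where "Z = (\<lambda>c. c *\<^sub>C a n) ` cball 0 (norm (b n))"
  have "compact Z"
    unfolding Z_def by (intro compact_continuous_image scaleC.continuous_on continuous_intros) simp
  with K(1) have "compact {x + y |x y. x \<in> K \<and> y \<in> Z}" by (rule compact_sums)
  moreover have "finite_rank (Suc n) a b z \<in> {x + y |x y. x \<in> K \<and> y \<in> Z}" if z: "z \<in> cball 0 1" for z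
  proof -
    have "cmod (cinner z (b n)) \<le> norm (b n)"
      using norm_cinner_le[of z "b n"] z mult_left_le_one_le[of "norm (b n)" "norm z"] by simp
    then have "cinner z (b n) *\<^sub>C a n \<in> Z" by (auto simp: Z_def)
    moreover have "finite_rank (Suc n) a b z = finite_rank n a b z + cinner z (b n) *\<^sub>C a n"
      by (simp add: finite_rank_def blinfun.add_left)
    ultimately show ?thesis using K(2)[OF z] by blast
  qed
  ultimately show ?case by blast
qed

lemma compact_op_finite_rank_limit:
  fixes T :: "'a::chilbert_space \<Rightarrow>\<^sub>L 'b::chilbert_space"
  assumes approx: "\<And>\<epsilon>. \<epsilon> > 0 \<Longrightarrow> \<exists>n a b. \<forall>z. norm (T z - finite_rank n a b z) \<le> \<epsilon> * norm z"
  shows "compact_op T"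
  unfolding compact_op_def compact_eq_totally_bounded
proof (intro conjI allI impI)
  show "complete (closure (blinfun_apply T ` cball 0 1))" by (simp add: complete_eq_closed)
  fix r :: real assume r: "r > 0"
  obtain n a b where F: "\<And>z. norm (T z - finite_rank n a b z) \<le> (r/3) * norm z"
    using approx[of "r/3"] r by auto
  obtain K where K: "compact K" "\<And>z. z \<in> cball 0 1 \<Longrightarrow> finite_rank n a b z \<in> K"
    using finite_rank_compact_image[of n a b] by metis
  obtain k where k: "finite k" "K \<subseteq> (\<Union>x\<in>k. ball x (r/3))"
    using K(1)[unfolded compact_eq_totally_bounded, THEN conjunct2, rule_format, of "r/3"] r by auto
  \<comment> \<open>Closed balls are used so that the closure of the image stays covered; their
    radius leaves room for open balls of radius r.\<close>
  have "blinfun_apply T ` cball 0 1 \<subseteq> (\<Union>x\<in>k. cball x (2*r/3))"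
  proof clarify
    fix z :: 'a assume z: "z \<in> cball 0 1"
    then obtain x where x: "x \<in> k" "dist x (finite_rank n a b z) < r/3" using K(2) k(2) by force
    have "dist (finite_rank n a b z) (T z) \<le> r/3 * norm z"
      using F[of z] by (simp add: dist_norm norm_minus_commute)
    also have "\<dots> \<le> r/3" using z r by (simp add: mult_left_le)
    finally have "dist x (T z) \<le> 2*r/3"
      using dist_triangle[of x "T z" "finite_rank n a b z"] x(2) by linarith
    then show "T z \<in> (\<Union>x\<in>k. cball x (2*r/3))" using x(1) by auto
  qed
  then have "closure (blinfun_apply T ` cball 0 1) \<subseteq> (\<Union>x\<in>k. cball x (2*r/3))"
    using k(1) by (intro closure_minimal closed_UN) auto
  also have "\<dots> \<subseteq> (\<Union>x\<in>k. ball x r)" using r by (intro UN_mono) auto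
  finally show "\<exists>k. finite k \<and> closure (blinfun_apply T ` cball 0 1) \<subseteq> (\<Union>x\<in>k. ball x r)"
    using k(1) by blast
qed

text \<open>The finite rank operator \<open>Q T + (1 - Q) T P\<close> approximates \<open>T\<close> with error
  \<open>(1 - Q) T (1 - P)\<close>, where \<open>P\<close> and \<open>Q\<close> are the projections onto the spans of \<open>e\<close> and \<open>f\<close>.\<close>

definition compression :: "('a::chilbert_space \<Rightarrow>\<^sub>L 'a) \<Rightarrow> nat \<Rightarrow> (nat \<Rightarrow> 'a) \<Rightarrow> (nat \<Rightarrow> 'a) \<Rightarrow> ('a \<Rightarrow>\<^sub>L 'a)" where
  "compression T n e f = finite_rank n f (\<lambda>i. cadjoint T (f i))
     + finite_rank n (\<lambda>i. T (e i) - onproj f {..<n} (T (e i))) e"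

lemma finite_rank_add_rank_one: "\<exists>m a' b'. finite_rank n a b + rank_one c d = finite_rank m a' b'"
proof (intro exI)
  have "(\<Sum>i<n. rank_one (a i) (b i)) = (\<Sum>i<n. rank_one ((a(n := c)) i) ((b(n := d)) i))"
    by (intro sum.cong) auto
  then show "finite_rank n a b + rank_one c d = finite_rank (Suc n) (a(n := c)) (b(n := d))"
    by (simp add: finite_rank_def)
qed

lemma finite_rank_add: "\<exists>m a'' b''. finite_rank n a b + finite_rank n' a' b' = finite_rank m a'' b''"
proof (induction n')
  case 0
  show ?case by (auto simp: finite_rank_def[of 0])
next
  case (Suc n')
  then obtain m a'' b'' where "finite_rank n a b + finite_rank n' a' b' = finite_rank m a'' b''" by blast
  then have "finite_rank n a b + finite_rank (Suc n') a' b' = finite_rank m a'' b'' + rank_one (a' n') (b' n')"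
    by (simp add: finite_rank_def add.assoc)
  then show ?case using finite_rank_add_rank_one by metis
qed

lemma compression_is_finite_rank: "\<exists>m a b. compression T n e f = finite_rank m a b"
  unfolding compression_def by (rule finite_rank_add)

lemma compression_error:
  assumes "clinear_op T"
  shows "cinner ((T - compression T n e f) z) w
    = cinner (T (z - onproj e {..<n} z)) (w - onproj f {..<n} w)"
proof -
  let ?P = "onproj e {..<n}" and ?Q = "onproj f {..<n}"
  have "compression T n e f z = ?Q (T z) + (T (?P z) - ?Q (T (?P z)))"
    by (simp add: compression_def finite_rank_def blinfun.add_left blinfun.sum_left blinfun.sum_right
        onproj_apply[of f _ "T z"] onproj_apply[of e _ z] clinear_op_scaleC[OF assms]
        clinear_op_scaleC[OF clinear_op_onproj] scaleC.diff_right sum_subtractf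
        cinner_cadjoint[OF assms])
  then have "(T - compression T n e f) z = T (z - ?P z) - ?Q (T (z - ?P z))"
    by (simp add: blinfun.diff_left blinfun.diff_right algebra_simps)
  then show ?thesis by (simp add: cinner.diff_left cinner.diff_right cinner_onproj_commute)
qed

lemma onfam_extend:
  fixes e :: "nat \<Rightarrow> 'a::chilbert_space"
  assumes e: "onfam e {..<n}" and z: "norm z = 1" "\<And>i. i < n \<Longrightarrow> cinner z (e i) = 0"
  shows "onfam (e(n := z)) {..<Suc n}"
proof -
  have "cinner z z = 1" using z(1) by (simp add: cinner_self)
  moreover have "cinner (e i) z = 0" if "i < n" for i
    using z(2)[OF that] by (metis cinner_commute complex_cnj_zero)
  ultimately show ?thesis
    using e z(2) by (auto simp: onfam_def less_Suc_eq)
qed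

text \<open>If e and f come within \<epsilon> of the supremum of these sums, T is at most \<epsilon>
  between unit vectors orthogonal to e and to f, since such a pair could be appended to the
  families. Hence the error of the compression has operator norm at most \<epsilon>, and T is a norm
  limit of finite rank operators.\<close>

lemma compact_opI_onfam_bound:
  fixes T :: "'a::chilbert_space \<Rightarrow>\<^sub>L 'a"
  assumes lin: "clinear_op T"
    and C: "\<And>(n :: nat) e f. onfam e {..<n} \<Longrightarrow> onfam f {..<n} \<Longrightarrow> (\<Sum>i<n. cmod (cinner (T (e i)) (f i))) \<le> C"
  shows "compact_op T"
proof (rule compact_op_finite_rank_limit)
  fix \<epsilon> :: real assume \<epsilon>: "\<epsilon> > 0"
  define \<S> where "\<S> = {\<Sum>i<n. cmod (cinner (T (e i)) (f i)) |(n :: nat) e f. onfam e {..<n} \<and> onfam f {..<n}}"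
  have bdd: "bdd_above \<S>" using C by (intro bdd_aboveI[of _ C]) (auto simp: \<S>_def)
  have "onfam (\<lambda>_. 0 :: 'a) {..<0 :: nat}" by (simp add: onfam_def)
  then have ne: "\<S> \<noteq> {}" unfolding \<S>_def by blast
  obtain x where x: "x \<in> \<S>" "Sup \<S> - \<epsilon> < x"
    using less_cSup_iff[OF ne bdd, of "Sup \<S> - \<epsilon>"] \<epsilon> by auto
  then obtain n :: nat and e f where ef: "onfam e {..<n}" "onfam f {..<n}"
    and x': "x = (\<Sum>i<n. cmod (cinner (T (e i)) (f i)))"
    unfolding \<S>_def by blast
  have sup: "Sup \<S> - \<epsilon> < (\<Sum>i<n. cmod (cinner (T (e i)) (f i)))" using x(2) x' by simp
  let ?P = "onproj e {..<n}" and ?Q = "onproj f {..<n}" and ?R = "T - compression T n e f"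
  have perp: "cinner (z - onproj g {..<n} z) (g i) = 0" if "onfam g {..<n}" "i < n" for g :: "nat \<Rightarrow> 'a" and z i
    using onproj_orthogonal[of "{..<n}" g "g i" z] that by (simp add: complex_vector.span_base)
  have unit: "cmod (cinner (T z) w) \<le> \<epsilon>" if "norm z = 1" "\<And>i. i < n \<Longrightarrow> cinner z (e i) = 0"
    "norm w = 1" "\<And>i. i < n \<Longrightarrow> cinner w (f i) = 0" for z w
  proof -
    have "(\<Sum>i<Suc n. cmod (cinner (T ((e(n := z)) i)) ((f(n := w)) i))) \<in> \<S>"
      unfolding \<S>_def using onfam_extend[OF ef(1) that(1,2)] onfam_extend[OF ef(2) that(3,4)] by blast
    from cSup_upper[OF this bdd] sup show ?thesis by simp
  qed
  have gen: "cmod (cinner (T z) w) \<le> \<epsilon> * norm z * norm w"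
    if zw: "\<And>i. i < n \<Longrightarrow> cinner z (e i) = 0" "\<And>i. i < n \<Longrightarrow> cinner w (f i) = 0" for z w
  proof (cases "z = 0 \<or> w = 0")
    case False
    let ?z = "complex_of_real (1 / norm z) *\<^sub>C z" and ?w = "complex_of_real (1 / norm w) *\<^sub>C w"
    have "cmod (cinner (T ?z) ?w) \<le> \<epsilon>"
      using False zw by (intro unit) (auto simp: norm_scaleC norm_divide)
    then show ?thesis
      using False by (simp add: clinear_op_scaleC[OF lin] norm_mult norm_divide field_simps)
  qed (auto simp: blinfun.zero_right cinner.zero_left cinner.zero_right)
  have contr: "norm (z - onproj g {..<n} z) \<le> norm z" if "onfam g {..<n}" for g :: "nat \<Rightarrow> 'a" and z
    using onproj_best[OF _ that complex_vector.span_zero, of z] by simp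
  have "norm (?R z) \<le> \<epsilon> * norm z" for z
  proof (cases "?R z = 0")
    case False
    have "(norm (?R z))\<^sup>2 = cmod (cinner (?R z) (?R z))" by (simp add: cinner_self norm_power)
    also have "\<dots> = cmod (cinner (T (z - ?P z)) (?R z - ?Q (?R z)))"
      by (simp only: compression_error[OF lin])
    also have "\<dots> \<le> \<epsilon> * norm (z - ?P z) * norm (?R z - ?Q (?R z))"
      by (intro gen perp ef)
    also have "\<dots> \<le> \<epsilon> * norm z * norm (?R z)"
      using \<epsilon> by (intro mult_mono contr ef) auto
    finally show ?thesis using False by (simp add: power2_eq_square)
  qed (use \<epsilon> in simp)
  moreover obtain m a b where "compression T n e f = finite_rank m a b"
    using compression_is_finite_rank by blast
  ultimately show "\<exists>n a b. \<forall>z. norm (T z - finite_rank n a b z) \<le> \<epsilon> * norm z"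
    by (metis blinfun.diff_left)
qed

text \<open>Converse of \<open>trace_norm_bessel\<close>. The singular vectors u and the normalised
  images T u form orthonormal families for which the sum in the hypothesis is a partial sum of the
  singular values, so C bounds the whole series.\<close>

theorem trace_classI:
  fixes T :: "'a::chilbert_space \<Rightarrow>\<^sub>L 'a"
  assumes lin: "clinear_op T"
    and C: "\<And>(n :: nat) e f. onfam e {..<n} \<Longrightarrow> onfam f {..<n} \<Longrightarrow> (\<Sum>i<n. cmod (cinner (T (e i)) (f i))) \<le> C"
  shows "T \<in> trace_class \<and> trace_norm T \<le> C"
proof -
  have cpt: "compact_op T" using compact_opI_onfam_bound[OF lin C] .
  obtain U where U: "orthonormal_set U" "\<And>u. u \<in> U \<Longrightarrow> T u \<noteq> 0"
    and orth: "\<And>u v. u \<in> U \<Longrightarrow> v \<in> U \<Longrightarrow> u \<noteq> v \<Longrightarrow> cinner (T u) (T v) = 0"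
    and ker: "\<And>z. (\<And>u. u \<in> U \<Longrightarrow> cinner z u = 0) \<Longrightarrow> T z = 0"
    and fin: "\<And>\<sigma>. \<sigma> > 0 \<Longrightarrow> finite {u \<in> U. norm (T u) = \<sigma>}"
    and card: "\<And>\<sigma>. \<sigma> > 0 \<Longrightarrow> card {u \<in> U. norm (T u) = \<sigma>} = singular_multiplicity T \<sigma>"
  proof (rule singular_system[OF lin cpt], goal_cases)
    case (1 U)
    show ?case by (rule 1(1)[OF 1(2-7)])
  qed
  let ?g = "\<lambda>\<sigma>. \<sigma> * real (singular_multiplicity T \<sigma>)"
  have bound: "sum ?g F \<le> C" if F: "finite F" "F \<subseteq> {0<..}" for F
  proof -
    \<comment> \<open>All singular vectors with value in F, finite because every multiplicity
      is.\<close>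
    define V where "V = (\<Union>\<sigma>\<in>F. {u \<in> U. norm (T u) = \<sigma>})"
    have finV: "finite V" unfolding V_def using F fin by blast
    have VU: "V \<subseteq> U" by (auto simp: V_def)
    have "sum ?g F = (\<Sum>\<sigma>\<in>F. \<Sum>u\<in>{u\<in>V. norm (T u) = \<sigma>}. norm (T u))"
    proof (rule sum.cong[OF refl])
      fix \<sigma> assume "\<sigma> \<in> F"
      then have "{u\<in>V. norm (T u) = \<sigma>} = {u \<in> U. norm (T u) = \<sigma>}" by (auto simp: V_def)
      then show "?g \<sigma> = (\<Sum>u\<in>{u\<in>V. norm (T u) = \<sigma>}. norm (T u))"
        using card[of \<sigma>] F(2) \<open>\<sigma> \<in> F\<close> by (auto simp: mult.commute)
    qed
    also have "\<dots> = (\<Sum>u\<in>V. norm (T u))"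
      using finV F(1) by (intro sum.group) (auto simp: V_def)
    also have "\<dots> \<le> C"
    proof -
      obtain h where h: "bij_betw h {..<card V} V"
        using ex_bij_betw_nat_finite[OF finV] by (auto simp: lessThan_atLeast0)
      define e where "e = h"
      define f where "f i = complex_of_real (1 / norm (T (h i))) *\<^sub>C T (h i)" for i
      have hU: "h i \<in> U" if "i < card V" for i
        using bij_betwE[OF h] that VU by blast
      have hne: "h i \<noteq> h j" if "i < card V" "j < card V" "i \<noteq> j" for i j
        using bij_betw_imp_inj_on[OF h] that by (auto simp: inj_on_def)
      have "onfam e {..<card V}"
        using U(1) hU hne by (auto simp: e_def onfam_def orthonormal_set_def)
      moreover have "onfam f {..<card V}"
        unfolding onfam_def
      proof (intro ballI)
        fix i j assume ij: "i \<in> {..<card V}" "j \<in> {..<card V}"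
        show "cinner (f i) (f j) = (if i = j then 1 else 0)"
          using U(2)[OF hU, of i] orth[OF hU hU, of i j] hne[of i j] ij
          by (auto simp: f_def cinner_self power2_eq_square)
      qed
      ultimately have "(\<Sum>i<card V. cmod (cinner (T (e i)) (f i))) \<le> C" by (rule C)
      also have "(\<Sum>i<card V. cmod (cinner (T (e i)) (f i))) = (\<Sum>i<card V. norm (T (h i)))"
        using U(2)[OF hU]
        by (intro sum.cong refl) (simp add: e_def f_def cinner_self norm_mult norm_divide norm_power power2_eq_square)
      also have "\<dots> = (\<Sum>u\<in>V. norm (T u))" by (rule sum.reindex_bij_betw[OF h])
      finally show ?thesis .
    qed
    finally show ?thesis .
  qed
  have "bdd_above (sum ?g ` {F. F \<subseteq> {0<..} \<and> finite F})"
    using bound by (auto intro!: bdd_aboveI2)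
  then have summ: "?g summable_on {0<..}"
    by (intro nonneg_bdd_above_summable_on) auto
  moreover have "trace_norm T \<le> C"
    unfolding trace_norm_def by (rule infsum_le_finite_sums[OF summ bound])
  ultimately show ?thesis using lin cpt by (simp add: trace_class_def)
qed

section \<open>Algebra and basic estimates of the trace norm\<close>

lemma trace_norm_nonneg: "0 \<le> trace_norm T"
  unfolding trace_norm_def by (rule infsum_nonneg) auto

lemma trace_class_clinear: "T \<in> trace_class \<Longrightarrow> clinear_op T"
  by (simp add: trace_class_def)

lemma
  shows trace_class_zero: "(0 :: 'a::chilbert_space \<Rightarrow>\<^sub>L 'a) \<in> trace_class"
    and trace_norm_zero: "trace_norm (0 :: 'a \<Rightarrow>\<^sub>L 'a) = 0"
proof -
  have "(0 :: 'a \<Rightarrow>\<^sub>L 'a) \<in> trace_class \<and> trace_norm (0 :: 'a \<Rightarrow>\<^sub>L 'a) \<le> 0"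
    by (rule trace_classI[OF clinear_op_zero]) (simp add: cinner.zero_left)
  then show "(0 :: 'a \<Rightarrow>\<^sub>L 'a) \<in> trace_class" "trace_norm (0 :: 'a \<Rightarrow>\<^sub>L 'a) = 0"
    using trace_norm_nonneg by (auto intro: antisym)
qed

lemma
  fixes S T :: "'a::chilbert_space \<Rightarrow>\<^sub>L 'a"
  assumes S: "S \<in> trace_class" and T: "T \<in> trace_class"
  shows trace_class_add: "S + T \<in> trace_class"
    and trace_norm_triangle: "trace_norm (S + T) \<le> trace_norm S + trace_norm T"
proof -
  have "S + T \<in> trace_class \<and> trace_norm (S + T) \<le> trace_norm S + trace_norm T"
  proof (rule trace_classI)
    fix n :: nat and e f :: "nat \<Rightarrow> 'a" assume ef: "onfam e {..<n}" "onfam f {..<n}"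
    have "(\<Sum>i<n. cmod (cinner ((S + T) (e i)) (f i)))
        \<le> (\<Sum>i<n. cmod (cinner (S (e i)) (f i)) + cmod (cinner (T (e i)) (f i)))"
      by (intro sum_mono) (simp add: blinfun.add_left cinner.add_left norm_triangle_ineq)
    also have "\<dots> \<le> trace_norm S + trace_norm T"
      unfolding sum.distrib using ef by (intro add_mono trace_norm_onfam S T) auto
    finally show "(\<Sum>i<n. cmod (cinner ((S + T) (e i)) (f i))) \<le> trace_norm S + trace_norm T" .
  qed (intro clinear_op_add trace_class_clinear S T)
  then show "S + T \<in> trace_class" "trace_norm (S + T) \<le> trace_norm S + trace_norm T" by auto
qed

lemma
  fixes T :: "'a::chilbert_space \<Rightarrow>\<^sub>L 'a"
  assumes T: "T \<in> trace_class"
  shows trace_class_scaleC: "scaleC_op c T \<in> trace_class"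
    and trace_norm_scaleC: "trace_norm (scaleC_op c T) \<le> cmod c * trace_norm T"
proof -
  have "scaleC_op c T \<in> trace_class \<and> trace_norm (scaleC_op c T) \<le> cmod c * trace_norm T"
  proof (rule trace_classI)
    fix n :: nat and e f :: "nat \<Rightarrow> 'a" assume ef: "onfam e {..<n}" "onfam f {..<n}"
    have "(\<Sum>i<n. cmod (cinner (scaleC_op c T (e i)) (f i))) = cmod c * (\<Sum>i<n. cmod (cinner (T (e i)) (f i)))"
      by (simp add: norm_mult sum_distrib_left)
    also have "\<dots> \<le> cmod c * trace_norm T"
      using ef by (intro mult_left_mono trace_norm_onfam T) auto
    finally show "(\<Sum>i<n. cmod (cinner (scaleC_op c T (e i)) (f i))) \<le> cmod c * trace_norm T" .
  qed (intro clinear_op_scaleC_op trace_class_clinear T)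
  then show "scaleC_op c T \<in> trace_class" "trace_norm (scaleC_op c T) \<le> cmod c * trace_norm T" by auto
qed

lemma uminus_eq_scaleC_op: "- T = scaleC_op (-1) T"
  by (rule blinfun_eqI) (simp add: blinfun.minus_left)

lemma trace_class_uminus: "T \<in> trace_class \<Longrightarrow> - T \<in> trace_class"
  unfolding uminus_eq_scaleC_op by (rule trace_class_scaleC)

lemma trace_norm_uminus:
  assumes "T \<in> trace_class"
  shows "trace_norm (- T) = trace_norm T"
  using trace_norm_scaleC[OF assms, of "-1"] trace_norm_scaleC[OF trace_class_uminus[OF assms], of "-1"]
  by (simp flip: uminus_eq_scaleC_op)

lemma trace_class_diff: "S \<in> trace_class \<Longrightarrow> T \<in> trace_class \<Longrightarrow> S - T \<in> trace_class"
  using trace_class_add[of S "- T"] trace_class_uminus[of T] by simp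

lemma trace_norm_minus_commute:
  "S \<in> trace_class \<Longrightarrow> T \<in> trace_class \<Longrightarrow> trace_norm (S - T) = trace_norm (T - S)"
  using trace_norm_uminus[OF trace_class_diff, of S T] by simp

lemma trace_norm_triangle_sub:
  "S \<in> trace_class \<Longrightarrow> T \<in> trace_class \<Longrightarrow> trace_norm S \<le> trace_norm (S - T) + trace_norm T"
  using trace_norm_triangle[OF trace_class_diff, of S T T] by simp

lemma
  fixes x y :: "'a::chilbert_space"
  shows trace_class_rank_one: "rank_one x y \<in> trace_class"
    and trace_norm_rank_one: "trace_norm (rank_one x y) \<le> norm x * norm y"
proof -
  have "rank_one x y \<in> trace_class \<and> trace_norm (rank_one x y) \<le> norm x * norm y"
  proof (rule trace_classI[OF clinear_op_rank_one])
    fix n :: nat and e f :: "nat \<Rightarrow> 'a" assume ef: "onfam e {..<n}" "onfam f {..<n}"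
    show "(\<Sum>i<n. cmod (cinner (rank_one x y (e i)) (f i))) \<le> norm x * norm y"
      using bessel_cauchy_schwarz[OF bessel_onfam bessel_onfam, OF _ ef(1) _ ef(2), of y x]
      by (simp add: norm_mult cmod_cinner_commute[of "e _"] mult.commute[of "norm x"])
  qed
  then show "rank_one x y \<in> trace_class" "trace_norm (rank_one x y) \<le> norm x * norm y" by auto
qed

lemma trace_class_sum: "(\<And>i. i \<in> I \<Longrightarrow> S i \<in> trace_class) \<Longrightarrow> (\<Sum>i\<in>I. S i) \<in> trace_class"
  by (induction I rule: infinite_finite_induct) (auto simp: trace_class_zero trace_class_add)

lemma trace_norm_sum:
  "(\<And>i. i \<in> I \<Longrightarrow> S i \<in> trace_class) \<Longrightarrow> trace_norm (\<Sum>i\<in>I. S i) \<le> (\<Sum>i\<in>I. trace_norm (S i))"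
  by (induction I rule: infinite_finite_induct)
     (auto simp: trace_norm_zero intro!: order_trans[OF trace_norm_triangle] trace_class_sum)

text \<open>A single unit vector is a Bessel family, which gives the estimate for unit z and w;
  homogeneity does the rest.\<close>

lemma cmod_cinner_le_trace_norm:
  fixes T :: "'a::chilbert_space \<Rightarrow>\<^sub>L 'a"
  assumes T: "T \<in> trace_class"
  shows "cmod (cinner (T z) w) \<le> trace_norm T * norm z * norm w"
proof (cases "z = 0 \<or> w = 0")
  case False
  define z' w' where "z' = complex_of_real (1 / norm z) *\<^sub>C z" and "w' = complex_of_real (1 / norm w) *\<^sub>C w"
  have "bessel_fam (\<lambda>_. v) {0 :: nat}" if "norm v = 1" for v :: 'a
    using that norm_cinner_le[of _ v] by (auto simp: bessel_fam_def power2_le_iff_abs_le)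
  moreover have "norm z' = 1" "norm w' = 1"
    using False by (simp_all add: z'_def w'_def norm_scaleC norm_divide)
  ultimately have "cmod (cinner (T z') w') \<le> trace_norm T"
    using trace_norm_bessel[OF T, of "\<lambda>_. z'" "{0 :: nat}" "\<lambda>_. w'"] by simp
  then show ?thesis
    using False by (simp add: z'_def w'_def clinear_op_scaleC[OF trace_class_clinear[OF T]]
        norm_mult norm_divide field_simps)
qed (auto simp: blinfun.zero_right cinner.zero_left cinner.zero_right)

lemma norm_le_trace_norm:
  fixes T :: "'a::chilbert_space \<Rightarrow>\<^sub>L 'a"
  assumes T: "T \<in> trace_class"
  shows "norm T \<le> trace_norm T"
proof (rule norm_blinfun_bound[OF trace_norm_nonneg])
  fix z
  show "norm (T z) \<le> trace_norm T * norm z"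
  proof (cases "T z = 0")
    case False
    have "(norm (T z))\<^sup>2 = cmod (cinner (T z) (T z))" by (simp add: cinner_self norm_power)
    also have "\<dots> \<le> trace_norm T * norm z * norm (T z)" by (rule cmod_cinner_le_trace_norm[OF T])
    finally show ?thesis using False by (simp add: power2_eq_square)
  qed (simp add: trace_norm_nonneg)
qed

section \<open>Density of finite rank operators in trace norm\<close>

lemma trace_class_finite_rank: "finite_rank n a b \<in> trace_class"
  unfolding finite_rank_def by (intro trace_class_sum trace_class_rank_one)

text \<open>Let e and f nearly attain \<open>trace_norm T\<close>. Arbitrary test families,
  projected off the spans of e and f, can be appended to e and f, and the enlarged sum is still at
  most \<open>trace_norm T\<close>. So little is left for the appended part, which is the test sum
  of the compression error.\<close>

lemma trace_class_approx:
  fixes T :: "'a::chilbert_space \<Rightarrow>\<^sub>L 'a"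
  assumes T: "T \<in> trace_class" and \<epsilon>: "\<epsilon> > 0"
  shows "\<exists>n a b. trace_norm (T - finite_rank n a b) \<le> \<epsilon>"
proof -
  have lin: "clinear_op T" by (rule trace_class_clinear[OF T])
  have "\<exists>(n::nat) e f. onfam e {..<n} \<and> onfam f {..<n} \<and>
      trace_norm T - \<epsilon> < (\<Sum>i<n. cmod (cinner (T (e i)) (f i)))"
  proof (rule ccontr)
    assume "\<not> ?thesis"
    then have "T \<in> trace_class \<and> trace_norm T \<le> trace_norm T - \<epsilon>"
      by (intro trace_classI lin) (auto simp: not_less)
    then show False using \<epsilon> by simp
  qed
  then obtain n :: nat and e f where ef: "onfam e {..<n}" "onfam f {..<n}"
    and big: "trace_norm T - \<epsilon> < (\<Sum>i<n. cmod (cinner (T (e i)) (f i)))" by blast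
  let ?R = "T - compression T n e f"
  \<comment> \<open>The enlarged family need not be orthonormal, but Pythagoras splits z into its
    projection and the rest, and each half of the family is Bessel on its own part.\<close>
  have bessel: "bessel_fam (case_sum g (\<lambda>j. g' j - onproj g {..<n} (g' j))) ({..<n} <+> {..<m})"
    if g: "onfam g {..<n}" "onfam g' {..<m}" for g g' :: "nat \<Rightarrow> 'a" and m
    unfolding bessel_fam_def
  proof (intro conjI allI)
    fix z
    let ?P = "onproj g {..<n}"
    have "cinner z (g' j - ?P (g' j)) = cinner (z - ?P z) (g' j)" for j
      by (simp add: cinner.diff_left cinner.diff_right cinner_onproj_commute)
    then have "(\<Sum>i\<in>{..<n} <+> {..<m}. (cmod (cinner z (case_sum g (\<lambda>j. g' j - ?P (g' j)) i)))\<^sup>2)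
        = (\<Sum>i<n. (cmod (cinner z (g i)))\<^sup>2) + (\<Sum>j<m. (cmod (cinner (z - ?P z) (g' j)))\<^sup>2)"
      by (simp add: sum.Plus)
    also have "\<dots> \<le> (norm (?P z))\<^sup>2 + (norm (z - ?P z))\<^sup>2"
      using bessel_onfam[OF _ g(2)] norm_onproj[OF _ g(1), of z] by (auto simp: bessel_fam_def)
    also have "\<dots> = (norm z)\<^sup>2" using onproj_pythagoras[OF _ g(1), of z] by simp
    finally show "(\<Sum>i\<in>{..<n} <+> {..<m}. (cmod (cinner z (case_sum g (\<lambda>j. g' j - ?P (g' j)) i)))\<^sup>2) \<le> (norm z)\<^sup>2" .
  qed simp
  have "?R \<in> trace_class \<and> trace_norm ?R \<le> \<epsilon>"
  proof (rule trace_classI)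
    obtain m a b where "compression T n e f = finite_rank m a b"
      using compression_is_finite_rank by blast
    then show "clinear_op ?R" by (simp add: clinear_op_diff lin trace_class_clinear trace_class_finite_rank)
    fix m :: nat and e' f' :: "nat \<Rightarrow> 'a" assume ef': "onfam e' {..<m}" "onfam f' {..<m}"
    have "(\<Sum>i<n. cmod (cinner (T (e i)) (f i))) + (\<Sum>j<m. cmod (cinner (?R (e' j)) (f' j))) \<le> trace_norm T"
      using trace_norm_bessel[OF T bessel[OF ef(1) ef'(1)] bessel[OF ef(2) ef'(2)]]
      by (simp add: sum.Plus compression_error[OF lin])
    then show "(\<Sum>j<m. cmod (cinner (?R (e' j)) (f' j))) \<le> \<epsilon>" using big by linarith
  qed
  then show ?thesis using compression_is_finite_rank[of T n e f] by metis
qed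

text \<open>Density in the form of an induction rule. It reduces basis independence of the trace,
  uniqueness of the partial traces and convergence of compressions to rank one operators and an
  estimate by the trace norm.\<close>

lemma trace_class_induct [consumes 1, case_names rank_one add limit]:
  fixes T :: "'a::chilbert_space \<Rightarrow>\<^sub>L 'a"
  assumes T: "T \<in> trace_class"
    and rank_one: "\<And>a b. P (rank_one a b)"
    and add: "\<And>S T. S \<in> trace_class \<Longrightarrow> T \<in> trace_class \<Longrightarrow> P S \<Longrightarrow> P T \<Longrightarrow> P (S + T)"
    and limit: "\<And>T. T \<in> trace_class \<Longrightarrow>
      (\<And>\<epsilon>. \<epsilon> > 0 \<Longrightarrow> \<exists>S\<in>trace_class. P S \<and> trace_norm (T - S) \<le> \<epsilon>) \<Longrightarrow> P T"
  shows "P T"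
proof -
  have "P (finite_rank n a b)" for n a b
  proof (induction n)
    case 0
    have "rank_one 0 0 = (0 :: 'a \<Rightarrow>\<^sub>L 'a)"
      by (rule blinfun_eqI) (simp add: scaleC.zero_right)
    then show ?case using rank_one[of 0 0] by (simp add: finite_rank_def)
  next
    case (Suc n)
    then have "P (finite_rank n a b + rank_one (a n) (b n))"
      by (intro add rank_one trace_class_finite_rank trace_class_rank_one)
    then show ?case by (simp add: finite_rank_def)
  qed
  moreover have "\<exists>S\<in>trace_class. P S \<and> trace_norm (T - S) \<le> \<epsilon>" if "\<epsilon> > 0" for \<epsilon>
  proof -
    obtain n a b where "trace_norm (T - finite_rank n a b) \<le> \<epsilon>"
      using trace_class_approx[OF T \<open>\<epsilon> > 0\<close>] by metis
    then show ?thesis using \<open>\<And>n a b. P (finite_rank n a b)\<close> trace_class_finite_rank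
      by (intro bexI[of _ "finite_rank n a b"]) simp_all
  qed
  ultimately show ?thesis by (intro limit[OF T])
qed

subsection \<open>The trace\<close>

lemma trace_norm_summable:
  fixes T :: "'a::chilbert_space \<Rightarrow>\<^sub>L 'a"
  assumes T: "T \<in> trace_class" and e: "onfam e I" and f: "onfam f I"
  shows "(\<lambda>i. cmod (cinner (T (e i)) (f i))) summable_on I"
    and "(\<lambda>i. cinner (T (e i)) (f i)) summable_on I"
    and "cmod (\<Sum>\<^sub>\<infinity>i\<in>I. cinner (T (e i)) (f i)) \<le> trace_norm T"
proof -
  have fin: "(\<Sum>i\<in>F. cmod (cinner (T (e i)) (f i))) \<le> trace_norm T" if "finite F" "F \<subseteq> I" for F
    using that by (intro trace_norm_onfam[OF T] onfam_subset[OF e] onfam_subset[OF f])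
  then have "bdd_above (sum (\<lambda>i. cmod (cinner (T (e i)) (f i))) ` {F. F \<subseteq> I \<and> finite F})"
    by (auto intro!: bdd_aboveI2)
  then show s: "(\<lambda>i. cmod (cinner (T (e i)) (f i))) summable_on I"
    by (intro nonneg_bdd_above_summable_on) auto
  then show "(\<lambda>i. cinner (T (e i)) (f i)) summable_on I"
    by (rule abs_summable_summable)
  have "cmod (\<Sum>\<^sub>\<infinity>i\<in>I. cinner (T (e i)) (f i)) \<le> (\<Sum>\<^sub>\<infinity>i\<in>I. cmod (cinner (T (e i)) (f i)))"
    by (rule norm_infsum_bound[OF s])
  also have "\<dots> \<le> trace_norm T" by (rule infsum_le_finite_sums[OF s fin])
  finally show "cmod (\<Sum>\<^sub>\<infinity>i\<in>I. cinner (T (e i)) (f i)) \<le> trace_norm T" .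
qed

lemma is_onb_onfam: "is_onb B \<Longrightarrow> onfam (\<lambda>x. x) B"
  by (simp add: is_onb_def orthonormal_set_iff_onfam)

text \<open>For rank one operators both sums are \<open>cinner x y\<close> by Parseval. Each sum is
  bounded by the trace norm, so the identity survives the limit.\<close>

lemma trace_basis_independent:
  fixes T :: "'a::chilbert_space \<Rightarrow>\<^sub>L 'a"
  assumes T: "T \<in> trace_class" and B: "is_onb B" and B': "is_onb B'"
  shows "(\<Sum>\<^sub>\<infinity>b\<in>B. cinner (T b) b) = (\<Sum>\<^sub>\<infinity>b\<in>B'. cinner (T b) b)"
  using T
proof (induction rule: trace_class_induct)
  case (rank_one x y)
  have "(\<Sum>\<^sub>\<infinity>b\<in>C. cinner (rank_one x y b) b) = cinner x y" if "is_onb C" for C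
    using infsumI[OF onb_parseval[OF that, of x y]] by (simp add: mult.commute)
  then show ?case using B B' by simp
next
  case (add S T)
  have "(\<Sum>\<^sub>\<infinity>b\<in>C. cinner ((S + T) b) b) = (\<Sum>\<^sub>\<infinity>b\<in>C. cinner (S b) b) + (\<Sum>\<^sub>\<infinity>b\<in>C. cinner (T b) b)"
    if "is_onb C" for C
    using trace_norm_summable(2)[OF add(1) is_onb_onfam is_onb_onfam, OF that that]
      trace_norm_summable(2)[OF add(2) is_onb_onfam is_onb_onfam, OF that that]
    by (simp add: blinfun.add_left cinner.add_left infsum_add)
  then show ?case using B B' add by simp
next
  case (limit T)
  have "cmod ((\<Sum>\<^sub>\<infinity>b\<in>B. cinner (T b) b) - (\<Sum>\<^sub>\<infinity>b\<in>B'. cinner (T b) b)) \<le> 0 + \<epsilon>" if "\<epsilon> > 0" for \<epsilon>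
  proof -
    obtain S where S: "S \<in> trace_class" "trace_norm (T - S) \<le> \<epsilon> / 2"
      and eq: "(\<Sum>\<^sub>\<infinity>b\<in>B. cinner (S b) b) = (\<Sum>\<^sub>\<infinity>b\<in>B'. cinner (S b) b)"
      using limit(2)[of "\<epsilon> / 2"] \<open>\<epsilon> > 0\<close> by auto
    have D: "T - S \<in> trace_class" by (rule trace_class_diff[OF limit(1) S(1)])
    have split: "(\<Sum>\<^sub>\<infinity>b\<in>C. cinner (T b) b) = (\<Sum>\<^sub>\<infinity>b\<in>C. cinner (S b) b) + (\<Sum>\<^sub>\<infinity>b\<in>C. cinner ((T - S) b) b)"
      and bd: "cmod (\<Sum>\<^sub>\<infinity>b\<in>C. cinner ((T - S) b) b) \<le> \<epsilon> / 2"
      if "is_onb C" for C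
      using trace_norm_summable(2)[OF S(1) is_onb_onfam is_onb_onfam, OF that that]
        trace_norm_summable(2,3)[OF D is_onb_onfam is_onb_onfam, OF that that] S(2)
      by (auto simp flip: infsum_add simp: blinfun.diff_left cinner.diff_left)
    show ?thesis
      unfolding split[OF B] split[OF B'] eq
      using bd[OF B] bd[OF B'] norm_triangle_ineq4[of "\<Sum>\<^sub>\<infinity>b\<in>B. cinner ((T - S) b) b"
          "\<Sum>\<^sub>\<infinity>b\<in>B'. cinner ((T - S) b) b"] by simp
  qed
  then have "cmod ((\<Sum>\<^sub>\<infinity>b\<in>B. cinner (T b) b) - (\<Sum>\<^sub>\<infinity>b\<in>B'. cinner (T b) b)) \<le> 0"
    by (rule field_le_epsilon)
  then show ?case by simp
qed

section \<open>Positive operators and their trace\<close>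

lemma
  assumes "psd_op T"
  shows psd_op_clinear: "clinear_op T"
    and psd_op_symmetric: "cinner (T x) y = cinner x (T y)"
    and psd_op_nonneg: "0 \<le> Re (cinner (T x) x)"
  using assms by (auto simp: psd_op_def)

lemma psd_op_quadratic_form: "psd_op T \<Longrightarrow> cinner (T x) x = complex_of_real (Re (cinner (T x) x))"
  by (rule complex_eqI) (use psd_op_symmetric[of T x x] arg_cong[OF cinner_commute[of "T x" x], of Im] in auto)

text \<open>Evaluates the nonnegative form at c x - y, with the phase c chosen so that the mixed
  term equals its modulus. This additive Cauchy-Schwarz inequality stands in for a square root of
  T.\<close>

lemma psd_op_cmod_le:
  assumes T: "psd_op T"
  shows "2 * cmod (cinner (T x) y) \<le> Re (cinner (T x) x) + Re (cinner (T y) y)"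
proof (cases "cinner (T x) y = 0")
  case False
  define c where "c = cnj (sgn (cinner (T x) y))"
  have n: "cmod c = 1" using False by (simp add: c_def norm_sgn)
  have c: "c * cinner (T x) y = complex_of_real (cmod (cinner (T x) y))"
    using False complex_norm_square[of "cinner (T x) y"]
    by (simp add: c_def sgn_eq power2_eq_square field_simps)
  have cc: "c * cnj c = 1" using complex_norm_square[of c] n by simp
  define v where "v = c *\<^sub>C x"
  have Tv: "T v = c *\<^sub>C T x" unfolding v_def by (rule clinear_op_scaleC[OF psd_op_clinear[OF T]])
  have sym: "Re (cinner (T y) v) = Re (cinner (T v) y)"
    unfolding psd_op_symmetric[OF T, of y] by (subst cinner_commute) simp
  have "cinner (T v) v = cinner (c *\<^sub>C T x) v" by (simp only: Tv)
  then have vv: "cinner (T v) v = cinner (T x) x"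
    using cc by (simp add: v_def mult.assoc[symmetric] mult.commute[of "cnj c"])
  have vy: "cinner (T v) y = complex_of_real (cmod (cinner (T x) y))" unfolding Tv by (simp add: c)
  have "0 \<le> Re (cinner (T (v - y)) (v - y))" by (rule psd_op_nonneg[OF T])
  also have "\<dots> = Re (cinner (T v) v) + Re (cinner (T y) y) - 2 * Re (cinner (T v) y)"
    using sym by (simp add: blinfun.diff_right cinner.diff_left cinner.diff_right)
  finally show ?thesis unfolding vv vy by simp
qed (use psd_op_nonneg[OF T, of x] psd_op_nonneg[OF T, of y] in simp)

text \<open>By \<open>psd_op_cmod_le\<close> a test sum is at most the average of two diagonal sums,
  and a finite diagonal sum is part of the trace in a basis extending the family. So the trace
  dominates the trace norm; the opposite estimate holds for every trace class operator.\<close>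

lemma psd_trace_has_sum:
  fixes T :: "'a::chilbert_space \<Rightarrow>\<^sub>L 'a"
  assumes psd: "psd_op T" and T: "T \<in> trace_class" and B: "is_onb B"
  shows "((\<lambda>b. Re (cinner (T b) b)) has_sum trace_norm T) B"
proof -
  let ?q = "\<lambda>b. Re (cinner (T b) b)"
  have summ: "?q summable_on C" if "is_onb C" for C
    by (rule summable_on_Re[OF trace_norm_summable(2)[OF T is_onb_onfam is_onb_onfam, OF that that]])
  have indep: "infsum ?q C = infsum ?q B" if C: "is_onb C" for C
    using infsum_Re[OF trace_norm_summable(2)[OF T is_onb_onfam is_onb_onfam, OF C C]]
      infsum_Re[OF trace_norm_summable(2)[OF T is_onb_onfam is_onb_onfam, OF B B]]
      trace_basis_independent[OF T B C] by simp
  have part: "(\<Sum>i<n. ?q (e i)) \<le> infsum ?q B" if e: "onfam e {..<n}" for e :: "nat \<Rightarrow> 'a" and n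
  proof -
    obtain C where C: "is_onb C" "e ` {..<n} \<subseteq> C"
      using orthonormal_extends_to_onb[OF onfam_image[OF e]] by blast
    have "(\<Sum>i<n. ?q (e i)) = sum ?q (e ` {..<n})"
      using onfam_inj_on[OF e] by (simp add: sum.reindex)
    also have "\<dots> \<le> infsum ?q C"
      using C psd_op_nonneg[OF psd] by (intro finite_sum_le_infsum summ) auto
    finally show ?thesis using indep[OF C(1)] by simp
  qed
  have "T \<in> trace_class \<and> trace_norm T \<le> infsum ?q B"
  proof (rule trace_classI[OF psd_op_clinear[OF psd]])
    fix n :: nat and e f :: "nat \<Rightarrow> 'a" assume ef: "onfam e {..<n}" "onfam f {..<n}"
    have "2 * (\<Sum>i<n. cmod (cinner (T (e i)) (f i))) \<le> (\<Sum>i<n. ?q (e i) + ?q (f i))"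
      unfolding sum_distrib_left by (intro sum_mono psd_op_cmod_le[OF psd])
    also have "\<dots> \<le> infsum ?q B + infsum ?q B"
      unfolding sum.distrib by (intro add_mono part ef)
    finally show "(\<Sum>i<n. cmod (cinner (T (e i)) (f i))) \<le> infsum ?q B" by simp
  qed
  moreover have "infsum ?q B \<le> trace_norm T"
    using trace_norm_summable(3)[OF T is_onb_onfam is_onb_onfam, OF B B]
      infsum_Re[OF trace_norm_summable(2)[OF T is_onb_onfam is_onb_onfam, OF B B]]
      complex_Re_le_cmod order_trans by metis
  ultimately have "infsum ?q B = trace_norm T" by simp
  then show ?thesis using summ[OF B] by (simp add: has_sum_iff)
qed

text \<open>\<open>trace_op\<close> sums over an unspecified basis; the formula for positive
  operators holds in any basis, so existence of one is enough.\<close>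

lemma psd_trace_op:
  fixes T :: "'a::chilbert_space \<Rightarrow>\<^sub>L 'a"
  assumes psd: "psd_op T" and T: "T \<in> trace_class"
  shows "trace_op T = complex_of_real (trace_norm T)"
proof -
  have B: "is_onb (SOME B :: 'a set. is_onb B)" by (rule someI_ex[OF onb_exists])
  show ?thesis
    unfolding trace_op_def
    using has_sum_of_real[OF psd_trace_has_sum[OF psd T B], where 'a = complex]
    by (intro infsumI) (simp flip: psd_op_quadratic_form[OF psd])
qed

lemma density_ops_iff: "T \<in> density_ops \<longleftrightarrow> psd_op T \<and> T \<in> trace_class \<and> trace_norm T = 1"
  using psd_trace_op[of T] by (auto simp: density_ops_def)

section \<open>Tensor products and partial traces\<close>

lemma closure_span_UNIV_subset:
  fixes A :: "'a::chilbert_space set"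
  assumes "closure (complex_vector.span A) = UNIV" "complex_vector.subspace W" "closed W" "A \<subseteq> W"
  shows "W = UNIV"
  using assms closure_minimal[OF complex_vector.span_minimal[OF assms(4,2)] assms(3)] by auto

section \<open>Product vectors, product bases and the form of the partial trace\<close>

lemma hilbert_tensor_swap: "hilbert_tensor t \<Longrightarrow> hilbert_tensor (\<lambda>y x. t x y)"
proof -
  assume t: "hilbert_tensor t"
  have "{t x y |y x. True} = {t x y |x y. True}" by auto
  with t show "hilbert_tensor (\<lambda>y x. t x y)"
    unfolding hilbert_tensor_def by (simp add: mult.commute)
qed

context
  fixes t :: "'a::chilbert_space \<Rightarrow> 'b::chilbert_space \<Rightarrow> 'c::chilbert_space"
  assumes tensor: "hilbert_tensor t"
begin

lemma tensor_cinner: "cinner (t x y) (t u v) = cinner x u * cinner y v"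
  using tensor by (simp add: hilbert_tensor_def)

lemma tensor_linear:
  shows "t (x + x') y = t x y + t x' y"
    and "t (c *\<^sub>C x) y = c *\<^sub>C t x y"
    and "t x (y + y') = t x y + t x y'"
    and "t x (c *\<^sub>C y) = c *\<^sub>C t x y"
  using tensor by (simp_all add: hilbert_tensor_def Vector_Spaces.linear_iff)

lemma norm_tensor: "norm (t x y) = norm x * norm y"
proof -
  have "complex_of_real ((norm (t x y))\<^sup>2) = complex_of_real ((norm x * norm y)\<^sup>2)"
    unfolding cinner_self[symmetric] tensor_cinner by (simp add: cinner_self power_mult_distrib)
  then have "(norm (t x y))\<^sup>2 = (norm x * norm y)\<^sup>2" using of_real_eq_iff by blast
  then show ?thesis by (simp add: power2_eq_iff_nonneg)
qed

lemma tensor_zero_left: "t 0 y = 0" and tensor_zero_right: "t x 0 = 0"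
  using norm_tensor[of 0 y] norm_tensor[of x 0] by auto

lemma bounded_linear_tensor_left: "bounded_linear (\<lambda>x. t x y)"
  by (rule bounded_linear_intro[where K = "norm y"])
     (simp_all add: tensor_linear scaleR_scaleC norm_tensor)

lemma bounded_linear_tensor_right: "bounded_linear (\<lambda>y. t x y)"
  by (rule bounded_linear_intro[where K = "norm x"])
     (simp_all add: tensor_linear scaleR_scaleC norm_tensor)

lemma onfam_tensor:
  assumes "onfam e I" "onfam f J"
  shows "onfam (\<lambda>(i, j). t (e i) (f j)) (I \<times> J)"
  using onfamD[OF assms(1)] onfamD[OF assms(2)] by (auto simp: onfam_def tensor_cinner)

text \<open>A vector orthogonal to all products of basis vectors is orthogonal to every
  \<open>t x b\<close> by totality of A, then to every \<open>t x y\<close> by totality of B, and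
  the product vectors are total by definition of the tensor product.\<close>

lemma onb_tensor:
  assumes A: "is_onb A" and B: "is_onb B"
  shows "is_onb ((\<lambda>(a, b). t a b) ` (A \<times> B))"
proof (rule is_onbI)
  show "orthonormal_set ((\<lambda>(a, b). t a b) ` (A \<times> B))"
    using onfam_image[OF onfam_tensor[OF is_onb_onfam[OF A] is_onb_onfam[OF B]]] .
  fix z assume z: "\<And>w. w \<in> (\<lambda>(a, b). t a b) ` (A \<times> B) \<Longrightarrow> cinner z w = 0"
  have step1: "cinner z (t x b) = 0" if b: "b \<in> B" for x b
  proof -
    have "{x. cinner z (t x b) = 0} = UNIV"
    proof (rule closure_span_UNIV_subset)
      show "closure (complex_vector.span A) = UNIV" using A by (simp add: is_onb_def)
      show "complex_vector.subspace {x. cinner z (t x b) = 0}"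
        by (rule complex_vector.subspaceI)
           (simp_all add: tensor_zero_left tensor_linear cinner.zero_right cinner.add_right)
      show "closed {x. cinner z (t x b) = 0}"
        by (intro closed_Collect_eq cinner.continuous_on continuous_on_const
            linear_continuous_on bounded_linear_tensor_left)
    qed (use z b in auto)
    then show ?thesis by auto
  qed
  have step2: "cinner z (t x y) = 0" for x y
  proof -
    have "{y. cinner z (t x y) = 0} = UNIV"
    proof (rule closure_span_UNIV_subset)
      show "closure (complex_vector.span B) = UNIV" using B by (simp add: is_onb_def)
      show "complex_vector.subspace {y. cinner z (t x y) = 0}"
        by (rule complex_vector.subspaceI)
           (simp_all add: tensor_zero_right tensor_linear cinner.zero_right cinner.add_right)
      show "closed {y. cinner z (t x y) = 0}"
        by (intro closed_Collect_eq cinner.continuous_on continuous_on_const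
            linear_continuous_on bounded_linear_tensor_right)
    qed (use step1 in auto)
    then show ?thesis by auto
  qed
  have "{w. cinner z w = 0} = UNIV"
  proof (rule closure_span_UNIV_subset)
    show "closure (complex_vector.span {t x y |x y. True}) = UNIV"
      using tensor by (simp add: hilbert_tensor_def)
    show "complex_vector.subspace {w. cinner z w = 0}"
      by (rule complex_vector.subspaceI) (simp_all add: cinner.zero_right cinner.add_right)
    show "closed {w. cinner z w = 0}"
      by (intro closed_Collect_eq cinner.continuous_on continuous_intros)
  qed (use step2 in auto)
  then have "cinner z z = 0" by blast
  then show "z = 0" by simp
qed

lemma onfam_tensor_right:
  assumes "norm x = 1" "onfam f J"
  shows "onfam (\<lambda>j. t x (f j)) J"
proof -
  have "cinner x x = 1" using assms(1) by (simp add: cinner_self)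
  then show ?thesis using onfamD[OF assms(2)] by (simp add: onfam_def tensor_cinner)
qed

text \<open>For unit vectors a and b the families \<open>t a f\<close> and \<open>t b f\<close> are
  orthonormal, so the trace norm controls the sum; the general case follows by scaling.\<close>

lemma partial_form_summable:
  assumes X: "X \<in> trace_class" and B: "is_onb B"
  shows "(\<lambda>f. cinner (X (t a f)) (t b f)) summable_on B"
    and "cmod (\<Sum>\<^sub>\<infinity>f\<in>B. cinner (X (t a f)) (t b f)) \<le> trace_norm X * norm a * norm b"
proof -
  have "(\<lambda>f. cinner (X (t a f)) (t b f)) summable_on B \<and>
      cmod (\<Sum>\<^sub>\<infinity>f\<in>B. cinner (X (t a f)) (t b f)) \<le> trace_norm X * norm a * norm b"
  proof (cases "a = 0 \<or> b = 0")
    case True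
    then have "cinner (X (t a f)) (t b f) = 0" for f
      by (auto simp: tensor_zero_left blinfun.zero_right cinner.zero_left cinner.zero_right)
    then show ?thesis using True by auto
  next
    case False
    define a' b' where "a' = complex_of_real (1 / norm a) *\<^sub>C a" and "b' = complex_of_real (1 / norm b) *\<^sub>C b"
    define c where "c = complex_of_real (norm a * norm b)"
    have n: "norm a' = 1" "norm b' = 1"
      using False by (simp_all add: a'_def b'_def norm_scaleC norm_divide)
    have ab: "a = complex_of_real (norm a) *\<^sub>C a'" "b = complex_of_real (norm b) *\<^sub>C b'"
      using False by (simp_all add: a'_def b'_def scaleC_scaleC flip: of_real_mult)
    have eq: "cinner (X (t a f)) (t b f) = c * cinner (X (t a' f)) (t b' f)" for f
      by (subst ab(1), subst ab(2))
        (simp add: tensor_linear clinear_op_scaleC[OF trace_class_clinear[OF X]] c_def)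
    note s = trace_norm_summable[OF X onfam_tensor_right[OF n(1) is_onb_onfam[OF B]]
        onfam_tensor_right[OF n(2) is_onb_onfam[OF B]]]
    have "cmod c * cmod (\<Sum>\<^sub>\<infinity>f\<in>B. cinner (X (t a' f)) (t b' f)) \<le> cmod c * trace_norm X"
      by (intro mult_left_mono s(3)) simp
    then show ?thesis
      unfolding eq using s(2)
      by (simp add: summable_on_cmult_right infsum_cmult_right norm_mult) (simp add: c_def norm_mult mult_ac)
  qed
  then show "(\<lambda>f. cinner (X (t a f)) (t b f)) summable_on B"
    "cmod (\<Sum>\<^sub>\<infinity>f\<in>B. cinner (X (t a f)) (t b f)) \<le> trace_norm X * norm a * norm b" by auto
qed

text \<open>S is the partial trace over the second factor, built from its form. The products
  \<open>t (e i) f\<close> are orthonormal, so a test sum for S, truncated to finitely many f, is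
  dominated by a test sum for X.\<close>

lemma partial_form_representation:
  assumes X: "X \<in> trace_class" and B: "is_onb B"
  shows "\<exists>S :: 'a \<Rightarrow>\<^sub>L 'a. S \<in> trace_class \<and> trace_norm S \<le> trace_norm X \<and>
    (\<forall>a b. ((\<lambda>f. cinner (X (t a f)) (t b f)) has_sum cinner (S a) b) B)"
proof -
  let ?Q = "\<lambda>a b. \<Sum>\<^sub>\<infinity>f\<in>B. cinner (X (t a f)) (t b f)"
  note s = partial_form_summable(1)[OF X B]
  note lin = trace_class_clinear[OF X]
  have "\<exists>S :: 'a \<Rightarrow>\<^sub>L 'a. clinear_op S \<and> (\<forall>a b. cinner (S a) b = ?Q a b)"
  proof (rule csesquilinear_representation[OF _ _ _ _ trace_norm_nonneg partial_form_summable(2)[OF X B]])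
    show "?Q (x + x') y = ?Q x y + ?Q x' y" for x x' y
      using infsum_add[OF s s] by (simp add: tensor_linear blinfun.add_right cinner.add_left)
    show "?Q x (y + y') = ?Q x y + ?Q x y'" for x y y'
      using infsum_add[OF s s] by (simp add: tensor_linear cinner.add_right)
    show "?Q (c *\<^sub>C x) y = c * ?Q x y" for c x y
      by (simp add: tensor_linear clinear_op_scaleC[OF lin] infsum_cmult_right s)
    show "?Q x (c *\<^sub>C y) = cnj c * ?Q x y" for c x y
      by (simp add: tensor_linear infsum_cmult_right s)
  qed
  then obtain S :: "'a \<Rightarrow>\<^sub>L 'a" where S: "clinear_op S" "\<And>a b. cinner (S a) b = ?Q a b" by blast
  have hs: "((\<lambda>f. cinner (X (t a f)) (t b f)) has_sum cinner (S a) b) B" for a b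
    unfolding S(2) by (rule has_sum_infsum[OF s])
  have "S \<in> trace_class \<and> trace_norm S \<le> trace_norm X"
  proof (rule trace_classI[OF S(1)])
    fix n :: nat and e g :: "nat \<Rightarrow> 'a" assume eg: "onfam e {..<n}" "onfam g {..<n}"
    have lim: "((\<lambda>F. \<Sum>i<n. cmod (\<Sum>f\<in>F. cinner (X (t (e i) f)) (t (g i) f)))
        \<longlongrightarrow> (\<Sum>i<n. cmod (cinner (S (e i)) (g i)))) (finite_subsets_at_top B)"
      using hs unfolding has_sum_def by (intro tendsto_sum tendsto_norm) auto
    have "(\<Sum>i<n. cmod (\<Sum>f\<in>F. cinner (X (t (e i) f)) (t (g i) f))) \<le> trace_norm X"
      if F: "finite F" "F \<subseteq> B" for F
    proof -
      have onF: "onfam (\<lambda>f. f) F" using onfam_subset[OF is_onb_onfam[OF B] F(2)] .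
      have "(\<Sum>i<n. cmod (\<Sum>f\<in>F. cinner (X (t (e i) f)) (t (g i) f)))
          \<le> (\<Sum>i<n. \<Sum>f\<in>F. cmod (cinner (X (t (e i) f)) (t (g i) f)))"
        by (intro sum_mono norm_sum)
      also have "\<dots> = (\<Sum>p\<in>{..<n} \<times> F. cmod (cinner (X (case p of (i, f) \<Rightarrow> t (e i) f))
          (case p of (i, f) \<Rightarrow> t (g i) f)))"
        by (simp add: sum.cartesian_product case_prod_unfold)
      also have "\<dots> \<le> trace_norm X"
        using F by (intro trace_norm_onfam[OF X _ onfam_tensor[OF eg(1) onF] onfam_tensor[OF eg(2) onF]]) auto
      finally show ?thesis .
    qed
    then show "(\<Sum>i<n. cmod (cinner (S (e i)) (g i))) \<le> trace_norm X"
      by (intro tendsto_upperbound[OF lim]) (auto intro!: eventually_finite_subsets_at_top_weakI)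
  qed
  with hs show ?thesis by blast
qed

end

section \<open>Uniqueness of bounded linear maps between trace class spaces\<close>

lemma rank_one_linear:
  fixes w w' :: "'a::chilbert_space" and z z' :: "'b::chilbert_space"
  shows "rank_one (w + w') z = rank_one w z + rank_one w' z"
    and "rank_one w (z + z') = rank_one w z + rank_one w z'"
    and "rank_one (c *\<^sub>C w) z = scaleC_op c (rank_one w z)"
    and "rank_one w (c *\<^sub>C z) = scaleC_op (cnj c) (rank_one w z)"
  by (rule blinfun_eqI; simp add: blinfun.add_left scaleC_add_right cinner.add_right scaleC_add_left
      scaleC_scaleC mult.commute)+

lemma scaleC_op_of_real: "scaleC_op (complex_of_real r) X = r *\<^sub>R X"
  by (rule blinfun_eqI) (simp add: blinfun.scaleR_left scaleR_scaleC)

lemma trace_class_scaleR: "X \<in> trace_class \<Longrightarrow> r *\<^sub>R X \<in> trace_class"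
  unfolding scaleC_op_of_real[symmetric] by (rule trace_class_scaleC)

lemma rank_one_scaleR:
  fixes w :: "'a::chilbert_space" and z :: "'b::chilbert_space"
  shows "rank_one (r *\<^sub>R w) z = r *\<^sub>R rank_one w z"
    and "rank_one w (r *\<^sub>R z) = r *\<^sub>R rank_one w z"
  using rank_one_linear(3)[of "complex_of_real r" w z] rank_one_linear(4)[of w "complex_of_real r" z]
  by (simp_all add: scaleC_op_of_real flip: scaleR_scaleC)

lemma trace_bounded_linear_norm_bound:
  assumes "trace_bounded_linear \<Phi>"
  shows "\<exists>K. \<forall>X\<in>trace_class. norm (\<Phi> X) \<le> K * trace_norm X"
  using assms norm_le_trace_norm order_trans unfolding trace_bounded_linear_def by metis

text \<open>The difference D is bounded, so on rank one operators it is continuous in each of the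
  two vectors; density of product vectors is applied to one vector and then to the other. Trace
  class induction covers the remaining operators, and outside the trace class both maps are
  zero.\<close>

lemma trace_bounded_linear_unique:
  fixes t :: "'a::chilbert_space \<Rightarrow> 'b::chilbert_space \<Rightarrow> 'c::chilbert_space"
    and \<Phi> \<Psi> :: "('c \<Rightarrow>\<^sub>L 'c) \<Rightarrow> ('d::chilbert_space \<Rightarrow>\<^sub>L 'd)"
  assumes tensor: "hilbert_tensor t"
    and \<Phi>: "trace_bounded_linear \<Phi>" and \<Psi>: "trace_bounded_linear \<Psi>"
    and eq: "\<And>x y u v. \<Phi> (rank_one (t x y) (t u v)) = \<Psi> (rank_one (t x y) (t u v))"
  shows "\<Phi> = \<Psi>"
proof -
  define D where "D X = \<Phi> X - \<Psi> X" for X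
  have D_add: "D (X + Y) = D X + D Y" if "X \<in> trace_class" "Y \<in> trace_class" for X Y
    using \<Phi> \<Psi> that by (simp add: D_def trace_bounded_linear_def)
  have scaleC_op_diff: "scaleC_op c (X - Y) = scaleC_op c X - scaleC_op c Y" for c and X Y :: "'d \<Rightarrow>\<^sub>L 'd"
    by (rule blinfun_eqI) (simp add: blinfun.diff_left scaleC.diff_right)
  have D_scale: "D (scaleC_op c X) = scaleC_op c (D X)" if "X \<in> trace_class" for c X
    using \<Phi> \<Psi> that by (simp add: D_def trace_bounded_linear_def scaleC_op_diff)
  obtain K1 K2 where K: "\<And>X. X \<in> trace_class \<Longrightarrow> norm (\<Phi> X) \<le> K1 * trace_norm X"
    "\<And>X. X \<in> trace_class \<Longrightarrow> norm (\<Psi> X) \<le> K2 * trace_norm X"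
    using trace_bounded_linear_norm_bound[OF \<Phi>] trace_bounded_linear_norm_bound[OF \<Psi>] by blast
  define K where "K = \<bar>K1\<bar> + \<bar>K2\<bar>"
  have K0: "0 \<le> K" by (simp add: K_def)
  have D_norm: "norm (D X) \<le> K * trace_norm X" if X: "X \<in> trace_class" for X
  proof -
    have "norm (D X) \<le> norm (\<Phi> X) + norm (\<Psi> X)" unfolding D_def by (rule norm_triangle_ineq4)
    also have "\<dots> \<le> \<bar>K1\<bar> * trace_norm X + \<bar>K2\<bar> * trace_norm X"
      using K[OF X] mult_right_mono[OF abs_ge_self[of K1] trace_norm_nonneg[of X]]
        mult_right_mono[OF abs_ge_self[of K2] trace_norm_nonneg[of X]] by linarith
    finally show ?thesis by (simp add: K_def algebra_simps)
  qed
  have D_r1: "norm (D (rank_one w z)) \<le> norm w * (norm z * K)" for w z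
  proof -
    have "norm (D (rank_one w z)) \<le> K * trace_norm (rank_one w z)" by (rule D_norm[OF trace_class_rank_one])
    also have "\<dots> \<le> K * (norm w * norm z)" by (intro mult_left_mono trace_norm_rank_one K0)
    finally show ?thesis by (simp add: mult_ac)
  qed
  have D_scaleR: "D (r *\<^sub>R X) = r *\<^sub>R D X" if "X \<in> trace_class" for r X
    using D_scale[OF that, of "complex_of_real r"] by (simp add: scaleC_op_of_real)
  have bl1: "bounded_linear (\<lambda>w. D (rank_one w z))" for z
    by (rule bounded_linear_intro[where K = "norm z * K"])
      (simp_all add: rank_one_linear rank_one_scaleR D_add trace_class_rank_one D_scaleR D_r1)
  \<comment> \<open>The dependence on z is conjugate linear, hence linear over the reals, and its
    zero set is still a complex subspace.\<close>
  have bl2: "bounded_linear (\<lambda>z. D (rank_one w z))" for w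
    using D_r1[of w] by (intro bounded_linear_intro[where K = "norm w * K"])
      (simp_all add: rank_one_linear rank_one_scaleR D_add trace_class_rank_one D_scaleR mult_ac)
  have dense: "closure (complex_vector.span {t x y |x y. True}) = UNIV"
    using tensor by (simp add: hilbert_tensor_def)
  have z1: "D (rank_one w (t u v)) = 0" for w u v
  proof -
    interpret bl: bounded_linear "\<lambda>w. D (rank_one w (t u v))" by (rule bl1)
    have "{w. D (rank_one w (t u v)) = 0} = UNIV"
    proof (rule closure_span_UNIV_subset[OF dense])
      show "complex_vector.subspace {w. D (rank_one w (t u v)) = 0}"
        by (rule complex_vector.subspaceI)
          (auto simp: bl.zero bl.add rank_one_linear(3) D_scale trace_class_rank_one
            intro!: blinfun_eqI simp: scaleC.zero_right)
      show "closed {w. D (rank_one w (t u v)) = 0}"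
        by (intro closed_Collect_eq linear_continuous_on bl1 continuous_on_const)
    qed (auto simp: D_def eq)
    then show ?thesis by auto
  qed
  have z2: "D (rank_one w z) = 0" for w z
  proof -
    interpret bl: bounded_linear "\<lambda>z. D (rank_one w z)" by (rule bl2)
    have "{z. D (rank_one w z) = 0} = UNIV"
    proof (rule closure_span_UNIV_subset[OF dense])
      show "complex_vector.subspace {z. D (rank_one w z) = 0}"
        by (rule complex_vector.subspaceI)
          (auto simp: bl.zero bl.add rank_one_linear(4) D_scale trace_class_rank_one
            intro!: blinfun_eqI simp: scaleC.zero_right)
      show "closed {z. D (rank_one w z) = 0}"
        by (intro closed_Collect_eq linear_continuous_on bl2 continuous_on_const)
    qed (auto simp: z1)
    then show ?thesis by auto
  qed
  have D0: "D X = 0" if "X \<in> trace_class" for X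
    using that
  proof (induction rule: trace_class_induct)
    case (rank_one a b)
    show ?case by (rule z2)
  next
    case (add S T)
    then show ?case by (simp add: D_add)
  next
    case (limit T)
    have "norm (D T) \<le> 0 + \<epsilon>" if \<epsilon>: "\<epsilon> > 0" for \<epsilon>
    proof -
      have "\<epsilon> / (K + 1) > 0" using \<epsilon> K0 by simp
      from limit(2)[OF this]
      obtain S where S: "S \<in> trace_class" "D S = 0" "trace_norm (T - S) \<le> \<epsilon> / (K + 1)" by blast
      have TS: "T - S \<in> trace_class" by (rule trace_class_diff[OF limit(1) S(1)])
      have "D T = D (T - S) + D S" using D_add[OF TS S(1)] by simp
      then have "norm (D T) \<le> K * trace_norm (T - S)" using S(2) D_norm[OF TS] by simp
      also have "\<dots> \<le> K * (\<epsilon> / (K + 1))" by (rule mult_left_mono[OF S(3) K0])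
      also have "\<dots> \<le> \<epsilon>" using K0 \<epsilon> by (simp add: field_simps)
      finally show ?thesis by simp
    qed
    then have "norm (D T) \<le> 0" by (rule field_le_epsilon)
    then show ?case by simp
  qed
  show ?thesis
  proof
    fix X
    show "\<Phi> X = \<Psi> X"
      using D0[of X] \<Phi> \<Psi> by (cases "X \<in> trace_class") (simp_all add: D_def trace_bounded_linear_def)
  qed
qed

text \<open>Transfers every fact proved for \<open>partial_trace2\<close> to
  \<open>partial_trace1\<close> by exchanging the factors.\<close>

lemma partial_trace1_swap: "partial_trace1 t = partial_trace2 (\<lambda>y x. t x y)"
  unfolding partial_trace1_def partial_trace2_def by (rule arg_cong[where f = The]) (rule ext, blast)

section \<open>The partial trace as a diagonal sum\<close>

context
  fixes t :: "'a::chilbert_space \<Rightarrow> 'b::chilbert_space \<Rightarrow> 'c::chilbert_space"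
  assumes tensor: "hilbert_tensor t"
begin

text \<open>Diagonal sums in a fixed basis B define a map that satisfies the definite description,
  and uniqueness identifies it with \<open>partial_trace2 t\<close>. As the description does not
  mention B, the formula holds in every basis.\<close>

lemma partial_trace2_characterization:
  "trace_bounded_linear (partial_trace2 t) \<and>
   (\<forall>X B. X \<in> trace_class \<longrightarrow> is_onb B \<longrightarrow> trace_norm (partial_trace2 t X) \<le> trace_norm X \<and>
     (\<forall>a b. ((\<lambda>f. cinner (X (t a f)) (t b f)) has_sum cinner (partial_trace2 t X a) b) B))"
proof -
  have main: "partial_trace2 t = \<Phi>" "trace_bounded_linear \<Phi>"
    if B: "is_onb B" and out: "\<And>X. X \<notin> trace_class \<Longrightarrow> \<Phi> X = 0"
      and \<Phi>: "\<And>X. X \<in> trace_class \<Longrightarrow> \<Phi> X \<in> trace_class \<and> trace_norm (\<Phi> X) \<le> trace_norm X"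
      and hs: "\<And>X a b. X \<in> trace_class \<Longrightarrow>
        ((\<lambda>f. cinner (X (t a f)) (t b f)) has_sum cinner (\<Phi> X a) b) B"
    for \<Phi> :: "('c \<Rightarrow>\<^sub>L 'c) \<Rightarrow> ('a \<Rightarrow>\<^sub>L 'a)" and B
  proof -
    \<comment> \<open>The diagonal sums pin down the operator, so linearity of \<Phi> reduces to
      linearity of unordered sums.\<close>
    have ext: "\<Phi> X = S" if "X \<in> trace_class"
      "\<And>a b. ((\<lambda>f. cinner (X (t a f)) (t b f)) has_sum cinner (S a) b) B" for X and S :: "'a \<Rightarrow>\<^sub>L 'a"
      by (intro blinfun_eqI cinner_ext has_sum_unique[OF hs[OF that(1)] that(2)])
    show tbl: "trace_bounded_linear \<Phi>"
      unfolding trace_bounded_linear_def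
    proof (intro conjI ballI allI impI)
      fix X Y :: "'c \<Rightarrow>\<^sub>L 'c" assume XY: "X \<in> trace_class" "Y \<in> trace_class"
      show "\<Phi> (X + Y) = \<Phi> X + \<Phi> Y"
        using has_sum_add[OF hs[OF XY(1)] hs[OF XY(2)]]
        by (intro ext trace_class_add XY) (simp add: blinfun.add_left cinner.add_left)
    next
      fix c and X :: "'c \<Rightarrow>\<^sub>L 'c" assume X: "X \<in> trace_class"
      show "\<Phi> (scaleC_op c X) = scaleC_op c (\<Phi> X)"
        using has_sum_cmult_right[OF hs[OF X]] by (intro ext trace_class_scaleC X) simp
    next
      show "\<exists>K. \<forall>X\<in>trace_class. trace_norm (\<Phi> X) \<le> K * trace_norm X"
        using \<Phi> by (intro exI[of _ 1]) simp
    qed (use \<Phi> out in auto)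
    have r1: "\<Phi> (rank_one (t x y) (t u v)) = scaleC_op (cinner y v) (rank_one x u)" for x y u v
    proof (rule ext[OF trace_class_rank_one])
      fix a b
      show "((\<lambda>f. cinner (rank_one (t x y) (t u v) (t a f)) (t b f)) has_sum
          cinner (scaleC_op (cinner y v) (rank_one x u) a) b) B"
        using has_sum_cmult_right[OF onb_parseval[OF B, of y v], of "cinner a u * cinner x b"]
        by (simp add: tensor_cinner[OF tensor] mult_ac)
    qed
    show "partial_trace2 t = \<Phi>"
      unfolding partial_trace2_def
    proof (rule the_equality)
      fix \<Psi> assume "trace_bounded_linear \<Psi> \<and>
        (\<forall>x y u v. \<Psi> (rank_one (t x y) (t u v)) = scaleC_op (cinner y v) (rank_one x u))"
      then show "\<Psi> = \<Phi>" using tbl r1 by (intro trace_bounded_linear_unique[OF tensor]) auto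
    qed (use tbl r1 in simp)
  qed
  have ex: "\<exists>\<Phi> :: ('c \<Rightarrow>\<^sub>L 'c) \<Rightarrow> ('a \<Rightarrow>\<^sub>L 'a). (\<forall>X. X \<notin> trace_class \<longrightarrow> \<Phi> X = 0) \<and>
      (\<forall>X\<in>trace_class. \<Phi> X \<in> trace_class \<and> trace_norm (\<Phi> X) \<le> trace_norm X \<and>
        (\<forall>a b. ((\<lambda>f. cinner (X (t a f)) (t b f)) has_sum cinner (\<Phi> X a) b) B))" if B: "is_onb B" for B
  proof -
    obtain \<Phi> :: "('c \<Rightarrow>\<^sub>L 'c) \<Rightarrow> ('a \<Rightarrow>\<^sub>L 'a)" where "\<And>X. X \<in> trace_class \<Longrightarrow> \<Phi> X \<in> trace_class \<and>
        trace_norm (\<Phi> X) \<le> trace_norm X \<and>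
        (\<forall>a b. ((\<lambda>f. cinner (X (t a f)) (t b f)) has_sum cinner (\<Phi> X a) b) B)"
      using partial_form_representation[OF tensor _ B] by metis
    \<comment> \<open>Values outside the trace class are reset to zero, as
      \<open>trace_bounded_linear\<close> demands.\<close>
    then show ?thesis by (intro exI[of _ "\<lambda>X. if X \<in> trace_class then \<Phi> X else 0"]) simp
  qed
  have 1: "trace_norm (partial_trace2 t X) \<le> trace_norm X \<and>
     (\<forall>a b. ((\<lambda>f. cinner (X (t a f)) (t b f)) has_sum cinner (partial_trace2 t X a) b) B)"
    and 2: "trace_bounded_linear (partial_trace2 t)"
    if X: "X \<in> trace_class" and B: "is_onb B" for X B
  proof -
    obtain \<Phi> :: "('c \<Rightarrow>\<^sub>L 'c) \<Rightarrow> ('a \<Rightarrow>\<^sub>L 'a)" where \<Phi>: "\<And>X. X \<notin> trace_class \<Longrightarrow> \<Phi> X = 0"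
      "\<And>X. X \<in> trace_class \<Longrightarrow> \<Phi> X \<in> trace_class \<and> trace_norm (\<Phi> X) \<le> trace_norm X"
      "\<And>X a b. X \<in> trace_class \<Longrightarrow> ((\<lambda>f. cinner (X (t a f)) (t b f)) has_sum cinner (\<Phi> X a) b) B"
      using ex[OF B] by blast
    have "partial_trace2 t = \<Phi>" "trace_bounded_linear \<Phi>" by (rule main[OF B \<Phi>]; assumption)+
    then show "trace_norm (partial_trace2 t X) \<le> trace_norm X \<and>
     (\<forall>a b. ((\<lambda>f. cinner (X (t a f)) (t b f)) has_sum cinner (partial_trace2 t X a) b) B)"
      "trace_bounded_linear (partial_trace2 t)"
      using \<Phi> X by auto
  qed
  obtain B :: "'b set" where "is_onb B" using onb_exists by blast
  from 2[OF trace_class_zero this] 1 show ?thesis by (intro conjI allI impI) auto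
qed

lemma partial_trace2_trace_class: "X \<in> trace_class \<Longrightarrow> partial_trace2 t X \<in> trace_class"
  using partial_trace2_characterization by (simp add: trace_bounded_linear_def)

lemma trace_norm_partial_trace2:
  assumes "X \<in> trace_class"
  shows "trace_norm (partial_trace2 t X) \<le> trace_norm X"
proof -
  obtain B :: "'b set" where "is_onb B" using onb_exists by blast
  from partial_trace2_characterization[THEN conjunct2, rule_format, OF assms this] show ?thesis by simp
qed

lemma partial_trace2_has_sum:
  "X \<in> trace_class \<Longrightarrow> is_onb B \<Longrightarrow>
    ((\<lambda>f. cinner (X (t a f)) (t b f)) has_sum cinner (partial_trace2 t X a) b) B"
  using partial_trace2_characterization[THEN conjunct2, rule_format, of X B] by simp

lemma partial_trace2_add:
  "X \<in> trace_class \<Longrightarrow> Y \<in> trace_class \<Longrightarrow> partial_trace2 t (X + Y) = partial_trace2 t X + partial_trace2 t Y"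
  using partial_trace2_characterization by (simp add: trace_bounded_linear_def)

lemma partial_trace2_scaleC:
  "X \<in> trace_class \<Longrightarrow> partial_trace2 t (scaleC_op c X) = scaleC_op c (partial_trace2 t X)"
  using partial_trace2_characterization by (simp add: trace_bounded_linear_def)

lemma partial_trace2_diff:
  assumes "X \<in> trace_class" "Y \<in> trace_class"
  shows "partial_trace2 t (X - Y) = partial_trace2 t X - partial_trace2 t Y"
  using partial_trace2_add[OF trace_class_diff[OF assms] assms(2)] by simp

lemma partial_trace2_psd:
  assumes X: "X \<in> trace_class" and psd: "psd_op X"
  shows "psd_op (partial_trace2 t X)"
  unfolding psd_op_def
proof (intro conjI allI)
  obtain B :: "'b set" where B: "is_onb B" using onb_exists by blast
  show "clinear_op (partial_trace2 t X)" by (intro trace_class_clinear partial_trace2_trace_class X)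
  fix a b
  show "cinner (partial_trace2 t X a) b = cinner a (partial_trace2 t X b)"
  proof -
    have "((\<lambda>f. cnj (cinner (X (t b f)) (t a f))) has_sum cnj (cinner (partial_trace2 t X b) a)) B"
      using partial_trace2_has_sum[OF X B, of b a] by (simp only: has_sum_cnj_iff)
    moreover have "cnj (cinner (X (t b f)) (t a f)) = cinner (X (t a f)) (t b f)" for f
      by (metis cinner_commute psd_op_symmetric[OF psd])
    ultimately have "cinner (partial_trace2 t X a) b = cnj (cinner (partial_trace2 t X b) a)"
      using partial_trace2_has_sum[OF X B, of a b] by (simp add: has_sum_unique)
    then show ?thesis by (metis cinner_commute)
  qed
  show "0 \<le> Re (cinner (partial_trace2 t X a) a)"
    using has_sum_Re[OF partial_trace2_has_sum[OF X B, of a a]] psd_op_nonneg[OF psd]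
    by (rule has_sum_nonneg)
qed

text \<open>Over a product basis the trace of X is an iterated sum whose inner sums are the diagonal
  entries of the partial trace; for positive operators trace and trace norm agree on both
  sides.\<close>

lemma trace_norm_partial_trace2_psd:
  assumes X: "X \<in> trace_class" and psd: "psd_op X"
  shows "trace_norm (partial_trace2 t X) = trace_norm X"
proof -
  obtain A :: "'a set" and B :: "'b set" where AB: "is_onb A" "is_onb B" using onb_exists by metis
  have inj: "inj_on (\<lambda>(a, b). t a b) (A \<times> B)"
    by (intro onfam_inj_on onfam_tensor[OF tensor] is_onb_onfam AB)
  have "((\<lambda>c. Re (cinner (X c) c)) has_sum trace_norm X) ((\<lambda>(a, b). t a b) ` (A \<times> B))"
    by (intro psd_trace_has_sum psd X onb_tensor tensor AB)
  then have "((\<lambda>(a, b). Re (cinner (X (t a b)) (t a b))) has_sum trace_norm X) (A \<times> B)"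
    unfolding has_sum_reindex[OF inj] by (simp add: o_def case_prod_unfold)
  then have "((\<lambda>a. Re (cinner (partial_trace2 t X a) a)) has_sum trace_norm X) A"
  proof (rule has_sum_SigmaD)
    fix a
    show "((\<lambda>f. case (a, f) of (a, b) \<Rightarrow> Re (cinner (X (t a b)) (t a b)))
        has_sum Re (cinner (partial_trace2 t X a) a)) B"
      using has_sum_Re[OF partial_trace2_has_sum[OF X AB(2), of a a]] by simp
  qed
  moreover have "((\<lambda>a. Re (cinner (partial_trace2 t X a) a)) has_sum trace_norm (partial_trace2 t X)) A"
    by (intro psd_trace_has_sum partial_trace2_psd partial_trace2_trace_class X psd AB)
  ultimately show ?thesis by (rule has_sum_unique[rotated])
qed

end

text \<open>Extending a to a basis shows that the entry of X at \<open>t a f\<close> is at most the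
  diagonal entry of the other marginal at f. These differences are nonnegative, and their sum over G
  is at most their total, \<open>trace_norm X\<close> minus the entry of
  \<open>partial_trace2 t X\<close> at a.\<close>

lemma partial_trace2_tail:
  fixes t :: "'a::chilbert_space \<Rightarrow> 'b::chilbert_space \<Rightarrow> 'c::chilbert_space"
  assumes tensor: "hilbert_tensor t" and X: "X \<in> trace_class" and psd: "psd_op X"
    and B: "is_onb B" and G: "finite G" "G \<subseteq> B" and a: "norm a = 1"
  shows "Re (cinner (partial_trace2 t X a) a) \<le> (\<Sum>f\<in>G. Re (cinner (X (t a f)) (t a f)))
    + (trace_norm X - (\<Sum>f\<in>G. Re (cinner (partial_trace1 t X f) f)))"
proof -
  note swap = hilbert_tensor_swap[OF tensor]
  have "orthonormal_set {a}" using a by (simp add: orthonormal_set_def cinner_self)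
  then obtain A where A: "is_onb A" "a \<in> A" using orthonormal_extends_to_onb by (metis insert_subset)
  have le: "Re (cinner (X (t a f)) (t a f)) \<le> Re (cinner (partial_trace1 t X f) f)" for f
    using finite_sum_le_has_sum[OF has_sum_Re[OF partial_trace2_has_sum[OF swap X A(1), of f f]], of "{a}"]
      A(2) psd_op_nonneg[OF psd] by (simp add: partial_trace1_swap)
  have "((\<lambda>f. Re (cinner (partial_trace1 t X f) f)) has_sum trace_norm X) B"
    unfolding partial_trace1_swap
    using psd_trace_has_sum[OF partial_trace2_psd[OF swap X psd] partial_trace2_trace_class[OF swap X] B]
    by (simp add: trace_norm_partial_trace2_psd[OF swap X psd])
  moreover have "((\<lambda>f. - Re (cinner (X (t a f)) (t a f))) has_sum - Re (cinner (partial_trace2 t X a) a)) B"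
    using has_sum_Re[OF partial_trace2_has_sum[OF tensor X B, of a a]] by (simp add: has_sum_uminus)
  ultimately have "((\<lambda>f. Re (cinner (partial_trace1 t X f) f) + - Re (cinner (X (t a f)) (t a f)))
      has_sum (trace_norm X + - Re (cinner (partial_trace2 t X a) a))) B" by (rule has_sum_add)
  then have "((\<lambda>f. Re (cinner (partial_trace1 t X f) f) - Re (cinner (X (t a f)) (t a f)))
      has_sum (trace_norm X - Re (cinner (partial_trace2 t X a) a))) B" by simp
  from finite_sum_le_has_sum[OF this G(1,2)] le show ?thesis by (simp add: sum_subtractf)
qed

section \<open>Weak compactness of positive operators\<close>

text \<open>Tychonoff's theorem for a product of discs, in place of a diagonal argument: over a
  countable index type the product is metrisable, so compactness yields convergent
  subsequences.\<close>

lemma subsequence_converging_coordinatewise: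
  fixes M :: "nat \<Rightarrow> 'i::countable \<Rightarrow> complex"
  assumes "\<And>k i. cmod (M k i) \<le> C"
  obtains r L where "strict_mono (r :: nat \<Rightarrow> nat)" "\<And>i. (\<lambda>k. M (r k) i) \<longlonglongrightarrow> L i"
proof -
  have "compact (PiE UNIV (\<lambda>i::'i. cball (0::complex) C))"
    using compactin_PiE[of "\<lambda>_::'i. euclidean :: complex topology" UNIV "\<lambda>_. cball 0 C"]
    by (simp add: euclidean_product_topology)
  moreover have "\<forall>k. M k \<in> PiE UNIV (\<lambda>i::'i. cball (0::complex) C)" using assms by auto
  ultimately obtain L r where r: "strict_mono (r :: nat \<Rightarrow> nat)" "(M \<circ> r) \<longlonglongrightarrow> L"
    using seq_compactE[OF compact_imp_seq_compact] by metis
  have "(\<lambda>k. M (r k) i) \<longlonglongrightarrow> L i" for i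
    using continuous_on_tendsto_compose[OF continuous_on_product_coordinates[of i] r(2)] by (simp add: o_def)
  with r(1) show thesis by (rule that)
qed

text \<open>The bound is uniform in k, so values at l are Cauchy because those at a nearby s n are.
  This spreads convergence from basis vectors to their closed span.\<close>

lemma closed_Collect_convergent:
  fixes g :: "nat \<Rightarrow> 'a::real_normed_vector \<Rightarrow> complex"
  assumes diff: "\<And>k a b. g k (a - b) = g k a - g k b" and bd: "\<And>k a. cmod (g k a) \<le> K * norm a"
    and K: "0 \<le> K"
  shows "closed {a. convergent (\<lambda>k. g k a)}"
  unfolding closed_sequential_limits
proof (intro allI impI, elim conjE)
  fix s l assume s: "\<forall>n. s n \<in> {a. convergent (\<lambda>k. g k a)}" and l: "s \<longlonglongrightarrow> l"
  have "Cauchy (\<lambda>k. g k l)"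
  proof (rule CauchyI)
    fix e :: real assume e: "e > 0"
    then have "e / (3 * (K + 1)) > 0" using K by simp
    with l obtain n where n: "norm (s n - l) < e / (3 * (K + 1))"
      unfolding LIMSEQ_iff by blast
    have close: "cmod (g k (s n) - g k l) < e / 3" for k
    proof -
      have "cmod (g k (s n) - g k l) \<le> K * norm (s n - l)" using bd[of k "s n - l"] by (simp add: diff)
      also have "\<dots> \<le> (K + 1) * norm (s n - l)" by (simp add: mult_right_mono)
      also have "\<dots> < (K + 1) * (e / (3 * (K + 1)))"
        using n K by (intro mult_strict_left_mono) auto
      also have "\<dots> = e / 3" using K by (simp add: field_simps)
      finally show ?thesis .
    qed
    have "Cauchy (\<lambda>k. g k (s n))" using s convergent_Cauchy by blast
    then obtain N where N: "\<And>i j. i \<ge> N \<Longrightarrow> j \<ge> N \<Longrightarrow> cmod (g i (s n) - g j (s n)) < e / 3"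
      using e CauchyD[of "\<lambda>k. g k (s n)" "e / 3"] by auto
    show "\<exists>N. \<forall>i\<ge>N. \<forall>j\<ge>N. cmod (g i l - g j l) < e"
    proof (intro exI allI impI)
      fix i j assume ij: "N \<le> i" "N \<le> j"
      have "cmod (g i l - g j l) = cmod ((g i (s n) - g j (s n)) - (g i (s n) - g i l) + (g j (s n) - g j l))"
        by simp
      also have "\<dots> \<le> cmod ((g i (s n) - g j (s n)) - (g i (s n) - g i l)) + cmod (g j (s n) - g j l)"
        by (rule norm_triangle_ineq)
      also have "\<dots> \<le> (cmod (g i (s n) - g j (s n)) + cmod (g i (s n) - g i l)) + cmod (g j (s n) - g j l)"
        by (intro add_right_mono norm_triangle_ineq4)
      finally show "cmod (g i l - g j l) < e" using N[OF ij] close[of i] close[of j] by linarith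
    qed
  qed
  then show "l \<in> {a. convergent (\<lambda>k. g k a)}" by (simp add: Cauchy_convergent_iff)
qed

lemma cinner_blinfun_bound:
  fixes T :: "'a::chilbert_space \<Rightarrow>\<^sub>L 'b::chilbert_space"
  assumes "norm T \<le> C"
  shows "cmod (cinner (T a) b) \<le> C * norm a * norm b"
proof -
  have "cmod (cinner (T a) b) \<le> norm (T a) * norm b" by (rule norm_cinner_le)
  also have "\<dots> \<le> (C * norm a) * norm b"
    using norm_blinfun[of T a] mult_right_mono[OF assms norm_ge_zero[of a]]
    by (intro mult_right_mono) auto
  finally show ?thesis .
qed

text \<open>The matrix entries in the basis x converge along a subsequence. Being symmetric with
  values in \<X>, the operators vanish on the orthogonal complement of \<X>, so these entries
  control the form everywhere; convergence is extended in one argument and then in the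
  other.\<close>

lemma psd_weak_subsequence:
  fixes Y :: "nat \<Rightarrow> 'a::chilbert_space \<Rightarrow>\<^sub>L 'a" and x :: "nat \<Rightarrow> 'a"
  assumes x: "onb_sequence_of x \<X>" and psd: "\<And>k. psd_op (Y k)" and bd: "\<And>k. norm (Y k) \<le> C"
    and range: "\<And>k z. Y k z \<in> \<X>"
  obtains r S where "strict_mono (r :: nat \<Rightarrow> nat)" "psd_op S" "\<And>z. S z \<in> \<X>"
    "\<And>a b. (\<lambda>k. cinner (Y (r k) a) b) \<longlonglongrightarrow> cinner (S a) b"
proof -
  have \<X>: "\<X> = closure (complex_vector.span (range x))" using x by (simp add: onb_sequence_of_def)
  have sub: "complex_vector.subspace \<X>" "closed \<X>"
    unfolding \<X> by (auto intro: csubspace_closure complex_vector.subspace_span)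
  have C: "0 \<le> C" using bd[of 0] norm_ge_zero order_trans by blast
  have "norm (x i) = 1" for i
    using x onfam_norm[of x UNIV i] by (simp add: onb_sequence_of_def onfam_def)
  then have "cmod (cinner (Y k (x (fst p))) (x (snd p))) \<le> C" for k and p :: "nat \<times> nat"
    using cinner_blinfun_bound[OF bd, of k "x (fst p)" "x (snd p)"] by simp
  from subsequence_converging_coordinatewise[where M = "\<lambda>k p. cinner (Y k (x (fst p))) (x (snd p))", OF this]
  obtain r :: "nat \<Rightarrow> nat" and L :: "nat \<times> nat \<Rightarrow> complex" where r: "strict_mono r"
    and L: "\<And>p. (\<lambda>k. cinner (Y (r k) (x (fst p))) (x (snd p))) \<longlonglongrightarrow> L p"
    by metis
  note scale = clinear_op_scaleC[OF psd_op_clinear[OF psd]]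
  note bnd = cinner_blinfun_bound[OF bd]
  have perp: "cinner (Y k a) b = 0" if "\<And>s. s \<in> \<X> \<Longrightarrow> cinner s b = 0" for k a b
    using that range by blast
  have perp': "cinner (Y k b) a = 0" if "\<And>s. s \<in> \<X> \<Longrightarrow> cinner s b = 0" for k a b
    using that[OF range, of k a] by (metis psd_op_symmetric[OF psd] cinner_commute complex_cnj_zero)
  \<comment> \<open>Every vector is the sum of one in \<X> and one orthogonal to \<X>, so a closed
    subspace that contains the basis and this complement is everything.\<close>
  have total: "a \<in> W" if W: "complex_vector.subspace W" "closed W" "range x \<subseteq> W"
    "\<And>b. (\<And>s. s \<in> \<X> \<Longrightarrow> cinner s b = 0) \<Longrightarrow> b \<in> W" for a W
  proof -
    obtain p where p: "p \<in> \<X>" "\<And>s. s \<in> \<X> \<Longrightarrow> cinner s (a - p) = 0"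
      using exists_projection[OF sub, of a] by blast
    have "\<X> \<subseteq> W"
      unfolding \<X> by (rule closure_minimal[OF complex_vector.span_minimal[OF W(3,1)] W(2)])
    then have "p \<in> W" using p(1) by blast
    from complex_vector.subspace_add[OF W(1) this W(4)[OF p(2)]] show ?thesis by simp
  qed
  have conv1: "convergent (\<lambda>k. cinner (Y (r k) a) (x j))" for a j
  proof -
    have "a \<in> {a. convergent (\<lambda>k. cinner (Y (r k) a) (x j))}"
    proof (rule total)
      show "closed {a. convergent (\<lambda>k. cinner (Y (r k) a) (x j))}"
        using C bnd[of _ _ "x j"] by (intro closed_Collect_convergent[where K = "C * norm (x j)"])
          (auto simp: blinfun.diff_right cinner.diff_left mult_ac)
      show "complex_vector.subspace {a. convergent (\<lambda>k. cinner (Y (r k) a) (x j))}"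
        by (rule complex_vector.subspaceI)
          (auto simp: blinfun.zero_right cinner.zero_left blinfun.add_right cinner.add_left scale
            intro: convergent_const convergent_add convergent_mult)
      show "range x \<subseteq> {a. convergent (\<lambda>k. cinner (Y (r k) a) (x j))}"
        using L[of "(_, j)"] by (auto simp: convergent_def)
      show "b \<in> {a. convergent (\<lambda>k. cinner (Y (r k) a) (x j))}"
        if "\<And>s. s \<in> \<X> \<Longrightarrow> cinner s b = 0" for b
        using perp'[OF that] by (simp add: convergent_const)
    qed
    then show ?thesis by simp
  qed
  have conv2: "convergent (\<lambda>k. cinner (Y (r k) a) b)" for a b
  proof -
    have "b \<in> {b. convergent (\<lambda>k. cinner (Y (r k) a) b)}"
    proof (rule total)
      show "closed {b. convergent (\<lambda>k. cinner (Y (r k) a) b)}"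
        using C bnd[of _ a] by (intro closed_Collect_convergent[where K = "C * norm a"])
          (auto simp: cinner.diff_right mult_ac)
      show "complex_vector.subspace {b. convergent (\<lambda>k. cinner (Y (r k) a) b)}"
        by (rule complex_vector.subspaceI)
          (auto simp: cinner.zero_right cinner.add_right
            intro: convergent_const convergent_add convergent_mult)
      show "range x \<subseteq> {b. convergent (\<lambda>k. cinner (Y (r k) a) b)}" using conv1 by auto
      show "b \<in> {b. convergent (\<lambda>k. cinner (Y (r k) a) b)}"
        if "\<And>s. s \<in> \<X> \<Longrightarrow> cinner s b = 0" for b
        using perp[OF that] by (simp add: convergent_const)
    qed
    then show ?thesis by simp
  qed
  then obtain B where B: "\<And>a b. (\<lambda>k. cinner (Y (r k) a) b) \<longlonglongrightarrow> B a b"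
    unfolding convergent_def by metis
  have "\<exists>S :: 'a \<Rightarrow>\<^sub>L 'a. clinear_op S \<and> (\<forall>a b. cinner (S a) b = B a b)"
  proof (rule csesquilinear_representation[OF _ _ _ _ C])
    show "B (a + a') b = B a b + B a' b" for a a' b
      by (rule LIMSEQ_unique[OF B]) (simp add: blinfun.add_right cinner.add_left tendsto_add B)
    show "B a (b + b') = B a b + B a b'" for a b b'
      by (rule LIMSEQ_unique[OF B]) (simp add: cinner.add_right tendsto_add B)
    show "B (c *\<^sub>C a) b = c * B a b" for c a b
      by (rule LIMSEQ_unique[OF B]) (simp add: scale tendsto_mult B)
    show "B a (c *\<^sub>C b) = cnj c * B a b" for c a b
      by (rule LIMSEQ_unique[OF B]) (simp add: tendsto_mult B)
    show "cmod (B a b) \<le> C * norm a * norm b" for a b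
      by (rule LIMSEQ_le_const2[OF tendsto_norm[OF B]]) (use bnd in blast)
  qed
  then obtain S :: "'a \<Rightarrow>\<^sub>L 'a" where S: "clinear_op S" "\<And>a b. cinner (S a) b = B a b" by blast
  have lim: "(\<lambda>k. cinner (Y (r k) a) b) \<longlonglongrightarrow> cinner (S a) b" for a b unfolding S(2) by (rule B)
  have "psd_op S"
    unfolding psd_op_def
  proof (intro conjI allI S(1))
    fix a b
    have "cnj (cinner (Y (r k) b) a) = cinner (Y (r k) a) b" for k
      by (metis psd_op_symmetric[OF psd] cinner_commute)
    with tendsto_cnj[OF lim[of b a]] have "(\<lambda>k. cinner (Y (r k) a) b) \<longlonglongrightarrow> cnj (cinner (S b) a)" by simp
    then have "cinner (S a) b = cnj (cinner (S b) a)" using LIMSEQ_unique lim by blast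
    then show "cinner (S a) b = cinner a (S b)" by (metis cinner_commute)
    show "0 \<le> Re (cinner (S a) a)"
      by (rule LIMSEQ_le_const[OF tendsto_Re[OF lim]]) (use psd_op_nonneg[OF psd] in blast)
  qed
  moreover have "S z \<in> \<X>" for z
  proof -
    \<comment> \<open>The component of S z off \<X> is orthogonal to every Y k z, hence to the weak
      limit S z, hence to itself.\<close>
    obtain p where p: "p \<in> \<X>" "\<And>s. s \<in> \<X> \<Longrightarrow> cinner s (S z - p) = 0"
      using exists_projection[OF sub, of "S z"] by blast
    have "(\<lambda>k. cinner (Y (r k) z) (S z - p)) \<longlonglongrightarrow> 0" using perp[OF p(2)] by simp
    then have "cinner (S z) (S z - p) = 0" using LIMSEQ_unique lim by blast
    with p(2)[OF p(1)] have "cinner (S z - p) (S z - p) = 0" by (simp add: cinner.diff_left)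
    then show ?thesis using p(1) by simp
  qed
  ultimately show thesis by (rule that[OF r _ _ lim])
qed

section \<open>Compressions converging in trace norm\<close>

text \<open>Symmetry moves Q across the inner product and contractivity preserves Bessel families;
  the estimates for \<open>Q o\<^sub>L T o\<^sub>L Q\<close> rest on these two facts. Instances are
  the projections onto the finite spans and the one onto \<X>.\<close>

definition sym_contraction :: "('a::chilbert_space \<Rightarrow>\<^sub>L 'a) \<Rightarrow> bool" where
  "sym_contraction Q \<longleftrightarrow> clinear_op Q \<and> (\<forall>z w. cinner (Q z) w = cinner z (Q w)) \<and> (\<forall>z. norm (Q z) \<le> norm z)"

lemma sym_contraction_onproj:
  assumes "finite I" "onfam e I"
  shows "sym_contraction (onproj e I)"
proof -
  have "(norm (onproj e I z))\<^sup>2 \<le> (norm z)\<^sup>2" for z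
    using onproj_pythagoras[OF assms, of z] by simp
  then have "norm (onproj e I z) \<le> norm z" for z by (rule power2_le_imp_le) simp
  then show ?thesis by (simp add: sym_contraction_def clinear_op_onproj cinner_onproj_commute)
qed

lemma bessel_sym_contraction:
  assumes Q: "sym_contraction Q" and e: "bessel_fam e I"
  shows "bessel_fam (\<lambda>i. Q (e i)) I"
  unfolding bessel_fam_def
proof (intro conjI allI)
  fix z
  have "(\<Sum>i\<in>I. (cmod (cinner z (Q (e i))))\<^sup>2) = (\<Sum>i\<in>I. (cmod (cinner (Q z) (e i)))\<^sup>2)"
    using Q by (simp add: sym_contraction_def)
  also have "\<dots> \<le> (norm (Q z))\<^sup>2" using e by (simp add: bessel_fam_def)
  also have "\<dots> \<le> (norm z)\<^sup>2" using Q by (simp add: sym_contraction_def power_mono)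
  finally show "(\<Sum>i\<in>I. (cmod (cinner z (Q (e i))))\<^sup>2) \<le> (norm z)\<^sup>2" .
qed (use e in \<open>simp add: bessel_fam_def\<close>)

text \<open>Test families e and f for the compressed operator become the families Q e and Q f for T,
  which remain Bessel though in general not orthonormal.\<close>

lemma
  fixes T Q :: "'a::chilbert_space \<Rightarrow>\<^sub>L 'a"
  assumes Q: "sym_contraction Q" and T: "T \<in> trace_class"
  shows trace_class_compress: "Q o\<^sub>L T o\<^sub>L Q \<in> trace_class"
    and trace_norm_compress: "trace_norm (Q o\<^sub>L T o\<^sub>L Q) \<le> trace_norm T"
proof -
  have "Q o\<^sub>L T o\<^sub>L Q \<in> trace_class \<and> trace_norm (Q o\<^sub>L T o\<^sub>L Q) \<le> trace_norm T"
  proof (rule trace_classI)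
    show "clinear_op (Q o\<^sub>L T o\<^sub>L Q)"
      using Q trace_class_clinear[OF T] by (simp add: sym_contraction_def clinear_op_compose)
    fix n :: nat and e f :: "nat \<Rightarrow> 'a" assume ef: "onfam e {..<n}" "onfam f {..<n}"
    have "(\<Sum>i<n. cmod (cinner ((Q o\<^sub>L T o\<^sub>L Q) (e i)) (f i))) = (\<Sum>i<n. cmod (cinner (T (Q (e i))) (Q (f i))))"
      using Q by (simp add: sym_contraction_def)
    also have "\<dots> \<le> trace_norm T"
      by (intro trace_norm_bessel[OF T] bessel_sym_contraction[OF Q] bessel_onfam ef) auto
    finally show "(\<Sum>i<n. cmod (cinner ((Q o\<^sub>L T o\<^sub>L Q) (e i)) (f i))) \<le> trace_norm T" .
  qed
  then show "Q o\<^sub>L T o\<^sub>L Q \<in> trace_class" "trace_norm (Q o\<^sub>L T o\<^sub>L Q) \<le> trace_norm T" by auto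
qed

lemma compress_linear:
  fixes Q S T :: "'a::chilbert_space \<Rightarrow>\<^sub>L 'a"
  shows "Q o\<^sub>L (S + T) o\<^sub>L Q = (Q o\<^sub>L S o\<^sub>L Q) + (Q o\<^sub>L T o\<^sub>L Q)"
    and "Q o\<^sub>L (S - T) o\<^sub>L Q = (Q o\<^sub>L S o\<^sub>L Q) - (Q o\<^sub>L T o\<^sub>L Q)"
  by (rule blinfun_eqI; simp add: blinfun.add_left blinfun.add_right blinfun.diff_left blinfun.diff_right)+

lemma tendsto_zero_sandwich:
  fixes f g :: "nat \<Rightarrow> real"
  assumes "g \<longlonglongrightarrow> 0" "\<And>n. 0 \<le> f n" "\<And>n. f n \<le> g n"
  shows "f \<longlonglongrightarrow> 0"
  by (rule tendsto_sandwich[of "\<lambda>_. 0" f sequentially g]) (simp_all add: assms)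

text \<open>Pointwise convergence suffices because compressing a rank one operator by Q applies Q to
  both of its vectors. Density gives the general case, since compressions contract the trace norm
  uniformly in n.\<close>

lemma compress_tendsto:
  fixes T P :: "'a::chilbert_space \<Rightarrow>\<^sub>L 'a" and Q :: "nat \<Rightarrow> 'a \<Rightarrow>\<^sub>L 'a"
  assumes T: "T \<in> trace_class" and P: "sym_contraction P" and Q: "\<And>n. sym_contraction (Q n)"
    and lim: "\<And>z. (\<lambda>n. Q n z) \<longlonglongrightarrow> P z"
  shows "(\<lambda>n. trace_norm ((P o\<^sub>L T o\<^sub>L P) - (Q n o\<^sub>L T o\<^sub>L Q n))) \<longlonglongrightarrow> 0"
  using T
proof (induction rule: trace_class_induct)
  case (rank_one a b)
  have compress: "R o\<^sub>L rank_one a b o\<^sub>L R = rank_one (R a) (R b)" if "sym_contraction R" for R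
    using that by (intro blinfun_eqI) (simp add: sym_contraction_def clinear_op_scaleC)
  have le: "trace_norm ((P o\<^sub>L rank_one a b o\<^sub>L P) - (Q n o\<^sub>L rank_one a b o\<^sub>L Q n))
      \<le> norm (P a - Q n a) * norm (P b) + norm a * norm (P b - Q n b)" for n
  proof -
    have eq: "(P o\<^sub>L rank_one a b o\<^sub>L P) - (Q n o\<^sub>L rank_one a b o\<^sub>L Q n)
        = rank_one (P a - Q n a) (P b) + rank_one (Q n a) (P b - Q n b)"
      unfolding compress[OF P] compress[OF Q]
      by (rule blinfun_eqI) (simp add: blinfun.add_left blinfun.diff_left cinner.diff_right
          scaleC.diff_left scaleC.diff_right)
    have "trace_norm (rank_one (P a - Q n a) (P b) + rank_one (Q n a) (P b - Q n b))
        \<le> norm (P a - Q n a) * norm (P b) + norm (Q n a) * norm (P b - Q n b)"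
      by (intro order_trans[OF trace_norm_triangle] add_mono trace_norm_rank_one trace_class_rank_one)
    also have "\<dots> \<le> norm (P a - Q n a) * norm (P b) + norm a * norm (P b - Q n b)"
      using Q[of n] by (intro add_left_mono mult_right_mono) (auto simp: sym_contraction_def)
    finally show ?thesis unfolding eq .
  qed
  have "(\<lambda>n. norm (P a - Q n a) * norm (P b) + norm a * norm (P b - Q n b))
      \<longlonglongrightarrow> norm (P a - P a) * norm (P b) + norm a * norm (P b - P b)"
    by (intro tendsto_intros lim)
  then have "(\<lambda>n. norm (P a - Q n a) * norm (P b) + norm a * norm (P b - Q n b)) \<longlonglongrightarrow> 0" by simp
  then show ?case by (rule tendsto_zero_sandwich) (rule trace_norm_nonneg, rule le)
next
  case (add S T)
  have le: "trace_norm ((P o\<^sub>L (S + T) o\<^sub>L P) - (Q n o\<^sub>L (S + T) o\<^sub>L Q n))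
      \<le> trace_norm ((P o\<^sub>L S o\<^sub>L P) - (Q n o\<^sub>L S o\<^sub>L Q n)) + trace_norm ((P o\<^sub>L T o\<^sub>L P) - (Q n o\<^sub>L T o\<^sub>L Q n))" for n
    unfolding compress_linear add_diff_add
    by (intro trace_norm_triangle trace_class_diff trace_class_compress P Q add)
  from tendsto_add[OF add(3,4)]
  have "(\<lambda>n. trace_norm ((P o\<^sub>L S o\<^sub>L P) - (Q n o\<^sub>L S o\<^sub>L Q n))
      + trace_norm ((P o\<^sub>L T o\<^sub>L P) - (Q n o\<^sub>L T o\<^sub>L Q n))) \<longlonglongrightarrow> 0" by simp
  then show ?case by (rule tendsto_zero_sandwich) (rule trace_norm_nonneg, rule le)
next
  case (limit T)
  show ?case
  proof (rule LIMSEQ_I)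
    fix \<epsilon> :: real assume "\<epsilon> > 0"
    then have "\<epsilon> / 3 > 0" by simp
    from limit(2)[OF this] obtain S where S: "S \<in> trace_class" "trace_norm (T - S) \<le> \<epsilon> / 3"
      and SQ: "(\<lambda>n. trace_norm ((P o\<^sub>L S o\<^sub>L P) - (Q n o\<^sub>L S o\<^sub>L Q n))) \<longlonglongrightarrow> 0" by blast
    have D: "T - S \<in> trace_class" by (rule trace_class_diff[OF limit(1) S(1)])
    have c: "trace_norm (R o\<^sub>L (T - S) o\<^sub>L R) \<le> \<epsilon> / 3" if "sym_contraction R" for R
      using trace_norm_compress[OF that D] S(2) by linarith
    obtain N where N: "\<And>n. n \<ge> N \<Longrightarrow> trace_norm ((P o\<^sub>L S o\<^sub>L P) - (Q n o\<^sub>L S o\<^sub>L Q n)) < \<epsilon> / 3"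
      using LIMSEQ_D[OF SQ \<open>\<epsilon> / 3 > 0\<close>] by (auto simp: trace_norm_nonneg)
    have "trace_norm ((P o\<^sub>L T o\<^sub>L P) - (Q n o\<^sub>L T o\<^sub>L Q n)) < \<epsilon>" if "n \<ge> N" for n
    proof -
      \<comment> \<open>Two compressions of the small operator T - S, and between them the
        difference for S, which converges.\<close>
      have eq: "(P o\<^sub>L T o\<^sub>L P) - (Q n o\<^sub>L T o\<^sub>L Q n) = (P o\<^sub>L (T - S) o\<^sub>L P)
          + (((P o\<^sub>L S o\<^sub>L P) - (Q n o\<^sub>L S o\<^sub>L Q n)) + - (Q n o\<^sub>L (T - S) o\<^sub>L Q n))"
        unfolding compress_linear by simp
      note tc = trace_class_compress[OF P] trace_class_compress[OF Q]
      have "trace_norm ((P o\<^sub>L T o\<^sub>L P) - (Q n o\<^sub>L T o\<^sub>L Q n)) \<le> trace_norm (P o\<^sub>L (T - S) o\<^sub>L P)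
          + (trace_norm ((P o\<^sub>L S o\<^sub>L P) - (Q n o\<^sub>L S o\<^sub>L Q n)) + trace_norm (- (Q n o\<^sub>L (T - S) o\<^sub>L Q n)))"
        unfolding eq
        by (intro order_trans[OF trace_norm_triangle] add_left_mono trace_norm_triangle trace_class_add
            trace_class_diff trace_class_uminus tc D S(1))
      also have "trace_norm (- (Q n o\<^sub>L (T - S) o\<^sub>L Q n)) = trace_norm (Q n o\<^sub>L (T - S) o\<^sub>L Q n)"
        by (rule trace_norm_uminus[OF tc(2)[OF D]])
      finally show ?thesis using c[OF P] c[OF Q, of n] N[OF that] by linarith
    qed
    then show "\<exists>N. \<forall>n\<ge>N. norm (trace_norm ((P o\<^sub>L T o\<^sub>L P) - (Q n o\<^sub>L T o\<^sub>L Q n)) - 0) < \<epsilon>"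
      by (auto simp: trace_norm_nonneg)
  qed
qed

text \<open>Orthogonality of the residual determines the projected vector, so linearity is checked
  by verifying this condition for sums and multiples.\<close>

lemma exists_projection_operator:
  fixes V :: "'a::chilbert_space set"
  assumes V: "complex_vector.subspace V" "closed V"
  obtains P :: "'a \<Rightarrow>\<^sub>L 'a" where "sym_contraction P" "\<And>z. P z \<in> V" "\<And>z. z \<in> V \<Longrightarrow> P z = z"
    "\<And>z s. s \<in> V \<Longrightarrow> cinner (z - P z) s = 0"
proof -
  obtain p where p: "\<And>z. p z \<in> V" "\<And>z s. s \<in> V \<Longrightarrow> cinner s (z - p z) = 0"
    using exists_projection[OF V] by metis
  have p': "cinner (z - p z) s = 0" if "s \<in> V" for z s
    using p(2)[OF that, of z] by (metis cinner_commute complex_cnj_zero)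
  have uniq: "p z = y" if "y \<in> V" "\<And>s. s \<in> V \<Longrightarrow> cinner s (z - y) = 0" for y z
  proof -
    have d: "p z - y \<in> V" using p(1) that(1) by (rule complex_vector.subspace_diff[OF V(1)])
    have "cinner (p z - y) (p z - y) = cinner (p z - y) (z - y) - cinner (p z - y) (z - p z)"
      by (simp add: cinner.diff_right)
    also have "\<dots> = 0" using that(2)[OF d] p(2)[OF d] by simp
    finally show ?thesis by simp
  qed
  have add: "p (z + z') = p z + p z'" for z z'
  proof (rule uniq)
    show "p z + p z' \<in> V" by (intro complex_vector.subspace_add[OF V(1)] p(1))
    fix s assume s: "s \<in> V"
    have "z + z' - (p z + p z') = (z - p z) + (z' - p z')" by simp
    then show "cinner s (z + z' - (p z + p z')) = 0" using p(2)[OF s, of z] p(2)[OF s, of z'] by (simp only: cinner.add_right add_0)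
  qed
  have scale: "p (c *\<^sub>C z) = c *\<^sub>C p z" for c z
  proof (rule uniq)
    show "c *\<^sub>C p z \<in> V" by (intro complex_vector.subspace_scale[OF V(1)] p(1))
    fix s assume s: "s \<in> V"
    have "c *\<^sub>C z - c *\<^sub>C p z = c *\<^sub>C (z - p z)" by (simp only: scaleC.diff_right)
    then show "cinner s (c *\<^sub>C z - c *\<^sub>C p z) = 0" using p(2)[OF s, of z] by (simp only: cinner_scaleC_right mult_zero_right)
  qed
  have le: "norm (p z) \<le> norm z" for z
  proof -
    have "(norm z)\<^sup>2 = (norm (z - p z))\<^sup>2 + (norm (p z))\<^sup>2"
      using norm_sq_add[of "z - p z" "p z"] p'[OF p(1), of z z] by simp
    then have "(norm (p z))\<^sup>2 \<le> (norm z)\<^sup>2" by simp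
    then show ?thesis by (rule power2_le_imp_le) simp
  qed
  have "bounded_linear p"
    by (rule bounded_linear_intro[where K = 1]) (simp_all add: add scale scaleR_scaleC le)
  then have ap: "blinfun_apply (Blinfun p) = p" by (rule bounded_linear_Blinfun_apply)
  have sym: "cinner (p z) w = cinner z (p w)" for z w
    using p(2)[OF p(1), of z w] p'[OF p(1), of z w] by (simp add: cinner.diff_left cinner.diff_right)
  show thesis
  proof (rule that[of "Blinfun p"])
    show "sym_contraction (Blinfun p)"
      using sym le scale by (auto simp: sym_contraction_def ap intro!: clinear_opI)
    show "Blinfun p z = z" if "z \<in> V" for z unfolding ap using that by (intro uniq) (simp_all add: cinner.zero_right)
  qed (simp_all add: ap p(1) p')
qed

section \<open>The marginal defect\<close>

lemma psd_cone_iff: "closed V \<Longrightarrow> T \<in> psd_cone V \<longleftrightarrow> psd_op T \<and> (\<forall>z. T z \<in> V)"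
  using closure_subset[of "range (blinfun_apply T)"] closure_minimal[of "range (blinfun_apply T)" V]
  unfolding psd_cone_def supp_op_def by blast

lemma psd_op_zero: "psd_op 0"
  by (simp add: psd_op_def clinear_op_zero cinner.zero_left cinner.zero_right)

text \<open>With P the projection onto the span, D = P D, and by symmetry D = D P; hence D is given
  by its matrix in the family x.\<close>

lemma symmetric_finite_expansion:
  fixes D :: "'a::chilbert_space \<Rightarrow>\<^sub>L 'a"
  assumes fin: "finite I" and x: "onfam x I"
    and sym: "\<And>z w. cinner (D z) w = cinner z (D w)" and range: "\<And>z. D z \<in> complex_vector.span (x ` I)"
  shows "D = (\<Sum>i\<in>I. \<Sum>j\<in>I. scaleC_op (cinner (D (x j)) (x i)) (rank_one (x i) (x j)))"
proof (rule blinfun_eqI)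
  fix z
  have proj: "onproj x I (D w) = D w" for w by (rule onproj_span[OF fin x range])
  have "cinner (D z) (x i) = (\<Sum>j\<in>I. cinner (D (x j)) (x i) * cinner z (x j))" for i
  proof -
    have "cinner (D z) (x i) = cinner (onproj x I z) (D (x i))"
      by (simp add: sym cinner_onproj_commute proj)
    also have "\<dots> = (\<Sum>j\<in>I. cinner (D (x j)) (x i) * cinner z (x j))"
      by (simp add: cinner_onproj_left sym mult.commute)
    finally show ?thesis .
  qed
  then have "onproj x I (D z) = (\<Sum>i\<in>I. \<Sum>j\<in>I. (cinner (D (x j)) (x i) * cinner z (x j)) *\<^sub>C x i)"
    by (simp add: onproj_apply scaleC.sum_left)
  then show "D z = (\<Sum>i\<in>I. \<Sum>j\<in>I. scaleC_op (cinner (D (x j)) (x i)) (rank_one (x i) (x j))) z"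
    by (simp add: proj blinfun.sum_left scaleC_scaleC)
qed

text \<open>On a finite dimensional span matrix entries control the trace norm; this upgrades weak
  convergence of a minimising sequence to trace norm convergence.\<close>

lemma
  fixes D :: "'a::chilbert_space \<Rightarrow>\<^sub>L 'a"
  assumes fin: "finite I" and x: "onfam x I"
    and sym: "\<And>z w. cinner (D z) w = cinner z (D w)" and range: "\<And>z. D z \<in> complex_vector.span (x ` I)"
  shows trace_class_symmetric_finite: "D \<in> trace_class"
    and trace_norm_symmetric_finite: "trace_norm D \<le> (\<Sum>i\<in>I. \<Sum>j\<in>I. cmod (cinner (D (x j)) (x i)))"
proof -
  let ?t = "\<lambda>i j. scaleC_op (cinner (D (x j)) (x i)) (rank_one (x i) (x j))"
  have tc: "?t i j \<in> trace_class" for i j by (intro trace_class_scaleC trace_class_rank_one)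
  have eq: "D = (\<Sum>i\<in>I. \<Sum>j\<in>I. ?t i j)" by (rule symmetric_finite_expansion[OF assms])
  show "D \<in> trace_class" by (subst eq) (intro trace_class_sum tc)
  have le: "trace_norm (?t i j) \<le> cmod (cinner (D (x j)) (x i))" if "i \<in> I" "j \<in> I" for i j
  proof -
    have "trace_norm (?t i j) \<le> cmod (cinner (D (x j)) (x i)) * trace_norm (rank_one (x i) (x j))"
      by (rule trace_norm_scaleC[OF trace_class_rank_one])
    also have "\<dots> \<le> cmod (cinner (D (x j)) (x i)) * (norm (x i) * norm (x j))"
      by (intro mult_left_mono trace_norm_rank_one) simp
    finally show ?thesis using onfam_norm[OF x] that by simp
  qed
  have "trace_norm D = trace_norm (\<Sum>i\<in>I. \<Sum>j\<in>I. ?t i j)" using eq by simp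
  also have "\<dots> \<le> (\<Sum>i\<in>I. trace_norm (\<Sum>j\<in>I. ?t i j))" by (intro trace_norm_sum trace_class_sum tc)
  also have "\<dots> \<le> (\<Sum>i\<in>I. \<Sum>j\<in>I. trace_norm (?t i j))" by (intro sum_mono trace_norm_sum tc)
  also have "\<dots> \<le> (\<Sum>i\<in>I. \<Sum>j\<in>I. cmod (cinner (D (x j)) (x i)))" by (intro sum_mono le)
  finally show "trace_norm D \<le> (\<Sum>i\<in>I. \<Sum>j\<in>I. cmod (cinner (D (x j)) (x i)))" .
qed

section \<open>Limits in trace norm and marginals of weak limits\<close>

lemma trace_norm_abs_diff:
  assumes "S \<in> trace_class" "T \<in> trace_class"
  shows "\<bar>trace_norm S - trace_norm T\<bar> \<le> trace_norm (S - T)"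
  using trace_norm_triangle_sub[OF assms] trace_norm_triangle_sub[OF assms(2,1)]
    trace_norm_minus_commute[OF assms] by linarith

lemma
  fixes A :: "nat \<Rightarrow> 'a::chilbert_space \<Rightarrow>\<^sub>L 'a"
  assumes A: "\<And>k. A k \<in> trace_class" and A0: "A0 \<in> trace_class"
    and lim: "(\<lambda>k. trace_norm (A k - A0)) \<longlonglongrightarrow> 0"
  shows trace_norm_tendsto: "(\<lambda>k. trace_norm (A k)) \<longlonglongrightarrow> trace_norm A0"
    and trace_norm_tendsto_form: "(\<lambda>k. Re (cinner (A k a) a)) \<longlonglongrightarrow> Re (cinner (A0 a) a)"
proof -
  have "(\<lambda>k. \<bar>trace_norm (A k) - trace_norm A0\<bar>) \<longlonglongrightarrow> 0"
    by (rule tendsto_zero_sandwich[OF lim]) (rule abs_ge_zero, rule trace_norm_abs_diff[OF A A0])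
  then show "(\<lambda>k. trace_norm (A k)) \<longlonglongrightarrow> trace_norm A0"
    by (rule LIM_zero_cancel[OF tendsto_rabs_zero_cancel])
  have "(\<lambda>k. trace_norm (A k - A0) * norm a * norm a) \<longlonglongrightarrow> 0"
    using tendsto_mult_left_zero[OF tendsto_mult_left_zero[OF lim]] by simp
  then have "(\<lambda>k. \<bar>Re (cinner (A k a) a) - Re (cinner (A0 a) a)\<bar>) \<longlonglongrightarrow> 0"
  proof (rule tendsto_zero_sandwich)
    fix k
    have "\<bar>Re (cinner (A k a) a) - Re (cinner (A0 a) a)\<bar> \<le> cmod (cinner ((A k - A0) a) a)"
      using abs_Re_le_cmod[of "cinner ((A k - A0) a) a"] by (simp add: blinfun.diff_left cinner.diff_left)
    also have "\<dots> \<le> trace_norm (A k - A0) * norm a * norm a"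
      by (intro cmod_cinner_le_trace_norm trace_class_diff A A0)
    finally show "\<bar>Re (cinner (A k a) a) - Re (cinner (A0 a) a)\<bar> \<le> trace_norm (A k - A0) * norm a * norm a" .
  qed simp
  then show "(\<lambda>k. Re (cinner (A k a) a)) \<longlonglongrightarrow> Re (cinner (A0 a) a)"
    by (rule LIM_zero_cancel[OF tendsto_rabs_zero_cancel])
qed

text \<open>The form of the symmetric difference D vanishes; evaluated at a + D a it leaves twice
  the squared norm of D a.\<close>

lemma psd_op_eqI:
  fixes S T :: "'a::chilbert_space \<Rightarrow>\<^sub>L 'a"
  assumes S: "psd_op S" and T: "psd_op T"
    and eq: "\<And>a. norm a = 1 \<Longrightarrow> Re (cinner (S a) a) = Re (cinner (T a) a)"
  shows "S = T"
proof -
  define D where "D = S - T"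
  have lin: "clinear_op D" unfolding D_def by (intro clinear_op_diff psd_op_clinear S T)
  have sym: "cinner (D a) b = cinner a (D b)" for a b
    by (simp add: D_def blinfun.diff_left cinner.diff_left cinner.diff_right
        psd_op_symmetric[OF S] psd_op_symmetric[OF T])
  have q: "Re (cinner (D a) a) = 0" for a
  proof (cases "a = 0")
    case False
    define r where "r = 1 / norm a"
    have "norm (complex_of_real r *\<^sub>C a) = 1" using False by (simp add: r_def norm_scaleC norm_divide)
    from eq[OF this] have "Re (cinner (D (complex_of_real r *\<^sub>C a)) (complex_of_real r *\<^sub>C a)) = 0"
      by (simp add: D_def blinfun.diff_left cinner.diff_left)
    then have "r * (r * Re (cinner (D a) a)) = 0" by (simp add: clinear_op_scaleC[OF lin])
    then show ?thesis using False by (simp add: r_def)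
  qed (simp add: cinner.zero_right)
  have "D a = 0" for a
  proof -
    have c: "cinner (D (D a)) a = cinner (D a) (D a)" using sym[of "D a" a] by simp
    have "Re (cinner (D (a + D a)) (a + D a)) = 2 * Re (cinner (D a) (D a))"
      using q[of a] q[of "D a"] c by (simp add: blinfun.add_right cinner.add_left cinner.add_right)
    then have "Re (cinner (D a) (D a)) = 0" using q[of "a + D a"] by simp
    then show ?thesis by (simp add: cinner_self)
  qed
  then show ?thesis by (intro blinfun_eqI) (simp add: D_def blinfun.diff_left)
qed

text \<open>Convergence of the other marginal makes the sequence tight: mass outside a finite set \<open>G\<close> of
  basis vectors of the traced out factor is uniformly small, so none is lost in the weak limit.\<close>

lemma partial_trace2_weak_limit:
  fixes t :: "'a::chilbert_space \<Rightarrow> 'b::chilbert_space \<Rightarrow> 'c::chilbert_space"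
  assumes tensor: "hilbert_tensor t"
    and Y: "\<And>k. Y k \<in> trace_class" "\<And>k. psd_op (Y k)" and S: "S \<in> trace_class" "psd_op S"
    and \<rho>1: "\<rho>1 \<in> trace_class" "psd_op \<rho>1" and \<rho>2: "\<rho>2 \<in> trace_class" "psd_op \<rho>2"
    and weak: "\<And>a b. (\<lambda>k. cinner (Y k a) b) \<longlonglongrightarrow> cinner (S a) b"
    and lim1: "(\<lambda>k. trace_norm (partial_trace2 t (Y k) - \<rho>1)) \<longlonglongrightarrow> 0"
    and lim2: "(\<lambda>k. trace_norm (partial_trace1 t (Y k) - \<rho>2)) \<longlonglongrightarrow> 0"
  shows "partial_trace2 t S = \<rho>1"
proof (rule psd_op_eqI[OF partial_trace2_psd[OF tensor S] \<rho>1(2)])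
  note swap = hilbert_tensor_swap[OF tensor]
  note tc1 = partial_trace2_trace_class[OF swap, folded partial_trace1_swap]
  note tc2 = partial_trace2_trace_class[OF tensor]
  note tn1 = trace_norm_partial_trace2_psd[OF swap, folded partial_trace1_swap]
  obtain B :: "'b set" where B: "is_onb B" using onb_exists by blast
  fix a :: 'a assume a: "norm a = 1"
  let ?s = "\<lambda>f. Re (cinner (S (t a f)) (t a f))" and ?\<rho> = "\<lambda>f. Re (cinner (\<rho>2 f) f)"
  have l1: "(\<lambda>k. Re (cinner (partial_trace2 t (Y k) a) a)) \<longlonglongrightarrow> Re (cinner (\<rho>1 a) a)"
    by (intro trace_norm_tendsto_form tc2 Y \<rho>1 lim1)
  have l2: "(\<lambda>k. Re (cinner (partial_trace1 t (Y k) f) f)) \<longlonglongrightarrow> ?\<rho> f" for f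
    by (intro trace_norm_tendsto_form tc1 Y \<rho>2 lim2)
  have "(\<lambda>k. trace_norm (partial_trace1 t (Y k))) \<longlonglongrightarrow> trace_norm \<rho>2"
    by (intro trace_norm_tendsto tc1 Y \<rho>2 lim2)
  then have ltr: "(\<lambda>k. trace_norm (Y k)) \<longlonglongrightarrow> trace_norm \<rho>2" by (simp add: tn1 Y)
  have lG: "(\<lambda>k. \<Sum>f\<in>G. Re (cinner (Y k (t a f)) (t a f))) \<longlonglongrightarrow> sum ?s G" for G
    by (intro tendsto_sum tendsto_Re weak)
  have upper: "sum ?s G \<le> Re (cinner (\<rho>1 a) a)" if G: "finite G" "G \<subseteq> B" for G
  proof (rule LIMSEQ_le[OF lG l1])
    have "(\<Sum>f\<in>G. Re (cinner (Y k (t a f)) (t a f))) \<le> Re (cinner (partial_trace2 t (Y k) a) a)" for k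
      by (rule finite_sum_le_has_sum[OF has_sum_Re[OF partial_trace2_has_sum[OF tensor Y(1) B]] G])
        (rule psd_op_nonneg[OF Y(2)])
    then show "\<exists>N. \<forall>k\<ge>N. (\<Sum>f\<in>G. Re (cinner (Y k (t a f)) (t a f))) \<le> Re (cinner (partial_trace2 t (Y k) a) a)"
      by blast
  qed
  \<comment> \<open>The limit in k is taken for a fixed finite G. Only afterwards does G exhaust the
    basis, and then the bracket tends to zero.\<close>
  have lower: "Re (cinner (\<rho>1 a) a) \<le> sum ?s G + (trace_norm \<rho>2 - sum ?\<rho> G)" if G: "finite G" "G \<subseteq> B" for G
  proof (rule LIMSEQ_le[OF l1])
    show "(\<lambda>k. (\<Sum>f\<in>G. Re (cinner (Y k (t a f)) (t a f)))
        + (trace_norm (Y k) - (\<Sum>f\<in>G. Re (cinner (partial_trace1 t (Y k) f) f))))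
        \<longlonglongrightarrow> sum ?s G + (trace_norm \<rho>2 - sum ?\<rho> G)"
      by (intro tendsto_add tendsto_diff lG ltr tendsto_sum l2)
  qed (use partial_trace2_tail[OF tensor Y B G a] in blast)
  have sS: "(?s has_sum Re (cinner (partial_trace2 t S a) a)) B"
    by (rule has_sum_Re[OF partial_trace2_has_sum[OF tensor S(1) B]])
  have s\<rho>: "(?\<rho> has_sum trace_norm \<rho>2) B" by (rule psd_trace_has_sum[OF \<rho>2(2,1) B])
  have "Re (cinner (partial_trace2 t S a) a) \<le> Re (cinner (\<rho>1 a) a)"
    using sS upper by (rule has_sum_le_finite_sums)
  moreover have "Re (cinner (\<rho>1 a) a) \<le> Re (cinner (partial_trace2 t S a) a) + (trace_norm \<rho>2 - trace_norm \<rho>2)"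
  proof (rule tendsto_lowerbound)
    show "((\<lambda>G. sum ?s G + (trace_norm \<rho>2 - sum ?\<rho> G)) \<longlongrightarrow>
        Re (cinner (partial_trace2 t S a) a) + (trace_norm \<rho>2 - trace_norm \<rho>2)) (finite_subsets_at_top B)"
      using sS s\<rho> unfolding has_sum_def by (intro tendsto_add tendsto_diff tendsto_const)
  qed (auto intro!: eventually_finite_subsets_at_top_weakI lower)
  ultimately show "Re (cinner (partial_trace2 t S a) a) = Re (cinner (\<rho>1 a) a)" by simp
qed

lemma density_opsD:
  assumes "\<rho> \<in> density_ops"
  shows "psd_op \<rho>" "\<rho> \<in> trace_class" "trace_norm \<rho> = 1"
  using assms by (simp_all add: density_ops_iff)

lemma marginal_defect_nonneg: "0 \<le> marginal_defect t \<rho>1 \<rho>2 X"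
  by (simp add: marginal_defect_def trace_norm_nonneg)

lemma min_marginal_defect_le:
  "X \<in> psd_cone V \<Longrightarrow> min_marginal_defect t \<rho>1 \<rho>2 V \<le> marginal_defect t \<rho>1 \<rho>2 X"
  unfolding min_marginal_defect_def
  by (rule cINF_lower) (auto intro!: bdd_belowI2 marginal_defect_nonneg)

lemma psd_cone_zero: "complex_vector.subspace V \<Longrightarrow> closed V \<Longrightarrow> 0 \<in> psd_cone V"
  by (simp add: psd_cone_iff psd_op_zero complex_vector.subspace_0)

lemma min_marginal_defect_nonneg:
  "complex_vector.subspace V \<Longrightarrow> closed V \<Longrightarrow> 0 \<le> min_marginal_defect t \<rho>1 \<rho>2 V"
  unfolding min_marginal_defect_def
  using psd_cone_zero by (intro cINF_greatest marginal_defect_nonneg) blast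

section \<open>Finite dimensional spans of the basis of \<X>\<close>

context
  fixes x :: "nat \<Rightarrow> 'c::chilbert_space" and \<X> :: "'c set"
  assumes x: "onb_sequence_of x \<X>"
begin

lemma onfam_onb_sequence: "onfam x I"
  using x by (simp add: onb_sequence_of_def onfam_def)

lemma closed_span_onb_sequence: "closed (complex_vector.span (x ` {..<n}))"
  by (rule closed_span_onfam[OF _ onfam_onb_sequence]) simp

lemma span_onb_sequence_subset: "complex_vector.span (x ` {..<n}) \<subseteq> \<X>"
proof -
  have "complex_vector.span (x ` {..<n}) \<subseteq> complex_vector.span (range x)"
    by (rule complex_vector.span_mono) blast
  then show ?thesis using x closure_subset unfolding onb_sequence_of_def by blast
qed

lemma closed_subspace_onb_sequence: "complex_vector.subspace \<X>" "closed \<X>"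
  using x csubspace_closure[OF complex_vector.subspace_span, of "range x"]
  by (auto simp: onb_sequence_of_def)

lemma psd_cone_span_iff:
  "X \<in> psd_cone (complex_vector.span (x ` {..<n})) \<longleftrightarrow> psd_op X \<and> (\<forall>z. X z \<in> complex_vector.span (x ` {..<n}))"
  by (rule psd_cone_iff[OF closed_span_onb_sequence])

lemma psd_cone_span_trace_class:
  "X \<in> psd_cone (complex_vector.span (x ` {..<n})) \<Longrightarrow> X \<in> trace_class"
  unfolding psd_cone_span_iff
  by (intro trace_class_symmetric_finite[OF finite_lessThan onfam_onb_sequence]) (auto simp: psd_op_symmetric)

end

section \<open>The marginal defect: regularity, minimisers and couplings\<close>

context
  fixes t :: "'a::chilbert_space \<Rightarrow> 'b::chilbert_space \<Rightarrow> 'c::chilbert_space"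
    and \<rho>1 :: "'a \<Rightarrow>\<^sub>L 'a" and \<rho>2 :: "'b \<Rightarrow>\<^sub>L 'b"
  assumes tensor: "hilbert_tensor t" and \<rho>1: "\<rho>1 \<in> density_ops" and \<rho>2: "\<rho>2 \<in> density_ops"
begin

lemmas tensor_swap = hilbert_tensor_swap[OF tensor]
lemmas pt2_tc = partial_trace2_trace_class[OF tensor]
lemmas pt1_tc = partial_trace2_trace_class[OF tensor_swap, folded partial_trace1_swap]
lemmas pt2_add = partial_trace2_add[OF tensor]
lemmas pt1_add = partial_trace2_add[OF tensor_swap, folded partial_trace1_swap]
lemmas pt2_diff = partial_trace2_diff[OF tensor]
lemmas pt1_diff = partial_trace2_diff[OF tensor_swap, folded partial_trace1_swap]
lemmas pt2_scaleC = partial_trace2_scaleC[OF tensor]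
lemmas pt1_scaleC = partial_trace2_scaleC[OF tensor_swap, folded partial_trace1_swap]
lemmas pt2_norm = trace_norm_partial_trace2[OF tensor]
lemmas pt1_norm = trace_norm_partial_trace2[OF tensor_swap, folded partial_trace1_swap]
lemmas pt2_norm_psd = trace_norm_partial_trace2_psd[OF tensor]
lemmas pt1_norm_psd = trace_norm_partial_trace2_psd[OF tensor_swap, folded partial_trace1_swap]

text \<open>Each partial trace is a trace norm contraction and contributes one
  \<open>trace_norm (X - Y)\<close>, whence the factor 2.\<close>

lemma marginal_defect_lipschitz:
  assumes X: "X \<in> trace_class" and Y: "Y \<in> trace_class"
  shows "marginal_defect t \<rho>1 \<rho>2 X \<le> marginal_defect t \<rho>1 \<rho>2 Y + 2 * trace_norm (X - Y)"
proof -
  note d1 = density_opsD(2)[OF \<rho>1] and d2 = density_opsD(2)[OF \<rho>2]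
  have "trace_norm (partial_trace2 t X - \<rho>1) \<le> trace_norm (partial_trace2 t (X - Y)) + trace_norm (partial_trace2 t Y - \<rho>1)"
    using trace_norm_triangle_sub[OF trace_class_diff[OF pt2_tc[OF X] d1] trace_class_diff[OF pt2_tc[OF Y] d1]]
    by (simp add: pt2_diff[OF X Y])
  moreover have "trace_norm (partial_trace1 t X - \<rho>2) \<le> trace_norm (partial_trace1 t (X - Y)) + trace_norm (partial_trace1 t Y - \<rho>2)"
    using trace_norm_triangle_sub[OF trace_class_diff[OF pt1_tc[OF X] d2] trace_class_diff[OF pt1_tc[OF Y] d2]]
    by (simp add: pt1_diff[OF X Y])
  ultimately show ?thesis
    using pt2_norm[OF trace_class_diff[OF X Y]] pt1_norm[OF trace_class_diff[OF X Y]]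
    by (simp add: marginal_defect_def)
qed

text \<open>The defect is a sum of two norms, each composed with an affine map.\<close>

lemma marginal_defect_convex: "convex_on trace_class (marginal_defect t \<rho>1 \<rho>2)"
proof (rule convex_onI)
  show "convex (trace_class :: ('c \<Rightarrow>\<^sub>L 'c) set)"
    unfolding convex_def by (auto intro: trace_class_add trace_class_scaleR)
  have norm_conv: "trace_norm ((1 - u) *\<^sub>R A + u *\<^sub>R B) \<le> (1 - u) * trace_norm A + u * trace_norm B"
    if "A \<in> trace_class" "B \<in> trace_class" "0 < u" "u < 1" for A B :: "'d::chilbert_space \<Rightarrow>\<^sub>L 'd" and u
  proof -
    have s: "trace_norm (r *\<^sub>R C) \<le> r * trace_norm C" "r *\<^sub>R C \<in> trace_class"
      if "C \<in> trace_class" "0 < r" for C :: "'d \<Rightarrow>\<^sub>L 'd" and r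
      using trace_norm_scaleC[OF that(1), of "complex_of_real r"] trace_class_scaleC[OF that(1), of "complex_of_real r"]
        that(2) by (simp_all add: scaleC_op_of_real)
    show ?thesis
      using that by (intro order_trans[OF trace_norm_triangle] add_mono s) auto
  qed
  fix u :: real and X Y :: "'c \<Rightarrow>\<^sub>L 'c"
  assume u: "0 < u" "u < 1" and XY: "X \<in> trace_class" "Y \<in> trace_class"
  note d1 = density_opsD(2)[OF \<rho>1] and d2 = density_opsD(2)[OF \<rho>2]
  have scR: "partial_trace2 t (r *\<^sub>R Z) = r *\<^sub>R partial_trace2 t Z" "partial_trace1 t (r *\<^sub>R Z) = r *\<^sub>R partial_trace1 t Z"
    if "Z \<in> trace_class" for r Z
    using pt2_scaleC[OF that, of "complex_of_real r"] pt1_scaleC[OF that, of "complex_of_real r"]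
    by (simp_all add: scaleC_op_of_real)
  have lin2: "partial_trace2 t ((1 - u) *\<^sub>R X + u *\<^sub>R Y) = (1 - u) *\<^sub>R partial_trace2 t X + u *\<^sub>R partial_trace2 t Y"
    and lin1: "partial_trace1 t ((1 - u) *\<^sub>R X + u *\<^sub>R Y) = (1 - u) *\<^sub>R partial_trace1 t X + u *\<^sub>R partial_trace1 t Y"
    by (simp_all add: pt2_add pt1_add trace_class_scaleR XY scR)
  have e2: "partial_trace2 t ((1 - u) *\<^sub>R X + u *\<^sub>R Y) - \<rho>1
      = (1 - u) *\<^sub>R (partial_trace2 t X - \<rho>1) + u *\<^sub>R (partial_trace2 t Y - \<rho>1)"
    unfolding lin2 by (simp add: algebra_simps)
  have e1: "partial_trace1 t ((1 - u) *\<^sub>R X + u *\<^sub>R Y) - \<rho>2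
      = (1 - u) *\<^sub>R (partial_trace1 t X - \<rho>2) + u *\<^sub>R (partial_trace1 t Y - \<rho>2)"
    unfolding lin1 by (simp add: algebra_simps)
  show "marginal_defect t \<rho>1 \<rho>2 ((1 - u) *\<^sub>R X + u *\<^sub>R Y)
      \<le> (1 - u) * marginal_defect t \<rho>1 \<rho>2 X + u * marginal_defect t \<rho>1 \<rho>2 Y"
    unfolding marginal_defect_def e1 e2
    using norm_conv[OF trace_class_diff[OF pt2_tc[OF XY(1)] d1] trace_class_diff[OF pt2_tc[OF XY(2)] d1] u]
      norm_conv[OF trace_class_diff[OF pt1_tc[OF XY(1)] d2] trace_class_diff[OF pt1_tc[OF XY(2)] d2] u]
    by (simp add: algebra_simps)
qed

text \<open>Both marginals of a positive X have trace norm \<open>trace_norm X\<close> and both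
  targets have trace norm 1; the triangle inequalities for the two factors are added.\<close>

lemma trace_norm_le_marginal_defect:
  assumes X: "X \<in> trace_class" "psd_op X"
  shows "2 * trace_norm X \<le> 2 + marginal_defect t \<rho>1 \<rho>2 X"
  using trace_norm_triangle_sub[OF pt2_tc[OF X(1)] density_opsD(2)[OF \<rho>1]]
    trace_norm_triangle_sub[OF pt1_tc[OF X(1)] density_opsD(2)[OF \<rho>2]]
  by (simp add: marginal_defect_def density_opsD[OF \<rho>1] density_opsD[OF \<rho>2]
      pt1_norm_psd[OF X] pt2_norm_psd[OF X])

lemma marginal_defect_zero: "marginal_defect t \<rho>1 \<rho>2 0 = 2"
proof -
  have "partial_trace2 t 0 = 0" "partial_trace1 t 0 = 0"
    using pt2_diff[OF trace_class_zero trace_class_zero] pt1_diff[OF trace_class_zero trace_class_zero] by simp_all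
  then show ?thesis
    using density_opsD[OF \<rho>1] density_opsD[OF \<rho>2] by (simp add: marginal_defect_def trace_norm_uminus)
qed

context
  fixes x :: "nat \<Rightarrow> 'c" and \<X> :: "'c set"
  assumes x: "onb_sequence_of x \<X>"
begin

lemmas onfam_x = onfam_onb_sequence[OF x]
lemmas closed_span_x = closed_span_onb_sequence[OF x]
lemmas span_x_subset = span_onb_sequence_subset[OF x]
lemmas closed_subspace_X = closed_subspace_onb_sequence[OF x]
lemmas psd_cone_x_iff = psd_cone_span_iff[OF x]
lemmas psd_cone_x_trace_class = psd_cone_span_trace_class[OF x]

text \<open>The span is finite dimensional, so a bounded minimising sequence has a subsequence
  converging in trace norm, for which the defect is continuous. The bound is on the trace norm,
  which dominates the operator norm.\<close>

lemma min_marginal_defect_attained: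
  "\<exists>X\<in>psd_cone (complex_vector.span (x ` {..<n})).
     marginal_defect t \<rho>1 \<rho>2 X = min_marginal_defect t \<rho>1 \<rho>2 (complex_vector.span (x ` {..<n})) \<and>
     trace_norm X \<le> 2"
proof -
  let ?V = "complex_vector.span (x ` {..<n})"
  define m where "m = min_marginal_defect t \<rho>1 \<rho>2 ?V"
  have zero: "0 \<in> psd_cone ?V" by (rule psd_cone_zero[OF complex_vector.subspace_span closed_span_x])
  have m2: "m \<le> 2" using min_marginal_defect_le[OF zero, of t \<rho>1 \<rho>2] by (simp add: m_def marginal_defect_zero)
  have bdd: "bdd_below (marginal_defect t \<rho>1 \<rho>2 ` psd_cone ?V)"
    by (auto intro!: bdd_belowI2 marginal_defect_nonneg)
  have "\<exists>Y\<in>psd_cone ?V. marginal_defect t \<rho>1 \<rho>2 Y < m + 1 / real (Suc k)" for k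
    using cINF_less_iff[OF _ bdd, of "m + 1 / real (Suc k)"] zero
    by (auto simp: m_def min_marginal_defect_def)
  then obtain Y where Y: "\<And>k. Y k \<in> psd_cone ?V"
    and Ym: "\<And>k. marginal_defect t \<rho>1 \<rho>2 (Y k) < m + 1 / real (Suc k)" by metis
  note Ytc = psd_cone_x_trace_class[OF Y]
  have Ypsd: "psd_op (Y k)" and Yrange: "Y k z \<in> ?V" for k z using Y[of k] by (auto simp: psd_cone_x_iff)
  \<comment> \<open>A minimum of at most 2 and a slack of at most 1 give defect at most 3 and hence
    trace at most 5/2; the precise bound does not matter here.\<close>
  have "norm (Y k) \<le> 3" for k
  proof -
    have "1 / real (Suc k) \<le> 1" by simp
    then have "marginal_defect t \<rho>1 \<rho>2 (Y k) \<le> 3" using Ym[of k] m2 by linarith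
    then show ?thesis
      using trace_norm_le_marginal_defect[OF Ytc Ypsd, of k] norm_le_trace_norm[OF Ytc, of k] by linarith
  qed
  note Ybd = this
  have YX: "Y k z \<in> \<X>" for k z using Yrange span_x_subset by blast
  obtain r S where r: "strict_mono (r :: nat \<Rightarrow> nat)" and S: "psd_op S"
    and lim: "\<And>a b. (\<lambda>k. cinner (Y (r k) a) b) \<longlonglongrightarrow> cinner (S a) b"
  proof (rule psd_weak_subsequence[where Y = Y, OF x Ypsd Ybd YX], goal_cases)
    case (1 r S)
    show ?case by (rule 1(1)[OF 1(2,3,5)])
  qed
  \<comment> \<open>The span is weakly closed: whatever is orthogonal to it stays orthogonal to the
    limit.\<close>
  have S_range: "S z \<in> ?V" for z
  proof -
    have "cinner (S z - onproj x {..<n} (S z)) w = 0" for w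
    proof -
      let ?w = "w - onproj x {..<n} w"
      have "cinner (Y (r k) z) ?w = 0" for k
        using onproj_orthogonal[OF finite_lessThan onfam_x Yrange, of w] by (metis cinner_commute complex_cnj_zero)
      then have "(\<lambda>k. cinner (Y (r k) z) ?w) \<longlonglongrightarrow> 0" by simp
      then have "cinner (S z) ?w = 0" using LIMSEQ_unique lim by blast
      then show ?thesis by (simp add: cinner.diff_left cinner.diff_right cinner_onproj_commute)
    qed
    then have "S z - onproj x {..<n} (S z) = 0" using cinner_self_eq_0 by blast
    then have "S z = onproj x {..<n} (S z)" by simp
    then show ?thesis using onproj_in_span[of x "{..<n}" "S z"] by simp
  qed
  have S_cone: "S \<in> psd_cone ?V" using S S_range by (simp add: psd_cone_x_iff)
  note Stc = psd_cone_x_trace_class[OF S_cone]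
  have lim_tn: "(\<lambda>k. trace_norm (S - Y (r k))) \<longlonglongrightarrow> 0"
  proof (rule tendsto_zero_sandwich[OF _ trace_norm_nonneg])
    let ?D = "\<lambda>k. S - Y (r k)"
    show "trace_norm (?D k) \<le> (\<Sum>i<n. \<Sum>j<n. cmod (cinner (?D k (x j)) (x i)))" for k
    proof (rule trace_norm_symmetric_finite[OF _ onfam_x])
      show "cinner (?D k z) w = cinner z (?D k w)" for z w
        by (simp add: blinfun.diff_left cinner.diff_left cinner.diff_right psd_op_symmetric[OF S]
            psd_op_symmetric[OF Ypsd])
      show "?D k z \<in> ?V" for z
        using complex_vector.span_diff[OF S_range Yrange] by (simp add: blinfun.diff_left)
    qed simp
    have "(\<lambda>k. \<Sum>i<n. \<Sum>j<n. cmod (cinner (S (x j)) (x i) - cinner (Y (r k) (x j)) (x i)))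
        \<longlonglongrightarrow> (\<Sum>i<n. \<Sum>j<n. cmod (cinner (S (x j)) (x i) - cinner (S (x j)) (x i)))"
      by (intro tendsto_sum tendsto_norm tendsto_diff tendsto_const lim)
    then show "(\<lambda>k. \<Sum>i<n. \<Sum>j<n. cmod (cinner (?D k (x j)) (x i))) \<longlonglongrightarrow> 0"
      by (simp add: blinfun.diff_left cinner.diff_left)
  qed
  have "(\<lambda>k. (m + 1 / real (Suc k)) + 2 * trace_norm (S - Y (r k))) \<longlonglongrightarrow> (m + 0) + 2 * 0"
    by (intro tendsto_intros lim_tn LIMSEQ_inverse_real_of_nat[unfolded inverse_eq_divide])
  moreover have "marginal_defect t \<rho>1 \<rho>2 S \<le> (m + 1 / real (Suc k)) + 2 * trace_norm (S - Y (r k))" for k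
  proof -
    \<comment> \<open>The subsequence can only improve the slack, so the bound in terms of k
      persists.\<close>
    have "k \<le> r k" by (rule seq_suble[OF r])
    then have "1 / real (Suc (r k)) \<le> 1 / real (Suc k)" by (intro divide_left_mono) auto
    then show ?thesis using Ym[of "r k"] marginal_defect_lipschitz[OF Stc Ytc, of "r k"] by linarith
  qed
  ultimately have "marginal_defect t \<rho>1 \<rho>2 S \<le> m + 0 + 2 * 0"
    by (intro LIMSEQ_le_const) auto
  then have Sm: "marginal_defect t \<rho>1 \<rho>2 S = m" using min_marginal_defect_le[OF S_cone, of t \<rho>1 \<rho>2] by (simp add: m_def)
  \<comment> \<open>At the minimiser the slack is gone, and \<open>2 * trace_norm S\<close> is at
    most 2 + m, hence at most 4.\<close>
  then have "trace_norm S \<le> 2" using trace_norm_le_marginal_defect[OF Stc S] m2 by linarith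
  with Sm S_cone show ?thesis unfolding m_def by blast
qed

text \<open>The compressions of \<rho> are admissible competitors, and by the Lipschitz estimate
  their defects are at most twice their trace norm distance from \<rho>, whose own defect is
  zero.\<close>

lemma min_marginal_defect_tendsto_zero:
  assumes \<rho>: "\<rho> \<in> density_ops" "supp_op \<rho> \<subseteq> \<X>"
    and marg: "partial_trace2 t \<rho> = \<rho>1" "partial_trace1 t \<rho> = \<rho>2"
  shows "(\<lambda>n. min_marginal_defect t \<rho>1 \<rho>2 (complex_vector.span (x ` {..<n}))) \<longlonglongrightarrow> 0"
proof -
  note psd = density_opsD(1)[OF \<rho>(1)] and tc = density_opsD(2)[OF \<rho>(1)]
  define Q where "Q n = onproj x {..<n}" for n
  have Q: "sym_contraction (Q n)" for n unfolding Q_def by (intro sym_contraction_onproj onfam_x) simp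
  obtain P :: "'c \<Rightarrow>\<^sub>L 'c" where P: "sym_contraction P" "\<And>z. P z \<in> \<X>" "\<And>z. z \<in> \<X> \<Longrightarrow> P z = z"
    "\<And>z s. s \<in> \<X> \<Longrightarrow> cinner (z - P z) s = 0"
    using exists_projection_operator[OF closed_subspace_X] by metis
  have \<rho>X: "\<rho> z \<in> \<X>" for z using \<rho>(2) closure_subset[of "range (blinfun_apply \<rho>)"] by (auto simp: supp_op_def)
  \<comment> \<open>Since \<rho> maps into \<X> and is symmetric, it also annihilates the orthogonal
    complement; this removes the right factor P.\<close>
  have PP: "P o\<^sub>L \<rho> o\<^sub>L P = \<rho>"
  proof (intro blinfun_eqI cinner_ext)
    fix z w
    have "cinner (\<rho> (P z)) w = cinner (P z) (\<rho> w)" by (rule psd_op_symmetric[OF psd])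
    also have "\<dots> = cinner z (\<rho> w)" using P(4)[OF \<rho>X, of z w] by (simp add: cinner.diff_left)
    finally show "cinner ((P o\<^sub>L \<rho> o\<^sub>L P) z) w = cinner (\<rho> z) w"
      by (simp add: P(3) \<rho>X psd_op_symmetric[OF psd])
  qed
  \<comment> \<open>Q n z is a partial sum of the Fourier series of P z, because P z and z have the
    same coefficients along x.\<close>
  have Qlim: "(\<lambda>n. Q n z) \<longlonglongrightarrow> P z" for z
  proof -
    have "P z \<in> closure (complex_vector.span (range x))" using P(2) x by (simp add: onb_sequence_of_def)
    from fourier_has_sum[OF onfam_x this]
    have "(\<lambda>i. cinner (P z) (x i) *\<^sub>C x i) sums P z" by (rule has_sum_imp_sums)
    moreover have "cinner (P z) (x i) = cinner z (x i)" for i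
    proof -
      have "x i \<in> \<X>"
        using x closure_subset complex_vector.span_base[of "x i" "range x"] unfolding onb_sequence_of_def by blast
      from P(4)[OF this, of z] show ?thesis by (simp add: cinner.diff_left)
    qed
    ultimately show ?thesis by (simp add: sums_def Q_def onproj_apply)
  qed
  have lim: "(\<lambda>n. trace_norm (\<rho> - (Q n o\<^sub>L \<rho> o\<^sub>L Q n))) \<longlonglongrightarrow> 0"
    using compress_tendsto[OF tc P(1) Q Qlim] by (simp only: PP)
  have "(\<lambda>n. 2 * trace_norm (\<rho> - (Q n o\<^sub>L \<rho> o\<^sub>L Q n))) \<longlonglongrightarrow> 0"
    using tendsto_mult_right_zero[OF lim] by simp
  then show ?thesis
  proof (rule tendsto_zero_sandwich)
    fix n
    let ?V = "complex_vector.span (x ` {..<n})" and ?R = "Q n o\<^sub>L \<rho> o\<^sub>L Q n"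
    show "0 \<le> min_marginal_defect t \<rho>1 \<rho>2 ?V"
      by (rule min_marginal_defect_nonneg[OF complex_vector.subspace_span closed_span_x])
    have Rtc: "?R \<in> trace_class" by (rule trace_class_compress[OF Q tc])
    have q: "cinner (Q n z) w = cinner z (Q n w)" for z w using Q[of n] by (simp add: sym_contraction_def)
    have "psd_op ?R"
      unfolding psd_op_def
    proof (intro conjI allI trace_class_clinear[OF Rtc])
      show "cinner (?R z) w = cinner z (?R w)" for z w by (simp add: q psd_op_symmetric[OF psd])
      show "0 \<le> Re (cinner (?R z) z)" for z using psd_op_nonneg[OF psd, of "Q n z"] by (simp add: q)
    qed
    then have "?R \<in> psd_cone ?V" by (simp add: psd_cone_x_iff Q_def onproj_in_span)
    then have "min_marginal_defect t \<rho>1 \<rho>2 ?V \<le> marginal_defect t \<rho>1 \<rho>2 ?R" by (rule min_marginal_defect_le)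
    also have "\<dots> \<le> marginal_defect t \<rho>1 \<rho>2 \<rho> + 2 * trace_norm (?R - \<rho>)"
      by (rule marginal_defect_lipschitz[OF Rtc tc])
    also have "marginal_defect t \<rho>1 \<rho>2 \<rho> = 0" by (simp add: marginal_defect_def marg trace_norm_zero)
    also have "trace_norm (?R - \<rho>) = trace_norm (\<rho> - ?R)" by (rule trace_norm_minus_commute[OF Rtc tc])
    finally show "min_marginal_defect t \<rho>1 \<rho>2 ?V \<le> 2 * trace_norm (\<rho> - ?R)" by simp
  qed
qed

text \<open>Positivity, range and trace class pass to the weak limit directly. That its trace is 1
  is known only once its marginal has been identified with \<rho>1.\<close>

lemma coupling_exists_of_tendsto_zero:
  assumes lim: "(\<lambda>n. min_marginal_defect t \<rho>1 \<rho>2 (complex_vector.span (x ` {..<n}))) \<longlonglongrightarrow> 0"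
  shows "\<exists>\<rho>\<in>density_ops. supp_op \<rho> \<subseteq> \<X> \<and> partial_trace2 t \<rho> = \<rho>1 \<and> partial_trace1 t \<rho> = \<rho>2"
proof -
  obtain X where X: "\<And>n. X n \<in> psd_cone (complex_vector.span (x ` {..<n}))"
    and Xm: "\<And>n. marginal_defect t \<rho>1 \<rho>2 (X n) = min_marginal_defect t \<rho>1 \<rho>2 (complex_vector.span (x ` {..<n}))"
    and X2: "\<And>n. trace_norm (X n) \<le> 2"
    using min_marginal_defect_attained by metis
  note Xtc = psd_cone_x_trace_class[OF X]
  have Xpsd: "psd_op (X n)" and Xrange: "X n z \<in> \<X>" for n z
    using X[of n] span_x_subset[of n] by (auto simp: psd_cone_x_iff)
  have bd: "norm (X n) \<le> 2" for n using norm_le_trace_norm[OF Xtc, of n] X2[of n] by linarith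
  obtain r S where r: "strict_mono (r :: nat \<Rightarrow> nat)" and S: "psd_op S" "\<And>z. S z \<in> \<X>"
    and weak: "\<And>a b. (\<lambda>k. cinner (X (r k) a) b) \<longlonglongrightarrow> cinner (S a) b"
  proof (rule psd_weak_subsequence[where Y = X, OF x Xpsd bd Xrange], goal_cases)
    case (1 r S)
    show ?case by (rule 1(1)[OF 1(2-5)])
  qed
  \<comment> \<open>Lower semicontinuity: every test sum involves finitely many weakly convergent
    entries and inherits the uniform bound.\<close>
  have "S \<in> trace_class \<and> trace_norm S \<le> 2"
  proof (rule trace_classI[OF psd_op_clinear[OF S(1)]])
    fix n :: nat and e f :: "nat \<Rightarrow> 'c" assume ef: "onfam e {..<n}" "onfam f {..<n}"
    have "(\<lambda>k. \<Sum>i<n. cmod (cinner (X (r k) (e i)) (f i))) \<longlonglongrightarrow> (\<Sum>i<n. cmod (cinner (S (e i)) (f i)))"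
      by (intro tendsto_sum tendsto_norm weak)
    moreover have "(\<Sum>i<n. cmod (cinner (X (r k) (e i)) (f i))) \<le> 2" for k
      using trace_norm_onfam[OF Xtc _ ef, of "r k"] X2[of "r k"] by simp
    ultimately show "(\<Sum>i<n. cmod (cinner (S (e i)) (f i))) \<le> 2"
      by (intro LIMSEQ_le_const2) auto
  qed
  then have Stc: "S \<in> trace_class" by simp
  have "(\<lambda>k. marginal_defect t \<rho>1 \<rho>2 (X (r k))) \<longlonglongrightarrow> 0"
    using LIMSEQ_subseq_LIMSEQ[OF lim r] by (simp add: o_def Xm)
  then have lim2: "(\<lambda>k. trace_norm (partial_trace2 t (X (r k)) - \<rho>1)) \<longlonglongrightarrow> 0"
    and lim1: "(\<lambda>k. trace_norm (partial_trace1 t (X (r k)) - \<rho>2)) \<longlonglongrightarrow> 0"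
    by (rule tendsto_zero_sandwich; simp add: marginal_defect_def trace_norm_nonneg)+
  note d1 = density_opsD[OF \<rho>1] and d2 = density_opsD[OF \<rho>2]
  have m2: "partial_trace2 t S = \<rho>1"
    by (rule partial_trace2_weak_limit[OF tensor Xtc Xpsd Stc S(1) d1(2,1) d2(2,1) weak lim2 lim1])
  \<comment> \<open>Exchanging the factors twice gives back t, so the weak limit lemma applies again
    with the marginals in the other order.\<close>
  have pt_swap: "partial_trace1 (\<lambda>y x. t x y) = partial_trace2 t" by (rule partial_trace1_swap)
  have m1: "partial_trace1 t S = \<rho>2"
    unfolding partial_trace1_swap[of t]
  proof (rule partial_trace2_weak_limit[OF tensor_swap Xtc Xpsd Stc S(1) d2(2,1) d1(2,1) weak])
    show "(\<lambda>k. trace_norm (partial_trace2 (\<lambda>y x. t x y) (X (r k)) - \<rho>2)) \<longlonglongrightarrow> 0"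
      using lim1 unfolding partial_trace1_swap[of t] .
    show "(\<lambda>k. trace_norm (partial_trace1 (\<lambda>y x. t x y) (X (r k)) - \<rho>1)) \<longlonglongrightarrow> 0"
      using lim2 unfolding pt_swap .
  qed
  have "trace_norm S = 1" using pt2_norm_psd[OF Stc S(1)] m2 d1(3) by simp
  then have "S \<in> density_ops" using S(1) Stc by (simp add: density_ops_iff)
  moreover have "supp_op S \<subseteq> \<X>"
    unfolding supp_op_def using S(2) by (intro closure_minimal closed_subspace_X) auto
  ultimately show ?thesis using m1 m2 by blast
qed

end

end

theorem theorem1p3:
  fixes t :: "'a :: chilbert_space \<Rightarrow> 'b :: chilbert_space \<Rightarrow> 'c :: chilbert_space"
    and \<rho>1 :: "'a \<Rightarrow>\<^sub>L 'a" and \<rho>2 :: "'b \<Rightarrow>\<^sub>L 'b"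
    and \<X> :: "'c set" and x :: "nat \<Rightarrow> 'c"
  assumes "separable_space (euclidean :: 'a topology)"
    and "separable_space (euclidean :: 'b topology)"
    and "infinite_dimensional (UNIV :: 'a set)"
    and "infinite_dimensional (UNIV :: 'b set)"
    and "hilbert_tensor t"
    and "\<rho>1 \<in> density_ops" and "\<rho>2 \<in> density_ops"
    and "complex_vector.subspace \<X>" and "closed \<X>" and "infinite_dimensional \<X>"
    and "onb_sequence_of x \<X>"
  shows "(\<forall>X\<in>trace_class. 0 \<le> marginal_defect t \<rho>1 \<rho>2 X) \<and>
    convex_on trace_class (marginal_defect t \<rho>1 \<rho>2) \<and>
    (\<exists>L. \<forall>X\<in>trace_class. \<forall>Y\<in>trace_class.
       \<bar>marginal_defect t \<rho>1 \<rho>2 X - marginal_defect t \<rho>1 \<rho>2 Y\<bar> \<le> L * trace_norm (X - Y)) \<and>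
    (\<forall>n. \<exists>X\<in>psd_cone (complex_vector.span (x ` {..<n})).
       marginal_defect t \<rho>1 \<rho>2 X
         = min_marginal_defect t \<rho>1 \<rho>2 (complex_vector.span (x ` {..<n})) \<and>
       norm X \<le> 2) \<and>
    ((\<exists>\<rho>\<in>density_ops. supp_op \<rho> \<subseteq> \<X> \<and> partial_trace2 t \<rho> = \<rho>1 \<and> partial_trace1 t \<rho> = \<rho>2)
      \<longleftrightarrow> (\<lambda>n. min_marginal_defect t \<rho>1 \<rho>2 (complex_vector.span (x ` {..<n}))) \<longlonglongrightarrow> 0)"
proof (intro conjI)
  note asm = assms(5-7) and x = assms(11)
  show "\<forall>X\<in>trace_class. 0 \<le> marginal_defect t \<rho>1 \<rho>2 X"
    using marginal_defect_nonneg by blast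
  show "convex_on trace_class (marginal_defect t \<rho>1 \<rho>2)" by (rule marginal_defect_convex[OF asm])
  show "\<exists>L. \<forall>X\<in>trace_class. \<forall>Y\<in>trace_class.
       \<bar>marginal_defect t \<rho>1 \<rho>2 X - marginal_defect t \<rho>1 \<rho>2 Y\<bar> \<le> L * trace_norm (X - Y)"
  proof (intro exI ballI)
    fix X Y :: "'c \<Rightarrow>\<^sub>L 'c" assume XY: "X \<in> trace_class" "Y \<in> trace_class"
    show "\<bar>marginal_defect t \<rho>1 \<rho>2 X - marginal_defect t \<rho>1 \<rho>2 Y\<bar> \<le> 2 * trace_norm (X - Y)"
      using marginal_defect_lipschitz[OF asm XY] marginal_defect_lipschitz[OF asm XY(2,1)]
        trace_norm_minus_commute[OF XY] by linarith
  qed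
  show "\<forall>n. \<exists>X\<in>psd_cone (complex_vector.span (x ` {..<n})).
       marginal_defect t \<rho>1 \<rho>2 X
         = min_marginal_defect t \<rho>1 \<rho>2 (complex_vector.span (x ` {..<n})) \<and>
       norm X \<le> 2"
  proof
    fix n
    obtain X where X: "X \<in> psd_cone (complex_vector.span (x ` {..<n}))"
      "marginal_defect t \<rho>1 \<rho>2 X = min_marginal_defect t \<rho>1 \<rho>2 (complex_vector.span (x ` {..<n}))"
      "trace_norm X \<le> 2"
      using min_marginal_defect_attained[OF asm x] by blast
    then show "\<exists>X\<in>psd_cone (complex_vector.span (x ` {..<n})).
       marginal_defect t \<rho>1 \<rho>2 X
         = min_marginal_defect t \<rho>1 \<rho>2 (complex_vector.span (x ` {..<n})) \<and>
       norm X \<le> 2"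
      using norm_le_trace_norm[OF psd_cone_span_trace_class[OF x X(1)]] by (intro bexI[of _ X]) auto
  qed
  show "(\<exists>\<rho>\<in>density_ops. supp_op \<rho> \<subseteq> \<X> \<and> partial_trace2 t \<rho> = \<rho>1 \<and> partial_trace1 t \<rho> = \<rho>2)
      \<longleftrightarrow> (\<lambda>n. min_marginal_defect t \<rho>1 \<rho>2 (complex_vector.span (x ` {..<n}))) \<longlonglongrightarrow> 0"
    using min_marginal_defect_tendsto_zero[OF asm x] coupling_exists_of_tendsto_zero[OF asm x] by blast
qed

end
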